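(* Let $d\ge1$, $0\le\alpha<1/2$, and let $\{\xi_{i,n}:1\le i\le d,\ n\in\mathbb{N}\}$ be independent $\{0,1\}$-valued random variables on a probability space $\Omega$ with $\mathbb{P}(\xi_{i,n}=1)=n^{-\alpha}$. Then there is a set of probability $1$ in $\Omega$ such that every $\omega$ in this set has the following property: if $\{\vec a_k:k\in\mathbb{N}\}$ is an enumeration of the set $\{\vec n\in\mathbb{N}^d:\xi_{i,n_i}(\omega)=1\text{ for all }i\}$ with $|\vec a_k|$ nondecreasing, then for any measure-preserving $\mathbb{Z}^d$-action $\mathcal{T}$ on a probability space $X$ and any $f\in L^1(X)$, the averages $$A_Nf(x):=\frac1N\sum_{k=1}^N f\circ\mathcal{T}(\vec a_k)(x)$$ converge a.e. in $X$ as $N\to\infty$.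
   Context: $\mathbb{N}=\{1,2,3,\dots\}$ and $|\cdot|$ is the Euclidean norm. A measure-preserving $\mathbb{Z}^d$-action $\mathcal{T}$ assigns to each $\vec n\in\mathbb{Z}^d$ a measure-preserving transformation $\mathcal{T}(\vec n)$ of $X$ with $\mathcal{T}(\vec n)\circ\mathcal{T}(\vec m)=\mathcal{T}(\vec n+\vec m)$. *)

theory Defs
  imports "HOL-Probability.Probability"
begin

text \<open>
  Multi-indices are vectors of type \<open>int ^ 'd\<close>, where the finite type \<open>'d\<close> plays the role
  of \<open>{1..d}\<close>. Natural numbers start at \<open>1\<close> here, so sequences are
  only used at indices in \<open>{1..}\<close>.
\<close>

definition euclid_norm :: "int ^ 'd::finite \<Rightarrow> real" where
  "euclid_norm n = norm (\<chi> i. real_of_int (n $ i))"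

text \<open>
  The composition law is all that is required; \<open>T 0\<close> is not assumed to be the identity.
\<close>

definition measure_preserving_action ::
    "'x measure \<Rightarrow> (int ^ 'd::finite \<Rightarrow> 'x \<Rightarrow> 'x) \<Rightarrow> bool" where
  "measure_preserving_action M T \<longleftrightarrow>
     (\<forall>n. T n \<in> measurable M M \<and> distr M M (T n) = M) \<and>
     (\<forall>n m. \<forall>x\<in>space M. T n (T m x) = T (n + m) x)"

definition ergodic_average ::
    "(nat \<Rightarrow> int ^ 'd::finite) \<Rightarrow> (int ^ 'd \<Rightarrow> 'x \<Rightarrow> 'x) \<Rightarrow> ('x \<Rightarrow> complex) \<Rightarrow> nat \<Rightarrow> 'x \<Rightarrow> complex" where
  "ergodic_average a T f N x = (1 / of_nat N) * (\<Sum>k=1..N. f (T (a k) x))"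

definition L1_averages_converge :: "(nat \<Rightarrow> int ^ 'd::finite) \<Rightarrow> 'x measure \<Rightarrow> bool" where
  "L1_averages_converge a M \<longleftrightarrow>
     (\<forall>T f. measure_preserving_action M T \<longrightarrow> integrable M f \<longrightarrow>
        (AE x in M. convergent (\<lambda>N. ergodic_average a T f N x)))"

definition random_set :: "('d::finite \<Rightarrow> nat \<Rightarrow> 'w \<Rightarrow> real) \<Rightarrow> 'w \<Rightarrow> (int ^ 'd) set" where
  "random_set \<xi> \<omega> = {n. \<forall>i. n $ i \<ge> 1 \<and> \<xi> i (nat (n $ i)) \<omega> = 1}"

definition norm_ordered_enumeration ::
    "(nat \<Rightarrow> int ^ 'd::finite) \<Rightarrow> (int ^ 'd) set \<Rightarrow> bool" where
  "norm_ordered_enumeration a S \<longleftrightarrow>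
     bij_betw a {1..} S \<and> mono_on {1..} (\<lambda>k. euclid_norm (a k))"

text \<open>
  The exceptional null set must not depend on the probability space \<open>X\<close>, but a
  quantifier inside a formula ranges only over measures on a single type. So the good set
  of outcomes is pinned down, independently of the type carrying \<open>X\<close>, by testing on the
  function type \<open>int ^ 'd \<Rightarrow> complex\<close> (which carries every process
  \<open>n \<mapsto> f \<circ> T n\<close>); that every outcome in it works for probability spaces on all other
  types has to be asserted separately wherever this set is used.
\<close>

definition good_outcomes :: "'w measure \<Rightarrow> ('d::finite \<Rightarrow> nat \<Rightarrow> 'w \<Rightarrow> real) \<Rightarrow> 'w set" where
  "good_outcomes P \<xi> =
     {\<omega> \<in> space P. \<forall>a. norm_ordered_enumeration a (random_set \<xi> \<omega>) \<longrightarrow>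
        (\<forall>M :: (int ^ 'd \<Rightarrow> complex) measure. prob_space M \<longrightarrow> L1_averages_converge a M)}"

end

(*
  Write beta = 1 - alpha. The random averages over dyadic boxes [1,2^j]^d are compared with the
  averages with the deterministic weights n_1^(-alpha) ... n_d^(-alpha). By Chernoff bounds and
  Borel-Cantelli, almost surely the one-dimensional correlations sum_n xi_n xi_(n+h) are close to
  their expectations uniformly in h <> 0; this needs alpha < 1/2. Hence the autocorrelation of the
  difference of the two kernels is, off the coordinate subspaces, smaller than that of an average
  by a power of 2^(-j).

  The weak type (1,1) inequality for the random averages follows the method of Fefferman and
  Christ, directly on X: at scale j one discards the part of f where, for some set Z of coordinates
  and some scale k >= j, the average of f over boxes of size 2^k in the coordinates outside Z
  exceeds lambda 2^(k beta |Z|). The discarded part is seen only from an exceptional set,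
  controlled by a covering argument. The rest is split according to the last scale at which f was
  large, and the differences are summed in L^2. The deterministic averages are dominated by
  averages over boxes of varying shapes.

  For convergence, an integrable function is approximated in L^1 by the sum of an invariant function
  and a bounded function whose averages over the dyadic translates of boxes tend to 0. Coboundaries
  along the coordinate directions have the latter property, by the L^2 bound for the random part and
  by summation by parts for the deterministic one. A ball is exhausted by small cubes up to
  those at its boundary, whose contribution is small by Cauchy-Schwarz.
*)
theory Submission
  imports Defs
begin

section \<open>Boxes in the integer lattice and a weighted covering lemma\<close>

text \<open>Chance enters only through the locale \<open>sparse_set\<close>, whose assumptions
  constrain a single outcome. All facts about actions are deduced from them, so the exceptional
  outcomes cannot depend on the action or on the space.

  The obstacle is the diagonal. A 0-1 variable equals its own square, so at h_i = 0 a
  one-dimensional correlation has the size 2^(beta j) of a count instead of the size 2^((1 - 2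
  alpha) j) of a correlation, and in dimension d this excess occurs on every coordinate subspace.
  There the two kernels do not cancel, and the L^2 estimate has to gain from f instead. Hence there
  is one stopping condition for each set Z of coordinates, with 2^(k beta) in place of the length
  2^k in each coordinate of Z; every such coordinate then gains 2^(-beta (j - k)).

  The exponent 3/4 in the concentration estimates lies between 1/2, the size of a random
  fluctuation, and 1, the size of the mean. The gap above it becomes the saving of the difference
  kernel, the gap below it makes the exceptional probabilities summable. The condition alpha < 1/2
  says that the mean of a correlation, of order 2^((1 - 2 alpha) j), grows at all.\<close>

definition vbox :: "('d::finite \<Rightarrow> int set) \<Rightarrow> (int ^ 'd) set" where
  "vbox A = {n. \<forall>i. n $ i \<in> A i}"

lemma mem_vbox [simp]: "n \<in> vbox A \<longleftrightarrow> (\<forall>i. n $ i \<in> A i)"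
  by (simp add: vbox_def)

lemma vbox_mono: "(\<And>i. A i \<subseteq> B i) \<Longrightarrow> vbox A \<subseteq> vbox B"
  by (auto simp: vbox_def)

lemma bij_betw_vbox:
  "bij_betw (vec_lambda :: ('d \<Rightarrow> int) \<Rightarrow> int ^ 'd::finite) (PiE UNIV A) (vbox A)"
  by (rule bij_betwI[where g = vec_nth]) (auto simp: vbox_def PiE_def extensional_def)

lemma sum_vbox: "(\<Sum>n\<in>vbox A. F n) = (\<Sum>\<sigma>\<in>PiE UNIV A. F (vec_lambda \<sigma>))"
  using sum.reindex_bij_betw[OF bij_betw_vbox, of F A] by simp

lemma finite_vbox [simp, intro]: "(\<And>i. finite (A i)) \<Longrightarrow> finite (vbox A)"
  using bij_betw_finite[OF bij_betw_vbox, of A] finite_PiE[of UNIV A] by simp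

lemma card_vbox: "card (vbox A) = (\<Prod>i\<in>UNIV. card (A i))"
  using bij_betw_same_card[OF bij_betw_vbox, of A] card_PiE[of UNIV A] by simp

text \<open>Fubini for boxes; it reduces the correlations and counts in dimension
  \<open>CARD('d)\<close> to one-dimensional ones.\<close>

lemma sum_prod_vbox:
  fixes F :: "'d::finite \<Rightarrow> int \<Rightarrow> 'b::comm_semiring_1"
  assumes "\<And>i. finite (A i)"
  shows "(\<Sum>n\<in>vbox A. \<Prod>i\<in>UNIV. F i (n $ i)) = (\<Prod>i\<in>UNIV. \<Sum>a\<in>A i. F i a)"
  by (subst prod_sum_PiE) (use assms in \<open>auto simp: sum_vbox\<close>)

lemma sum_vbox_shift:
  "(\<Sum>m\<in>vbox A. F (x + m)) = (\<Sum>z\<in>(+) x ` vbox A. F z)" for x :: "int ^ 'd::finite"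
  by (simp add: sum.reindex o_def)

text \<open>Radius 0 is allowed in some of the coordinates. Such flat rectangles run along a
  coordinate subspace and are used in every stopping condition.\<close>

definition rect :: "('d::finite \<Rightarrow> nat) \<Rightarrow> (int ^ 'd) set" where
  "rect r = vbox (\<lambda>i. {- int (r i)..int (r i)})"

lemma mem_rect: "n \<in> rect r \<longleftrightarrow> (\<forall>i. \<bar>n $ i\<bar> \<le> int (r i))"
  unfolding rect_def by (simp add: abs_le_iff) (meson minus_le_iff)

lemma finite_rect [simp, intro]: "finite (rect r)"
  by (simp add: rect_def)

lemma card_rect: "card (rect r) = (\<Prod>i\<in>UNIV. 2 * r i + 1)"
  unfolding rect_def card_vbox by (intro prod.cong) auto

lemma zero_in_rect [simp]: "0 \<in> rect r"
  by (simp add: mem_rect)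

text \<open>
  The greedy choice of a point of highest level discards only points whose rectangles meet its
  rectangle, and these lie in the rectangle of twice the size around it.
\<close>

lemma vitali_weighted:
  fixes \<phi> :: "int ^ 'd::finite \<Rightarrow> real" and r :: "nat \<Rightarrow> 'd \<Rightarrow> nat" and w V :: "nat \<Rightarrow> real"
  assumes \<phi>: "\<And>z. \<phi> z \<ge> 0" and C: "C \<ge> 0"
    and r: "\<And>k l i. k \<le> l \<Longrightarrow> r k i \<le> r l i"
    and w: "\<And>k. w k \<ge> 0" "\<And>k l. k \<le> l \<Longrightarrow> w k \<le> w l"
    and V: "\<And>k. w k * (\<Prod>i\<in>UNIV. 4 * real (r k i) + 1) \<le> C * V k"
    and "finite E" "finite F"
    and "\<And>x. x \<in> E \<Longrightarrow> V (\<kappa> x) \<le> (\<Sum>m\<in>rect (r (\<kappa> x)). \<phi> (x + m))"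
    and "\<And>x. x \<in> E \<Longrightarrow> (+) x ` rect (r (\<kappa> x)) \<subseteq> F"
  shows "(\<Sum>x\<in>E. w (\<kappa> x)) \<le> C * (\<Sum>z\<in>F. \<phi> z)"
  using assms(7-)
proof (induction "card E" arbitrary: E F rule: less_induct)
  case (less E F)
  show ?case
  proof (cases "E = {}")
    case True
    then show ?thesis using C \<phi> by (simp add: sum_nonneg)
  next
    case False
    define K where "K = Max (\<kappa> ` E)"
    have "K \<in> \<kappa> ` E"
      unfolding K_def using False less.prems(1) by (intro Max_in) auto
    then obtain x where x: "x \<in> E" "\<kappa> x = K" by blast
    have Kmax: "\<kappa> y \<le> K" if "y \<in> E" for y
      unfolding K_def using that less.prems(1) by auto
    define G where "G = (+) x ` rect (r K)"
    define E1 where "E1 = {y\<in>E. ((+) y ` rect (r (\<kappa> y))) \<inter> G \<noteq> {}}"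
    define E2 where "E2 = E - E1"
    have fin: "finite E1" "finite E2" "finite G"
      using less.prems(1) by (auto simp: E1_def E2_def G_def)
    have "x \<in> E1"
    proof -
      have "x + 0 \<in> G" unfolding G_def using zero_in_rect by blast
      moreover have "x + 0 \<in> (+) x ` rect (r (\<kappa> x))" using zero_in_rect by blast
      ultimately show ?thesis using x(1) unfolding E1_def by blast
    qed
    then have "card E2 < card E"
      unfolding E2_def using less.prems(1) x by (intro psubset_card_mono) auto
    \<comment> \<open>The rectangles of the survivors avoid \<open>G\<close>, so the induction can
      run with \<open>F - G\<close>, and the mass of \<open>\<phi>\<close> on \<open>G\<close> is
      spent once, on \<open>E1\<close>.\<close>
    moreover have "(+) y ` rect (r (\<kappa> y)) \<subseteq> F - G" if "y \<in> E2" for y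
      using that less.prems(4)[of y] by (auto simp: E1_def E2_def)
    ultimately have IH: "(\<Sum>y\<in>E2. w (\<kappa> y)) \<le> C * (\<Sum>z\<in>F - G. \<phi> z)"
      using fin less.prems by (intro less.hyps) (auto simp: E2_def)
    have "E1 \<subseteq> (+) x ` rect (\<lambda>i. 2 * r K i)"
    proof
      fix y assume "y \<in> E1"
      then obtain m m' where m: "y \<in> E" "m \<in> rect (r (\<kappa> y))" "m' \<in> rect (r K)" "y + m = x + m'"
        by (auto simp: E1_def G_def)
      have "\<bar>(y - x) $ i\<bar> \<le> 2 * int (r K i)" for i
      proof -
        have "\<bar>m $ i\<bar> \<le> int (r (\<kappa> y) i)" using m(2) by (simp add: mem_rect)
        then have "\<bar>m $ i\<bar> \<le> int (r K i)" using r[OF Kmax[OF m(1)], of i] by linarith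
        moreover have "\<bar>m' $ i\<bar> \<le> int (r K i)" using m(3) by (simp add: mem_rect)
        moreover have "y $ i + m $ i = x $ i + m' $ i" 
          using m(4) by (metis vector_add_component)
        ultimately show ?thesis by simp
      qed
      then show "y \<in> (+) x ` rect (\<lambda>i. 2 * r K i)"
        by (intro image_eqI[of _ _ "y - x"]) (auto simp: mem_rect)
    qed
    then have "card E1 \<le> card (rect (\<lambda>i. 2 * r K i))"
      by (meson card_image_le card_mono finite_imageI finite_rect le_trans)
    also have "\<dots> = (\<Prod>i\<in>UNIV. 4 * r K i + 1)"
      unfolding card_rect by (intro prod.cong) auto
    finally have "real (card E1) \<le> real (\<Prod>i\<in>UNIV. 4 * r K i + 1)"
      by (rule of_nat_mono)
    then have c: "real (card E1) \<le> (\<Prod>i\<in>UNIV. 4 * real (r K i) + 1)" 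
      by (simp add: add.commute)
    have "(\<Sum>y\<in>E1. w (\<kappa> y)) \<le> (\<Sum>y\<in>E1. w K)"
      using Kmax w(2) by (intro sum_mono) (auto simp: E1_def)
    also have "\<dots> = w K * real (card E1)" by simp
    also have "\<dots> \<le> w K * (\<Prod>i\<in>UNIV. 4 * real (r K i) + 1)"
      using c w(1) by (intro mult_left_mono) auto
    also have "\<dots> \<le> C * V K" by (rule V)
    also have "\<dots> \<le> C * (\<Sum>m\<in>rect (r K). \<phi> (x + m))"
      using less.prems(3)[OF x(1)] x(2) C by (intro mult_left_mono) auto
    also have "(\<Sum>m\<in>rect (r K). \<phi> (x + m)) = (\<Sum>z\<in>G. \<phi> z)"
      unfolding G_def rect_def by (rule sum_vbox_shift)
    finally have E1: "(\<Sum>y\<in>E1. w (\<kappa> y)) \<le> C * (\<Sum>z\<in>G. \<phi> z)" .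
    have GF: "G \<subseteq> F" using less.prems(4)[OF x(1)] x(2) by (simp add: G_def)
    have "(\<Sum>y\<in>E. w (\<kappa> y)) = (\<Sum>y\<in>E1. w (\<kappa> y)) + (\<Sum>y\<in>E2. w (\<kappa> y))"
      unfolding E2_def using less.prems(1) by (subst sum.subset_diff[of E1 E]) (auto simp: E1_def)
    also have "\<dots> \<le> C * ((\<Sum>z\<in>F - G. \<phi> z) + (\<Sum>z\<in>G. \<phi> z))"
      using E1 IH by (simp add: algebra_simps)
    also have "(\<Sum>z\<in>F - G. \<phi> z) + (\<Sum>z\<in>G. \<phi> z) = (\<Sum>z\<in>F. \<phi> z)"
      using sum.subset_diff[OF GF less.prems(2), of \<phi>] by simp
    finally show ?thesis .
  qed
qed

section \<open>Measure-preserving actions and the maximal inequality\<close>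

locale mp_action = prob_space M for M :: "'x measure" +
  fixes T :: "int ^ 'd::finite \<Rightarrow> 'x \<Rightarrow> 'x"
  assumes mpa: "measure_preserving_action M T"
begin

lemma T_measurable [measurable]: "T n \<in> M \<rightarrow>\<^sub>M M"
  using mpa by (simp add: measure_preserving_action_def)

lemma distr_T: "distr M M (T n) = M"
  using mpa by (simp add: measure_preserving_action_def)

lemma T_in_space [simp]: "x \<in> space M \<Longrightarrow> T n x \<in> space M"
  by (rule measurable_space[OF T_measurable])

lemma T_T: "x \<in> space M \<Longrightarrow> T n (T m x) = T (n + m) x"
  using mpa by (simp add: measure_preserving_action_def)

lemma integral_T:
  fixes f :: "'x \<Rightarrow> real"
  assumes "f \<in> borel_measurable M"
  shows "(\<integral>x. f (T n x) \<partial>M) = (\<integral>x. f x \<partial>M)"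
  using integral_distr[OF T_measurable assms, of n] by (simp add: distr_T)

lemma integrable_T:
  fixes f :: "'x \<Rightarrow> real"
  assumes "integrable M f"
  shows "integrable M (\<lambda>x. f (T n x))"
  using assms integrable_distr[OF T_measurable, of n f] by (simp add: distr_T)

lemma prob_T:
  assumes "A \<in> sets M"
  shows "prob {x \<in> space M. T n x \<in> A} = prob A"
  using measure_distr[OF T_measurable assms, of n]
  by (simp add: distr_T vimage_def Int_def conj_commute)

lemma AE_T:
  assumes "AE x in M. Q x"
  shows "AE x in M. Q (T n x)"
proof (rule AE_distrD[OF T_measurable])
  show "AE x in distr M M (T n). Q x" unfolding distr_T by (rule assms)
qed

text \<open>Transference: the covering lemma is applied on the lattice to the values of
  \<open>f\<close> along the orbit of \<open>y\<close>, and the result is integrated over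
  \<open>y\<close>. The base points fill a box of side \<open>N\<close>, the values of
  \<open>f\<close> a box of side \<open>3 * N\<close>, whence \<open>3 ^ CARD('d)\<close>. The
  factor \<open>card (A k)\<close> in the hypothesis pays for the union over the translates by
  \<open>A k\<close>.\<close>

theorem maximal_transfer:
  fixes r :: "nat \<Rightarrow> 'd \<Rightarrow> nat" and A :: "nat \<Rightarrow> (int ^ 'd) set"
  assumes f: "integrable M f" "\<And>x. f x \<ge> 0" and C: "C \<ge> 0"
    and r: "\<And>k l i. k \<le> l \<Longrightarrow> r k i \<le> r l i"
    and A: "\<And>k. finite (A k)" "\<And>k l. k \<le> l \<Longrightarrow> A k \<subseteq> A l"
    and V: "\<And>k. real (card (A k)) * (\<Prod>i\<in>UNIV. 4 * real (r k i) + 1) \<le> C * V k"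
  shows "prob {x \<in> space M. \<exists>k\<le>J. \<exists>n\<in>A k. V k < (\<Sum>m\<in>rect (r k). f (T m (T n x)))}
           \<le> 3 ^ CARD('d) * C * (\<integral>x. f x \<partial>M)"
proof -
  have [measurable]: "f \<in> borel_measurable M" using f by simp
  define D where "D = (\<lambda>k x. \<Sum>m\<in>rect (r k). f (T m x))"
  have [measurable]: "D k \<in> borel_measurable M" for k unfolding D_def by measurable
  \<comment> \<open>A union bound over the shifts \<open>n\<close> reduces the claim to the integral
    of \<open>\<omega>\<close>, the number of shifts for which a point is bad.\<close>
  define B where "B = (\<lambda>n. {y \<in> space M. \<exists>k\<le>J. n \<in> A k \<and> V k < D k y})"
  have B_meas [measurable]: "B n \<in> sets M" for n unfolding B_def by measurable
  define \<omega> where "\<omega> = (\<lambda>y. \<Sum>n\<in>A J. indicat_real (B n) y)"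
  have \<omega>_meas [measurable]: "\<omega> \<in> borel_measurable M" unfolding \<omega>_def by measurable
  have B_int: "integrable M (indicat_real (B n))" for n
    by (intro integrable_real_indicator) (auto simp: less_top[symmetric])
  have \<omega>_int: "integrable M \<omega>" unfolding \<omega>_def
    by (intro Bochner_Integration.integrable_sum B_int)
  \<comment> \<open>A side length that dominates all radii up to level \<open>J\<close>; the added 1
    keeps it positive.\<close>
  define N where "N = 1 + (\<Sum>i\<in>UNIV. r J i)"
  have rN: "r k i \<le> N" if "k \<le> J" for k i
  proof -
    have "r k i \<le> r J i" by (rule r[OF that])
    also have "\<dots> \<le> (\<Sum>i\<in>UNIV. r J i)" by (rule member_le_sum) auto
    finally show ?thesis by (simp add: N_def)
  qed
  define \<Lambda> where "\<Lambda> = (vbox (\<lambda>_. {0..<int N}) :: (int ^ 'd) set)"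
  define \<Lambda>' where "\<Lambda>' = (vbox (\<lambda>_. {- int N..<2 * int N}) :: (int ^ 'd) set)"
  have fin: "finite \<Lambda>" "finite \<Lambda>'" by (auto simp: \<Lambda>_def \<Lambda>'_def)
  have card: "card \<Lambda> = N ^ CARD('d)" "card \<Lambda>' = (3 * N) ^ CARD('d)"
    by (auto simp: \<Lambda>_def \<Lambda>'_def card_vbox nat_add_distrib nat_mult_distrib)
  have pt: "(\<Sum>u\<in>\<Lambda>. \<omega> (T u y)) \<le> C * (\<Sum>z\<in>\<Lambda>'. f (T z y))" if y: "y \<in> space M" for y
  proof -
    define E where "E = {u\<in>\<Lambda>. \<exists>k\<le>J. V k < D k (T u y)}"
    \<comment> \<open>The largest level at which the threshold is exceeded. Since \<open>A\<close>
      increases, all shifts counted by \<open>\<omega>\<close> at this point lie in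
      \<open>A (\<kappa> u)\<close>.\<close>
    define \<kappa> where "\<kappa> = (\<lambda>u. Max {k. k \<le> J \<and> V k < D k (T u y)})"
    have \<kappa>: "\<kappa> u \<le> J" "V (\<kappa> u) < D (\<kappa> u) (T u y)" if "u \<in> E" for u
      using Max_in[of "{k. k \<le> J \<and> V k < D k (T u y)}"] that unfolding E_def \<kappa>_def by auto
    have \<kappa>_ge: "k \<le> \<kappa> u" if "k \<le> J" "V k < D k (T u y)" for k u
      unfolding \<kappa>_def using that by (intro Max_ge) auto
    have E: "\<omega> (T u y) \<le> real (card (A (\<kappa> u)))" if "u \<in> E" for u
    proof -
      have "\<omega> (T u y) = real (card {n\<in>A J. T u y \<in> B n})"
        unfolding \<omega>_def indicator_def using A(1) by (simp add: sum.If_cases Int_def)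
      also have "\<dots> \<le> real (card (A (\<kappa> u)))"
      proof (intro of_nat_mono card_mono A(1) subsetI)
        fix n assume "n \<in> {n\<in>A J. T u y \<in> B n}"
        then obtain k where k: "k \<le> J" "n \<in> A k" "V k < D k (T u y)" by (auto simp: B_def)
        then show "n \<in> A (\<kappa> u)" using A(2)[OF \<kappa>_ge[of k u]] by auto
      qed
      finally show ?thesis .
    qed
    have notE: "\<omega> (T u y) = 0" if "u \<in> \<Lambda> - E" for u
      using that unfolding \<omega>_def E_def B_def by (auto simp: indicator_def intro!: sum.neutral)
    have "(\<Sum>u\<in>\<Lambda>. \<omega> (T u y)) = (\<Sum>u\<in>E. \<omega> (T u y))"
      using fin notE by (intro sum.mono_neutral_right) (auto simp: E_def)
    also have "\<dots> \<le> (\<Sum>u\<in>E. real (card (A (\<kappa> u))))" by (intro sum_mono E)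
    also have "\<dots> \<le> C * (\<Sum>z\<in>\<Lambda>'. f (T z y))"
    proof (rule vitali_weighted[where r = r and V = V and w = "\<lambda>k. real (card (A k))"])
      show "finite E" using fin by (simp add: E_def)
      show "V (\<kappa> x) \<le> (\<Sum>m\<in>rect (r (\<kappa> x)). f (T (x + m) y))" if "x \<in> E" for x
        using \<kappa>(2)[OF that] y by (simp add: D_def T_T add.commute)
      show "(+) x ` rect (r (\<kappa> x)) \<subseteq> \<Lambda>'" if "x \<in> E" for x
      proof (rule subsetI, erule imageE)
        fix z m assume z: "z = x + m" and m: "m \<in> rect (r (\<kappa> x))"
        have "- int N \<le> z $ i \<and> z $ i < 2 * int N" for i
        proof -
          have "\<bar>m $ i\<bar> \<le> int (r (\<kappa> x) i)" using m by (simp add: mem_rect)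
          moreover have "int (r (\<kappa> x) i) \<le> int N" using rN[OF \<kappa>(1)[OF that]] by simp
          moreover have "0 \<le> x $ i" "x $ i < int N" using that by (auto simp: E_def \<Lambda>_def)
          ultimately show ?thesis unfolding z vector_add_component by linarith
        qed
        then show "z \<in> \<Lambda>'" by (simp add: \<Lambda>'_def)
      qed
      show "real (card (A k)) \<le> real (card (A l))" if "k \<le> l" for k l
        using A that by (intro of_nat_mono card_mono) auto
    qed (use f C r V fin in auto)
    finally show ?thesis .
  qed
  have "real N ^ CARD('d) * (\<integral>y. \<omega> y \<partial>M) = (\<integral>y. (\<Sum>u\<in>\<Lambda>. \<omega> (T u y)) \<partial>M)"
    using \<omega>_int by (subst Bochner_Integration.integral_sum) (auto simp: integrable_T integral_T card)
  also have "\<dots> \<le> (\<integral>y. C * (\<Sum>z\<in>\<Lambda>'. f (T z y)) \<partial>M)"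
    using \<omega>_int f pt by (intro integral_mono integrable_mult_right Bochner_Integration.integrable_sum)
      (auto simp: integrable_T)
  also have "\<dots> = C * (3 * real N) ^ CARD('d) * (\<integral>y. f y \<partial>M)"
    using f by (subst integral_mult_right_zero, subst Bochner_Integration.integral_sum)
      (auto simp: integrable_T integral_T card)
  finally have "real N ^ CARD('d) * (\<integral>y. \<omega> y \<partial>M)
      \<le> real N ^ CARD('d) * (3 ^ CARD('d) * C * (\<integral>y. f y \<partial>M))"
    by (simp add: power_mult_distrib mult_ac)
  moreover have "real N ^ CARD('d) > 0" by (intro zero_less_power) (simp add: N_def add_pos_nonneg sum_nonneg)
  ultimately have int_\<omega>: "(\<integral>y. \<omega> y \<partial>M) \<le> 3 ^ CARD('d) * C * (\<integral>y. f y \<partial>M)"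
    by (simp only: mult_le_cancel_left_pos)
  have "prob {x \<in> space M. \<exists>k\<le>J. \<exists>n\<in>A k. V k < D k (T n x)}
      \<le> prob (\<Union>n\<in>A J. {x\<in>space M. T n x \<in> B n})"
  proof (rule finite_measure_mono)
    show "{x \<in> space M. \<exists>k\<le>J. \<exists>n\<in>A k. V k < D k (T n x)} \<subseteq> (\<Union>n\<in>A J. {x\<in>space M. T n x \<in> B n})"
    proof
      fix x assume "x \<in> {x \<in> space M. \<exists>k\<le>J. \<exists>n\<in>A k. V k < D k (T n x)}"
      then obtain k n where kn: "x \<in> space M" "k \<le> J" "n \<in> A k" "V k < D k (T n x)" by blast
      have "n \<in> A J" using A(2)[OF kn(2)] kn(3) by blast
      moreover have "T n x \<in> B n" unfolding B_def using kn T_in_space[OF kn(1)] by blast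
      ultimately show "x \<in> (\<Union>n\<in>A J. {x\<in>space M. T n x \<in> B n})" using kn(1) by blast
    qed
    show "(\<Union>n\<in>A J. {x\<in>space M. T n x \<in> B n}) \<in> events"
      by (rule sets.finite_UN[OF A(1)]) measurable
  qed
  also have "\<dots> \<le> (\<Sum>n\<in>A J. prob {x\<in>space M. T n x \<in> B n})"
    by (intro finite_measure_subadditive_finite A(1) image_subsetI) measurable
  also have "\<dots> = (\<integral>y. \<omega> y \<partial>M)"
    unfolding \<omega>_def by (subst Bochner_Integration.integral_sum) (auto simp: prob_T B_int)
  also note int_\<omega>
  finally show ?thesis unfolding D_def .
qed

end

section \<open>The mean kernel\<close>

text \<open>The weight is dominated by a superposition of indicators of the intervals from 0 to
  \<open>2 ^ (j - s)\<close>. The shortest of them containing \<open>n\<close> suffices; the factor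
  2 absorbs the variation \<open>2 powr \<alpha>\<close> of the weight over its upper half.\<close>

lemma powr_le_dyadic_sum:
  assumes "0 \<le> \<alpha>" "\<alpha> \<le> 1" "0 < n" "n \<le> (2::int) ^ j"
  shows "real_of_int n powr (-\<alpha>)
    \<le> (\<Sum>s\<le>j. if n \<le> 2 ^ (j - s) then 2 * 2 powr (-\<alpha> * (real j - real s)) else 0)"
proof -
  define s where "s = Max {s. s \<le> j \<and> n \<le> 2 ^ (j - s)}"
  have "s \<in> {s. s \<le> j \<and> n \<le> 2 ^ (j - s)}"
    unfolding s_def using assms by (intro Max_in) (auto intro: exI[of _ 0])
  then have s: "s \<le> j" "n \<le> 2 ^ (j - s)" by auto
  have "real_of_int n powr (-\<alpha>) \<le> 2 * 2 powr (-\<alpha> * (real j - real s))"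
  proof (cases "s = j")
    case True
    then have "n = 1" using s assms by auto
    then show ?thesis using True by simp
  next
    case False
    have "\<not> n \<le> 2 ^ (j - Suc s)"
    proof
      assume "n \<le> 2 ^ (j - Suc s)"
      then have "Suc s \<le> s" unfolding s_def using False s by (intro Max_ge) (auto simp: s_def)
      then show False by simp
    qed
    moreover have "(2::int) ^ (j - s) = 2 * 2 ^ (j - Suc s)"
      using False s by (metis Suc_diff_Suc le_neq_implies_less power_Suc)
    ultimately have "2 ^ (j - s) \<le> 2 * n" by linarith
    then have "real_of_int (2 ^ (j - s)) \<le> real_of_int (2 * n)" by (simp only: of_int_le_iff)
    then have n: "2 powr (real j - real s) / 2 \<le> real_of_int n"
      using s by (simp add: powr_realpow[symmetric] of_nat_diff)
    have "real_of_int n powr (-\<alpha>) \<le> (2 powr (real j - real s) / 2) powr (-\<alpha>)"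
      using assms n by (intro powr_mono2') auto
    also have "\<dots> = 2 powr \<alpha> * 2 powr (-\<alpha> * (real j - real s))"
    proof -
      have e: "2 powr (real j - real s) / 2 = (2::real) powr (real j - real s - 1)"
        by (simp add: powr_diff)
      show ?thesis unfolding e powr_powr powr_add[symmetric] by (simp add: algebra_simps)
    qed
    also have "\<dots> \<le> 2 * 2 powr (-\<alpha> * (real j - real s))"
      using assms powr_mono[of \<alpha> 1 2] by (intro mult_right_mono) auto
    finally show ?thesis .
  qed
  also have "\<dots> = (if n \<le> 2 ^ (j - s) then 2 * 2 powr (-\<alpha> * (real j - real s)) else 0)"
    using s by simp
  also have "\<dots> \<le> (\<Sum>s\<le>j. if n \<le> 2 ^ (j - s) then 2 * 2 powr (-\<alpha> * (real j - real s)) else 0)"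
    using s by (intro member_le_sum[of s "{..j}"]) auto
  finally show ?thesis .
qed

lemma prod_if_all:
  "(\<Prod>i\<in>(UNIV::'d::finite set). if Q i then c i else 0) = (if \<forall>i. Q i then (\<Prod>i\<in>UNIV. c i) else (0::real))"
  by (auto intro!: prod_zero)

context mp_action
begin

text \<open>Normalised by the order of magnitude of the total weight instead of its value; constant
  factors do not matter for a weak type bound.\<close>

definition mean_avg :: "real \<Rightarrow> nat \<Rightarrow> ('x \<Rightarrow> real) \<Rightarrow> 'x \<Rightarrow> real" where
  "mean_avg \<alpha> j f x = (2 powr (- (1 - \<alpha>) * real j)) ^ CARD('d) *
     (\<Sum>n\<in>vbox (\<lambda>_. {0<..2 ^ j}). (\<Prod>i\<in>UNIV. real_of_int (n $ i) powr (-\<alpha>)) * f (T n x))"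

text \<open>Expanding the weight in each coordinate separately lets coordinate \<open>i\<close>
  choose its own scale \<open>j - \<sigma> i\<close>. For a fixed \<open>\<sigma>\<close> the
  rectangles depend on the single parameter \<open>j\<close> and increase with it, so the covering
  argument applies to each \<open>\<sigma>\<close>.\<close>

lemma mean_avg_le_rect_sums:
  assumes \<alpha>: "0 \<le> \<alpha>" "\<alpha> \<le> 1" and f: "\<And>x. f x \<ge> 0"
  shows "mean_avg \<alpha> j f x \<le> (\<Sum>\<sigma>\<in>PiE UNIV (\<lambda>_. {..j}).
     (\<Prod>i\<in>UNIV. 2 powr (- (1 - \<alpha>) * real j) * (2 * 2 powr (-\<alpha> * (real j - real (\<sigma> i))))) *
     (\<Sum>m\<in>rect (\<lambda>i. 2 ^ (j - \<sigma> i)). f (T m x)))"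
proof -
  let ?B = "vbox (\<lambda>_. {0<..2 ^ j}) :: (int ^ 'd) set"
  let ?S = "PiE UNIV (\<lambda>_. {..j}) :: ('d \<Rightarrow> nat) set"
  define c where "c = (\<lambda>s. 2 * 2 powr (-\<alpha> * (real j - real s)))"
  define g where "g = (2 powr (- (1 - \<alpha>) * real j))"
  have g: "g \<ge> 0" by (simp add: g_def)
  have c: "c s \<ge> 0" for s by (simp add: c_def)
  have fin: "finite ?S" by (intro finite_PiE) auto
  have key: "(\<Prod>i\<in>UNIV. real_of_int (n $ i) powr (-\<alpha>))
      \<le> (\<Sum>\<sigma>\<in>?S. if \<forall>i. n $ i \<le> 2 ^ (j - \<sigma> i) then (\<Prod>i\<in>UNIV. c (\<sigma> i)) else 0)" if "n \<in> ?B" for n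
  proof -
    have "(\<Prod>i\<in>UNIV. real_of_int (n $ i) powr (-\<alpha>))
        \<le> (\<Prod>i\<in>UNIV. \<Sum>s\<le>j. if n $ i \<le> 2 ^ (j - s) then c s else 0)"
      unfolding c_def using that \<alpha> by (intro prod_mono conjI powr_le_dyadic_sum) auto
    also have "\<dots> = (\<Sum>\<sigma>\<in>?S. \<Prod>i\<in>UNIV. if n $ i \<le> 2 ^ (j - \<sigma> i) then c (\<sigma> i) else 0)"
      by (subst prod_sum_PiE) auto
    finally show ?thesis by (simp only: prod_if_all)
  qed
  have "mean_avg \<alpha> j f x \<le> g ^ CARD('d) * (\<Sum>n\<in>?B.
      (\<Sum>\<sigma>\<in>?S. if \<forall>i. n $ i \<le> 2 ^ (j - \<sigma> i) then (\<Prod>i\<in>UNIV. c (\<sigma> i)) else 0) * f (T n x))"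
    unfolding mean_avg_def g_def[symmetric]
    by (intro mult_left_mono sum_mono mult_right_mono key f) (auto simp: g)
  also have "\<dots> = g ^ CARD('d) * (\<Sum>\<sigma>\<in>?S. \<Sum>n\<in>?B.
      (if \<forall>i. n $ i \<le> 2 ^ (j - \<sigma> i) then (\<Prod>i\<in>UNIV. c (\<sigma> i)) else 0) * f (T n x))"
    unfolding sum_distrib_right by (subst sum.swap) simp
  also have "\<dots> = (\<Sum>\<sigma>\<in>?S. (\<Prod>i\<in>UNIV. g * c (\<sigma> i)) *
      (\<Sum>n\<in>{n\<in>?B. \<forall>i. n $ i \<le> 2 ^ (j - \<sigma> i)}. f (T n x)))"
    unfolding sum_distrib_left
  proof (rule sum.cong[OF refl])
    fix \<sigma>
    have "(\<Sum>n\<in>?B. g ^ CARD('d) * ((if \<forall>i. n $ i \<le> 2 ^ (j - \<sigma> i) then (\<Prod>i\<in>UNIV. c (\<sigma> i)) else 0) * f (T n x)))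
      = (\<Sum>n\<in>?B. if \<forall>i. n $ i \<le> 2 ^ (j - \<sigma> i) then (\<Prod>i\<in>UNIV. g * c (\<sigma> i)) * f (T n x) else 0)"
      by (intro sum.cong) (auto simp: prod.distrib)
    also have "\<dots> = (\<Sum>n\<in>{n\<in>?B. \<forall>i. n $ i \<le> 2 ^ (j - \<sigma> i)}. (\<Prod>i\<in>UNIV. g * c (\<sigma> i)) * f (T n x))"
      by (subst sum.inter_filter) auto
    finally show "(\<Sum>n\<in>?B. g ^ CARD('d) * ((if \<forall>i. n $ i \<le> 2 ^ (j - \<sigma> i) then (\<Prod>i\<in>UNIV. c (\<sigma> i)) else 0) * f (T n x)))
      = (\<Sum>n\<in>{n\<in>?B. \<forall>i. n $ i \<le> 2 ^ (j - \<sigma> i)}. (\<Prod>i\<in>UNIV. g * c (\<sigma> i)) * f (T n x))" .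
  qed
  also have "\<dots> \<le> (\<Sum>\<sigma>\<in>?S. (\<Prod>i\<in>UNIV. g * c (\<sigma> i)) * (\<Sum>m\<in>rect (\<lambda>i. 2 ^ (j - \<sigma> i)). f (T m x)))"
  proof (intro sum_mono mult_left_mono sum_mono2)
    show "{n\<in>?B. \<forall>i. n $ i \<le> 2 ^ (j - \<sigma> i)} \<subseteq> rect (\<lambda>i. 2 ^ (j - \<sigma> i))" for \<sigma> :: "'d \<Rightarrow> nat"
    proof
      fix n assume n: "n \<in> {n\<in>?B. \<forall>i. n $ i \<le> 2 ^ (j - \<sigma> i)}"
      have "\<bar>n $ i\<bar> \<le> int (2 ^ (j - \<sigma> i))" for i
      proof -
        have "0 < n $ i" "n $ i \<le> 2 ^ (j - \<sigma> i)" using n by auto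
        then show ?thesis by simp
      qed
      then show "n \<in> rect (\<lambda>i. 2 ^ (j - \<sigma> i))" by (simp add: mem_rect)
    qed
  qed (auto intro!: prod_nonneg mult_nonneg_nonneg f g c)
  finally show ?thesis by (simp only: g_def c_def)
qed

text \<open>Weak type bounds cannot simply be added. The decay
  \<open>2 powr (- (1 - \<alpha>) * s)\<close> that belongs to an offset \<open>s\<close> is
  therefore split into two factors \<open>\<rho> ^ s\<close>: one makes the sum of the averages over
  \<open>\<sigma>\<close> converge, the other is used to raise the threshold \<open>V\<close> and so
  to make the exceptional probabilities summable over \<open>\<sigma>\<close>.\<close>

lemma mean_maximal:
  assumes \<alpha>: "0 \<le> \<alpha>" "\<alpha> < 1"
  obtains C where "C > 0"
    "\<And>f t J. integrable M f \<Longrightarrow> (\<And>x. f x \<ge> 0) \<Longrightarrow> t > 0 \<Longrightarrow>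
       prob {x \<in> space M. \<exists>j\<le>J. mean_avg \<alpha> j f x > C * t} \<le> C * (\<integral>x. f x \<partial>M) / t"
proof -
  define \<rho> :: real where "\<rho> = 2 powr (- (1 - \<alpha>) / 2)"
  have "\<rho> < 2 powr 0" unfolding \<rho>_def using \<alpha> by (intro powr_less_mono) auto
  then have \<rho>: "0 < \<rho>" "\<rho> < 1" by (auto simp: \<rho>_def)
  define G where "G = 1 / (1 - \<rho>)"
  have G: "G > 0" using \<rho> by (simp add: G_def)
  have geo: "(\<Sum>s\<le>J. \<rho> ^ s) \<le> G" for J
  proof -
    have "(\<Sum>s\<le>J. \<rho> ^ s) \<le> (\<Sum>s. \<rho> ^ s)"
      using \<rho> by (intro sum_le_suminf summable_geometric) auto
    then show ?thesis using \<rho> by (simp add: suminf_geometric G_def)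
  qed
  have geo': "(\<Sum>\<sigma>\<in>PiE UNIV (\<lambda>_::'d. {..J}). \<Prod>i\<in>UNIV. \<rho> ^ (\<sigma> i)) \<le> G ^ CARD('d)" for J :: nat
  proof -
    have "(\<Sum>\<sigma>\<in>PiE UNIV (\<lambda>_::'d. {..J}). \<Prod>i\<in>UNIV. \<rho> ^ (\<sigma> i)) = (\<Prod>i\<in>(UNIV::'d set). \<Sum>s\<le>J. \<rho> ^ s)"
      by (subst prod_sum_PiE) auto
    also have "\<dots> \<le> (\<Prod>i\<in>(UNIV::'d set). G)"
      using geo \<rho> by (intro prod_mono conjI sum_nonneg) auto
    finally show ?thesis by simp
  qed
  \<comment> \<open>15 is the 3 of \<open>maximal_transfer\<close> times the 5 in
    \<open>4 * 2 ^ k + 1 \<le> 5 * 2 ^ k\<close>.\<close>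
  define C where "C = (15 * G) ^ CARD('d)"
  have C: "C > 0" using G by (simp add: C_def)
  show ?thesis
  proof (rule that[OF C])
    fix f :: "'x \<Rightarrow> real" and t :: real and J :: nat
    assume f: "integrable M f" "\<And>x. f x \<ge> 0" and t: "t > 0"
    have [measurable]: "f \<in> borel_measurable M" using f by simp
    define V where "V = (\<lambda>(\<sigma>::'d \<Rightarrow> nat) k. t * (\<Prod>i\<in>UNIV. 2 ^ (k - \<sigma> i) / \<rho> ^ (\<sigma> i)))"
    define D where "D = (\<lambda>(\<sigma>::'d \<Rightarrow> nat) k x. \<Sum>m\<in>rect (\<lambda>i. 2 ^ (k - \<sigma> i)). f (T m x))"
    have [measurable]: "D \<sigma> k \<in> borel_measurable M" for \<sigma> k unfolding D_def by measurable
    have bd: "mean_avg \<alpha> j f x \<le> C * t"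
      if "\<And>\<sigma>. \<sigma> \<in> PiE UNIV (\<lambda>_. {..j}) \<Longrightarrow> D \<sigma> j x \<le> V \<sigma> j" for j x
    proof -
      have c: "2 powr (- (1 - \<alpha>) * real j) * (2 * 2 powr (-\<alpha> * (real j - real s))) * (2 ^ (j - s) / \<rho> ^ s)
          = 2 * \<rho> ^ s" if "s \<le> j" for s
      proof -
        have "\<rho> ^ s = 2 powr (- (1 - \<alpha>) / 2 * real s)"
          unfolding \<rho>_def by (simp add: powr_power mult_ac)
        moreover have "(2::real) ^ (j - s) = 2 powr (real j - real s)"
          using that by (simp add: powr_realpow[symmetric] of_nat_diff)
        moreover have "2 powr (- (1 - \<alpha>) * real j) * (2 powr (-\<alpha> * (real j - real s))) *
            2 powr (real j - real s) = 2 powr (- (1 - \<alpha>) / 2 * real s) * (2::real) powr (- (1 - \<alpha>) / 2 * real s)"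
          by (simp only: powr_add[symmetric]) (simp add: algebra_simps)
        ultimately show ?thesis by (simp add: field_simps)
      qed
      have "mean_avg \<alpha> j f x \<le> (\<Sum>\<sigma>\<in>PiE UNIV (\<lambda>_. {..j}).
        (\<Prod>i\<in>UNIV. 2 powr (- (1 - \<alpha>) * real j) * (2 * 2 powr (-\<alpha> * (real j - real (\<sigma> i))))) * D \<sigma> j x)"
        unfolding D_def using \<alpha> f by (intro mean_avg_le_rect_sums) auto
      also have "\<dots> \<le> (\<Sum>\<sigma>\<in>PiE UNIV (\<lambda>_. {..j}).
        (\<Prod>i\<in>UNIV. 2 powr (- (1 - \<alpha>) * real j) * (2 * 2 powr (-\<alpha> * (real j - real (\<sigma> i))))) * V \<sigma> j)"
        using that by (intro sum_mono mult_left_mono prod_nonneg) auto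
      also have "\<dots> = (\<Sum>\<sigma>\<in>PiE UNIV (\<lambda>_::'d. {..j}). 2 ^ CARD('d) * (t * (\<Prod>i\<in>UNIV. \<rho> ^ (\<sigma> i))))"
      proof (rule sum.cong[OF refl])
        fix \<sigma> :: "'d \<Rightarrow> nat" assume \<sigma>: "\<sigma> \<in> PiE UNIV (\<lambda>_. {..j})"
        have "(\<Prod>i\<in>UNIV. 2 powr (- (1 - \<alpha>) * real j) * (2 * 2 powr (-\<alpha> * (real j - real (\<sigma> i))))) * V \<sigma> j
          = t * (\<Prod>i\<in>UNIV. 2 powr (- (1 - \<alpha>) * real j) * (2 * 2 powr (-\<alpha> * (real j - real (\<sigma> i))))
              * (2 ^ (j - \<sigma> i) / \<rho> ^ (\<sigma> i)))"
          unfolding V_def prod.distrib by simp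
        also have "\<dots> = t * (\<Prod>i\<in>UNIV. 2 * \<rho> ^ (\<sigma> i))"
          using \<sigma> by (intro arg_cong[where f = "(*) t"] prod.cong refl c) auto
        finally show "(\<Prod>i\<in>UNIV. 2 powr (- (1 - \<alpha>) * real j) * (2 * 2 powr (-\<alpha> * (real j - real (\<sigma> i))))) * V \<sigma> j
          = 2 ^ CARD('d) * (t * (\<Prod>i\<in>UNIV. \<rho> ^ (\<sigma> i)))"
          by (simp add: prod.distrib)
      qed
      also have "\<dots> = 2 ^ CARD('d) * t * (\<Sum>\<sigma>\<in>PiE UNIV (\<lambda>_::'d. {..j}). \<Prod>i\<in>UNIV. \<rho> ^ (\<sigma> i))"
        by (simp add: sum_distrib_left mult_ac)
      also have "\<dots> \<le> 15 ^ CARD('d) * t * G ^ CARD('d)"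
        using t geo' \<rho> by (intro mult_mono power_mono sum_nonneg prod_nonneg) auto
      finally show ?thesis by (simp add: C_def power_mult_distrib mult_ac)
    qed
    let ?S = "PiE UNIV (\<lambda>_. {..J}) :: ('d \<Rightarrow> nat) set"
    let ?E = "\<lambda>\<sigma>. {x \<in> space M. \<exists>k\<le>J. V \<sigma> k < D \<sigma> k x}"
    have finS: "finite ?S" by (intro finite_PiE) auto
    have each: "prob (?E \<sigma>) \<le> (15 ^ CARD('d) * (\<integral>x. f x \<partial>M) / t) * (\<Prod>i\<in>UNIV. \<rho> ^ (\<sigma> i))" for \<sigma> :: "'d \<Rightarrow> nat"
    proof -
      have "prob {x \<in> space M. \<exists>k\<le>J. \<exists>n\<in>{0}. V \<sigma> k < (\<Sum>m\<in>rect (\<lambda>i. 2 ^ (k - \<sigma> i)). f (T m (T n x)))}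
        \<le> 3 ^ CARD('d) * (5 ^ CARD('d) / t * (\<Prod>i\<in>UNIV. \<rho> ^ (\<sigma> i))) * (\<integral>x. f x \<partial>M)"
      proof (rule maximal_transfer[where r = "\<lambda>k i. 2 ^ (k - \<sigma> i)" and A = "\<lambda>_. {0}"])
        fix k
        have "(\<Prod>i\<in>UNIV. 4 * real (2 ^ (k - \<sigma> i)) + 1) \<le> (\<Prod>i\<in>UNIV. 5 * 2 ^ (k - \<sigma> i))"
          by (intro prod_mono) auto
        also have "\<dots> = 5 ^ CARD('d) / t * (\<Prod>i\<in>UNIV. \<rho> ^ (\<sigma> i)) * V \<sigma> k"
          unfolding V_def using t \<rho> by (simp add: prod.distrib prod_dividef)
        finally show "real (card {0}) * (\<Prod>i\<in>UNIV. 4 * real (2 ^ (k - \<sigma> i)) + 1)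
          \<le> 5 ^ CARD('d) / t * (\<Prod>i\<in>UNIV. \<rho> ^ (\<sigma> i)) * V \<sigma> k" by simp
      qed (use f t \<rho> in \<open>auto intro!: mult_nonneg_nonneg divide_nonneg_pos prod_nonneg\<close>)
      also have "{x \<in> space M. \<exists>k\<le>J. \<exists>n\<in>{0}. V \<sigma> k < (\<Sum>m\<in>rect (\<lambda>i. 2 ^ (k - \<sigma> i)). f (T m (T n x)))}
        = ?E \<sigma>"
        unfolding D_def by (intro Collect_cong conj_cong refl) (simp add: T_T)
      also have "3 ^ CARD('d) * (5 ^ CARD('d) / t * (\<Prod>i\<in>UNIV. \<rho> ^ (\<sigma> i))) * (\<integral>x. f x \<partial>M)
        = ((3 * 5) ^ CARD('d) * (\<integral>x. f x \<partial>M) / t) * (\<Prod>i\<in>UNIV. \<rho> ^ (\<sigma> i))"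
        unfolding power_mult_distrib by simp
      finally show ?thesis by simp
    qed
    have "prob {x \<in> space M. \<exists>j\<le>J. mean_avg \<alpha> j f x > C * t} \<le> prob (\<Union>\<sigma>\<in>?S. ?E \<sigma>)"
    proof (rule finite_measure_mono)
      show "{x \<in> space M. \<exists>j\<le>J. mean_avg \<alpha> j f x > C * t} \<subseteq> (\<Union>\<sigma>\<in>?S. ?E \<sigma>)"
      proof clarify
        fix x j assume x: "x \<in> space M" "j \<le> J" "mean_avg \<alpha> j f x > C * t"
        then obtain \<sigma> where \<sigma>: "\<sigma> \<in> PiE UNIV (\<lambda>_. {..j})" "D \<sigma> j x > V \<sigma> j"
          using bd[of j x] by (meson not_le)
        moreover have "\<sigma> \<in> ?S" using \<sigma>(1) x(2) by (auto simp: PiE_def Pi_def intro: order_trans)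
        ultimately show "x \<in> (\<Union>\<sigma>\<in>?S. ?E \<sigma>)" using x(1,2) by blast
      qed
      show "(\<Union>\<sigma>\<in>?S. ?E \<sigma>) \<in> events" by (rule sets.finite_UN[OF finS]) measurable
    qed
    also have "\<dots> \<le> (\<Sum>\<sigma>\<in>?S. prob (?E \<sigma>))"
      by (intro finite_measure_subadditive_finite finS image_subsetI) measurable
    also have "\<dots> \<le> (\<Sum>\<sigma>\<in>?S. (15 ^ CARD('d) * (\<integral>x. f x \<partial>M) / t) * (\<Prod>i\<in>UNIV. \<rho> ^ (\<sigma> i)))"
      by (intro sum_mono each)
    also have "\<dots> = (15 ^ CARD('d) * (\<integral>x. f x \<partial>M) / t) * (\<Sum>\<sigma>\<in>?S. \<Prod>i\<in>UNIV. \<rho> ^ (\<sigma> i))"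
      by (simp add: sum_distrib_left)
    also have "\<dots> \<le> (15 ^ CARD('d) * (\<integral>x. f x \<partial>M) / t) * G ^ CARD('d)"
      using f t by (intro mult_left_mono geo') auto
    finally show "prob {x \<in> space M. \<exists>j\<le>J. mean_avg \<alpha> j f x > C * t} \<le> C * (\<integral>x. f x \<partial>M) / t"
      by (simp add: C_def power_mult_distrib mult_ac)
  qed
qed

end

section \<open>Random sets through their correlations\<close>

text \<open>By the mean value theorem each term is at most an increment of x^(1 - a) / (1 -
  a).\<close>

lemma sum_powr_le:
  assumes a: "0 \<le> a" "a < 1" and N: "0 \<le> (N::int)"
  shows "(\<Sum>n\<in>{0<..N}. real_of_int n powr (-a)) \<le> real_of_int N powr (1 - a) / (1 - a)"
  using N
proof (induction rule: int_ge_induct)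
  case base
  then show ?case by simp
next
  case (step N)
  have "(1 - a) * real_of_int (N + 1) powr (-a) \<le> real_of_int (N + 1) powr (1 - a) - real_of_int N powr (1 - a)"
  proof (cases "N = 0")
    case True
    then show ?thesis using a by simp
  next
    case False
    then have N: "N \<ge> 1" using step by simp
    have "\<exists>z. real_of_int N < z \<and> z < real_of_int (N + 1) \<and>
       real_of_int (N + 1) powr (1 - a) - real_of_int N powr (1 - a)
       = (real_of_int (N + 1) - real_of_int N) * ((1 - a) * z powr (1 - a - 1))"
      using N by (intro MVT2 has_real_derivative_powr) auto
    then obtain z where z: "real_of_int N < z" "z < real_of_int (N + 1)"
      "real_of_int (N + 1) powr (1 - a) - real_of_int N powr (1 - a) = (1 - a) * z powr (-a)"
      by auto
    have "real_of_int (N + 1) powr (-a) \<le> z powr (-a)"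
      using z N a by (intro powr_mono2') auto
    then show ?thesis using z(3) a by (simp add: mult_left_mono)
  qed
  moreover have "{0<..N + 1} = insert (N + 1) {0<..N}" using step by auto
  ultimately show ?case using step a by (simp add: field_simps)
qed

text \<open>Dividing by \<open>E\<close> brings all factors to modulus at most 1, where a difference
  of products is bounded by the sum of the differences of the factors.\<close>

lemma abs_prod_diff_le:
  fixes a b E :: "'d::finite \<Rightarrow> real"
  assumes E: "\<And>i. E i > 0" and ab: "\<And>i. \<bar>a i\<bar> \<le> E i" "\<And>i. \<bar>b i\<bar> \<le> E i"
    and diff: "\<And>i. \<bar>a i - b i\<bar> \<le> \<delta> * E i"
  shows "\<bar>(\<Prod>i\<in>UNIV. a i) - (\<Prod>i\<in>UNIV. b i)\<bar> \<le> real CARD('d) * \<delta> * (\<Prod>i\<in>UNIV. E i)"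
proof -
  have "norm ((\<Prod>i\<in>UNIV. a i / E i) - (\<Prod>i\<in>UNIV. b i / E i)) \<le> (\<Sum>i\<in>UNIV. norm (a i / E i - b i / E i))"
    using E ab by (intro norm_prod_diff) (auto simp: abs_div less_imp_le)
  also have "\<dots> \<le> (\<Sum>i\<in>(UNIV::'d set). \<delta>)"
  proof (intro sum_mono)
    fix i
    have "norm (a i / E i - b i / E i) = \<bar>a i - b i\<bar> / E i"
      using E[of i] by (simp add: abs_div diff_divide_distrib[symmetric])
    then show "norm (a i / E i - b i / E i) \<le> \<delta>"
      using diff[of i] E[of i] by (simp add: divide_le_eq)
  qed
  finally have "\<bar>((\<Prod>i\<in>UNIV. a i) - (\<Prod>i\<in>UNIV. b i)) / (\<Prod>i\<in>UNIV. E i)\<bar> \<le> real CARD('d) * \<delta>"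
    by (simp add: prod_dividef diff_divide_distrib)
  moreover have "(\<Prod>i\<in>UNIV. E i) > 0" using E by (intro prod_pos) auto
  ultimately show ?thesis by (simp add: abs_div divide_le_eq)
qed

section \<open>One-dimensional correlations and the required properties of an outcome\<close>

definition corr_sum :: "int set \<Rightarrow> (int \<Rightarrow> real) \<Rightarrow> (int \<Rightarrow> real) \<Rightarrow> int \<Rightarrow> real" where
  "corr_sum I u v h = (\<Sum>n\<in>{n\<in>I. n + h \<in> I}. u n * v (n + h))"

lemma corr_sum_minus: "corr_sum I u v (- h) = corr_sum I v u h"
  unfolding corr_sum_def
  by (rule sum.reindex_bij_witness[where i = "\<lambda>n. n + h" and j = "\<lambda>n. n - h"]) auto

lemma corr_sum_nonneg:
  assumes "\<And>n. n \<in> I \<Longrightarrow> u n \<ge> 0" "\<And>n. n \<in> I \<Longrightarrow> v n \<ge> 0"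
  shows "corr_sum I u v h \<ge> 0"
  unfolding corr_sum_def using assms by (intro sum_nonneg) auto

lemma corr_sum_interval:
  assumes "h \<ge> 0"
  shows "corr_sum {a<..b} u v h = (\<Sum>n\<in>{a<..b - h}. u n * v (n + h))"
  unfolding corr_sum_def using assms by (intro sum.cong) auto

definition wt :: "real \<Rightarrow> int \<Rightarrow> real" where
  "wt \<alpha> n = real_of_int n powr (- \<alpha>)"

lemma wt_nonneg [simp]: "wt \<alpha> n \<ge> 0"
  by (simp add: wt_def)

lemma wt_le_1: "\<alpha> \<ge> 0 \<Longrightarrow> n \<ge> 1 \<Longrightarrow> wt \<alpha> n \<le> 1"
  unfolding wt_def using powr_mono2'[of "-\<alpha>" 1 "real_of_int n"] by simp

lemma sum_wt_dyadic_le: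
  assumes "0 \<le> \<alpha>" "\<alpha> < 1" "0 \<le> a" "b \<le> 2 ^ j"
  shows "(\<Sum>n\<in>{a<..b}. wt \<alpha> n) \<le> 1 / (1 - \<alpha>) * 2 powr ((1 - \<alpha>) * real j)"
proof -
  have "(\<Sum>n\<in>{a<..b}. wt \<alpha> n) \<le> (\<Sum>n\<in>{0<..2 ^ j}. wt \<alpha> n)"
    using assms by (intro sum_mono2) auto
  also have "\<dots> \<le> real_of_int (2 ^ j) powr (1 - \<alpha>) / (1 - \<alpha>)"
    unfolding wt_def using assms by (intro sum_powr_le) auto
  also have "real_of_int (2 ^ j) powr (1 - \<alpha>) = 2 powr ((1 - \<alpha>) * real j)"
    by (simp add: powr_realpow[symmetric] powr_powr mult.commute)
  finally show ?thesis by simp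
qed

lemma sum_wt_sq_dyadic_le:
  assumes "0 \<le> \<alpha>" "\<alpha> < 1/2" "0 \<le> a" "b \<le> 2 ^ j"
  shows "(\<Sum>n\<in>{a<..b}. (wt \<alpha> n)\<^sup>2) \<le> 1 / (1 - 2 * \<alpha>) * 2 powr ((1 - 2 * \<alpha>) * real j)"
proof -
  have "(\<Sum>n\<in>{a<..b}. (wt \<alpha> n)\<^sup>2) = (\<Sum>n\<in>{a<..b}. wt (2 * \<alpha>) n)"
    unfolding wt_def by (intro sum.cong refl) (simp add: power2_eq_square powr_add[symmetric])
  then show ?thesis using sum_wt_dyadic_le[of "2 * \<alpha>" a b j] assms by simp
qed

text \<open>Both error terms are the power 3/4 of the size of the corresponding mean, a count of
  order 2^((1 - alpha) j) or a correlation of order 2^((1 - 2 alpha) j). Mixed pairs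
  \<open>u\<close>, \<open>v\<close> occur because it is the difference of the random and the mean
  kernel that gets correlated with itself.\<close>

locale sparse_set =
  fixes \<alpha> C :: real and X :: "'d::finite \<Rightarrow> int \<Rightarrow> real"
  assumes \<alpha>: "0 \<le> \<alpha>" "\<alpha> < 1/2" and C: "C \<ge> 0"
    and X: "n \<ge> 1 \<Longrightarrow> X i n \<in> {0, 1}"
    and discrepancy: "0 \<le> a \<Longrightarrow> a \<le> b \<Longrightarrow> b \<le> 2 ^ j \<Longrightarrow>
      \<bar>\<Sum>n\<in>{a<..b}. X i n - wt \<alpha> n\<bar> \<le> C * 2 powr (3/4 * (1 - \<alpha>) * real j)"
    and correlation: "0 \<le> a \<Longrightarrow> a \<le> b \<Longrightarrow> 1 \<le> h \<Longrightarrow> b + h \<le> 2 ^ j \<Longrightarrow>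
      u \<in> {X i, wt \<alpha>} \<Longrightarrow> v \<in> {X i, wt \<alpha>} \<Longrightarrow>
      \<bar>\<Sum>n\<in>{a<..b}. u n * v (n + h) - wt \<alpha> n * wt \<alpha> (n + h)\<bar> \<le> C * 2 powr (3/4 * (1 - 2 * \<alpha>) * real j)"
begin

lemma \<alpha>_less_1: "\<alpha> < 1"
  using \<alpha> by simp

definition K1 :: real where "K1 = C + 1 / (1 - 2 * \<alpha>)"

lemma K1: "K1 \<ge> 1" "K1 \<ge> C" "K1 \<ge> C + 1 / (1 - \<alpha>)"
proof -
  have "1 / (1 - 2 * \<alpha>) \<ge> 1 / (1 - \<alpha>)" using \<alpha> by (intro divide_left_mono) auto
  moreover have "1 / (1 - 2 * \<alpha>) \<ge> 1" using \<alpha> by simp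
  ultimately show "K1 \<ge> 1" "K1 \<ge> C" "K1 \<ge> C + 1 / (1 - \<alpha>)" using C unfolding K1_def by linarith+
qed

lemma X_nonneg: "n \<ge> 1 \<Longrightarrow> X i n \<ge> 0" and X_le_1: "n \<ge> 1 \<Longrightarrow> X i n \<le> 1"
  using X[of n i] by auto

lemma two_powr_le: "x \<le> y \<Longrightarrow> (2::real) powr x \<le> 2 powr y"
  by simp

lemmas sum_wt_le = sum_wt_dyadic_le[OF \<alpha>(1) \<alpha>_less_1]

lemmas sum_wt_sq_le = sum_wt_sq_dyadic_le[OF \<alpha>]

lemma sum_X_le:
  assumes "0 \<le> a" "b \<le> 2 ^ j"
  shows "(\<Sum>n\<in>{a<..b}. X i n) \<le> K1 * 2 powr ((1 - \<alpha>) * real j)"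
proof (cases "a \<le> b")
  case True
  have "(\<Sum>n\<in>{a<..b}. X i n) \<le> (\<Sum>n\<in>{a<..b}. wt \<alpha> n) + C * 2 powr (3/4 * (1 - \<alpha>) * real j)"
    using discrepancy[OF assms(1) True assms(2), of i] by (simp add: sum_subtractf)
  also have "\<dots> \<le> 1 / (1 - \<alpha>) * 2 powr ((1 - \<alpha>) * real j) + C * 2 powr ((1 - \<alpha>) * real j)"
    using \<alpha> C by (intro add_mono sum_wt_le assms mult_left_mono two_powr_le mult_right_mono) auto
  also have "\<dots> = (C + 1 / (1 - \<alpha>)) * 2 powr ((1 - \<alpha>) * real j)" by (simp add: algebra_simps)
  also have "\<dots> \<le> K1 * 2 powr ((1 - \<alpha>) * real j)" by (intro mult_right_mono K1) auto
  finally show ?thesis .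
qed (use K1 in auto)

text \<open>The locale speaks of positive shifts. A negative one is reversed by exchanging
  \<open>u\<close> and \<open>v\<close>, and a window shorter than the shift contains no
  pair.\<close>

lemma corr_sum_diff_le:
  assumes ab: "0 \<le> a" "b \<le> 2 ^ j" and uv: "u \<in> {X i, wt \<alpha>}" "v \<in> {X i, wt \<alpha>}" and h: "h \<noteq> 0"
  shows "\<bar>corr_sum {a<..b} u v h - corr_sum {a<..b} (wt \<alpha>) (wt \<alpha>) h\<bar>
    \<le> C * 2 powr (3/4 * (1 - 2 * \<alpha>) * real j)"
proof -
  have *: "\<bar>corr_sum {a<..b} u v h - corr_sum {a<..b} (wt \<alpha>) (wt \<alpha>) h\<bar>
    \<le> C * 2 powr (3/4 * (1 - 2 * \<alpha>) * real j)"
    if uv: "u \<in> {X i, wt \<alpha>}" "v \<in> {X i, wt \<alpha>}" and h: "h \<ge> 1" for u v h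
  proof (cases "a \<le> b - h")
    case True
    have "\<bar>\<Sum>n\<in>{a<..b - h}. u n * v (n + h) - wt \<alpha> n * wt \<alpha> (n + h)\<bar>
        \<le> C * 2 powr (3/4 * (1 - 2 * \<alpha>) * real j)"
      using uv h True ab by (intro correlation[where i = i]) auto
    then show ?thesis using h by (simp add: corr_sum_interval sum_subtractf)
  next
    case False
    then show ?thesis using h C by (simp add: corr_sum_interval)
  qed
  show ?thesis
  proof (cases "h \<ge> 1")
    case True
    then show ?thesis using * uv by blast
  next
    case False
    then have "- h \<ge> 1" using h by simp
    then show ?thesis
      using *[of v u "- h"] uv corr_sum_minus[of _ _ _ h] by simp
  qed
qed

text \<open>The arithmetic-geometric mean inequality reduces this to the sum of n^(-2 alpha), which
  has the order 2^((1 - 2 alpha) j) because 2 alpha < 1.\<close>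

lemma corr_sum_wt_le:
  assumes ab: "0 \<le> a" "b \<le> 2 ^ j"
  shows "corr_sum {a<..b} (wt \<alpha>) (wt \<alpha>) h \<le> 1 / (1 - 2 * \<alpha>) * 2 powr ((1 - 2 * \<alpha>) * real j)"
proof -
  let ?I = "{n\<in>{a<..b}. n + h \<in> {a<..b}}"
  have fin: "finite ?I" by (rule finite_subset[of _ "{a<..b}"]) auto
  have "corr_sum {a<..b} (wt \<alpha>) (wt \<alpha>) h \<le> (\<Sum>n\<in>?I. ((wt \<alpha> n)\<^sup>2 + (wt \<alpha> (n + h))\<^sup>2) / 2)"
    unfolding corr_sum_def
  proof (intro sum_mono)
    fix n show "wt \<alpha> n * wt \<alpha> (n + h) \<le> ((wt \<alpha> n)\<^sup>2 + (wt \<alpha> (n + h))\<^sup>2) / 2"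
      using sum_squares_bound[of "wt \<alpha> n" "wt \<alpha> (n + h)"] by simp
  qed
  also have "\<dots> = (\<Sum>n\<in>?I. (wt \<alpha> n)\<^sup>2) / 2 + (\<Sum>n\<in>?I. (wt \<alpha> (n + h))\<^sup>2) / 2"
    by (simp add: sum.distrib add_divide_distrib sum_divide_distrib)
  also have "(\<Sum>n\<in>?I. (wt \<alpha> (n + h))\<^sup>2) = (\<Sum>n\<in>(\<lambda>n. n + h) ` ?I. (wt \<alpha> n)\<^sup>2)"
    by (subst sum.reindex) (auto simp: inj_on_def)
  also have "(\<Sum>n\<in>?I. (wt \<alpha> n)\<^sup>2) / 2 + (\<Sum>n\<in>(\<lambda>n. n + h) ` ?I. (wt \<alpha> n)\<^sup>2) / 2
      \<le> (\<Sum>n\<in>{a<..b}. (wt \<alpha> n)\<^sup>2) / 2 + (\<Sum>n\<in>{a<..b}. (wt \<alpha> n)\<^sup>2) / 2"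
    by (intro add_mono divide_right_mono sum_mono2) auto
  also have "\<dots> \<le> 1 / (1 - 2 * \<alpha>) * 2 powr ((1 - 2 * \<alpha>) * real j)"
    using sum_wt_sq_le[OF ab] by simp
  finally show ?thesis .
qed

text \<open>Two different orders of magnitude: for \<open>h \<noteq> 0\<close> the probabilities
  multiply, whereas at \<open>h = 0\<close> a 0-1 value equals its square and the sum is only
  bounded by a count.\<close>

lemma corr_sum_le:
  assumes ab: "0 \<le> a" "b \<le> 2 ^ j" and uv: "u \<in> {X i, wt \<alpha>}" "v \<in> {X i, wt \<alpha>}"
  shows "\<bar>corr_sum {a<..b} u v h\<bar>
    \<le> K1 * (if h = 0 then 2 powr ((1 - \<alpha>) * real j) else 2 powr ((1 - 2 * \<alpha>) * real j))"
proof (cases "h = 0")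
  case True
  have nn: "0 \<le> u n" "0 \<le> v n" "u n \<le> 1" "v n \<le> 1" if "n \<in> {a<..b}" for n
    using that ab uv X_nonneg[of n i] X_le_1[of n i] wt_le_1[OF \<alpha>(1), of n] by auto
  have "0 \<le> corr_sum {a<..b} u v h" by (intro corr_sum_nonneg nn)
  moreover have "corr_sum {a<..b} u v h \<le> (\<Sum>n\<in>{a<..b}. u n)"
  proof -
    have "corr_sum {a<..b} u v h = (\<Sum>n\<in>{a<..b}. u n * v n)"
      unfolding corr_sum_def True by (intro sum.cong) auto
    also have "\<dots> \<le> (\<Sum>n\<in>{a<..b}. u n)"
      by (intro sum_mono mult_left_le nn)
    finally show ?thesis .
  qed
  moreover have "(\<Sum>n\<in>{a<..b}. u n) \<le> K1 * 2 powr ((1 - \<alpha>) * real j)"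
  proof -
    have "1 / (1 - \<alpha>) * 2 powr ((1 - \<alpha>) * real j) \<le> K1 * 2 powr ((1 - \<alpha>) * real j)"
      using K1 C by (intro mult_right_mono) auto
    then show ?thesis
      using uv(1) sum_X_le[OF ab, of i] sum_wt_le[OF ab] by auto
  qed
  ultimately show ?thesis using True by simp
next
  case False
  have "corr_sum {a<..b} (wt \<alpha>) (wt \<alpha>) h \<ge> 0" by (intro corr_sum_nonneg) auto
  then have "\<bar>corr_sum {a<..b} u v h\<bar>
      \<le> C * 2 powr (3/4 * (1 - 2 * \<alpha>) * real j) + 1 / (1 - 2 * \<alpha>) * 2 powr ((1 - 2 * \<alpha>) * real j)"
    using corr_sum_diff_le[OF ab uv False] corr_sum_wt_le[OF ab, of h] by linarith
  also have "\<dots> \<le> C * 2 powr ((1 - 2 * \<alpha>) * real j) + 1 / (1 - 2 * \<alpha>) * 2 powr ((1 - 2 * \<alpha>) * real j)"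
    using \<alpha> C by (intro add_mono mult_left_mono two_powr_le mult_right_mono) auto
  also have "\<dots> = K1 * 2 powr ((1 - 2 * \<alpha>) * real j)"
    by (simp add: K1_def algebra_simps)
  finally show ?thesis using False by simp
qed

text \<open>Not a product over the coordinates, which is why its autocorrelation falls into four
  products.\<close>

definition fluct :: "int ^ 'd \<Rightarrow> real" where
  "fluct n = (\<Prod>i\<in>UNIV. X i (n $ i)) - (\<Prod>i\<in>UNIV. wt \<alpha> (n $ i))"

text \<open>\<open>Z\<close> stands for the set of coordinates in which the shift vanishes. The
  product collects the bounds of \<open>corr_sum_le\<close>; the last factor is the saving of the
  difference kernel, available only off the coordinate subspaces.\<close>

definition kernel_bound :: "nat \<Rightarrow> 'd set \<Rightarrow> real" where
  "kernel_bound j Z =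
     (\<Prod>i\<in>UNIV. if i \<in> Z then 2 powr ((1 - \<alpha>) * real j) else 2 powr ((1 - 2 * \<alpha>) * real j)) *
     (if Z = {} then 2 powr (- ((1 - 2 * \<alpha>) / 4) * real j) else 1)"

definition K2 :: real where "K2 = 4 * real CARD('d) * K1 ^ CARD('d)"

lemma kernel_bound_nonneg: "kernel_bound j Z \<ge> 0"
  unfolding kernel_bound_def by (intro mult_nonneg_nonneg prod_nonneg) auto

lemma K2_nonneg: "K2 \<ge> 0"
  unfolding K2_def using K1 by simp

text \<open>Expansion gives four products of one-dimensional correlations with the signs +, -, -, +.
  Subtracting the product for the pure weights from each of the other three leaves three small
  differences and no main term. If a coordinate of \<open>h\<close> is 0, the four products are
  merely bounded one by one.\<close>

lemma fluct_autocorrelation: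
  fixes a b :: "'d \<Rightarrow> int"
  assumes ab: "\<And>i. 0 \<le> a i" "\<And>i. b i \<le> 2 ^ j"
  defines "B \<equiv> vbox (\<lambda>i. {a i<..b i})"
  shows "\<bar>\<Sum>n\<in>{n\<in>B. n + h \<in> B}. fluct n * fluct (n + h)\<bar> \<le> K2 * kernel_bound j {i. h $ i = 0}"
proof -
  define R where "R = (\<lambda>u v i. corr_sum {a i<..b i} (u i) (v i) (h $ i))"
  define W :: "'d \<Rightarrow> int \<Rightarrow> real" where "W = (\<lambda>_. wt \<alpha>)"
  define e where "e = (\<lambda>i. if h $ i = 0 then 2 powr ((1 - \<alpha>) * real j) else 2 powr ((1 - 2 * \<alpha>) * real j))"
  define E where "E = (\<lambda>i. K1 * e i)"
  have e: "e i > 0" for i by (simp add: e_def)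
  have E: "E i > 0" for i using e[of i] K1(1) by (simp add: E_def)
  have set_eq: "{n\<in>B. n + h \<in> B} = vbox (\<lambda>i. {n\<in>{a i<..b i}. n + h $ i \<in> {a i<..b i}})"
    unfolding B_def by auto
  have fin: "finite {n\<in>{a i<..b i}. n + h $ i \<in> {a i<..b i}}" for i
    by (rule finite_subset[of _ "{a i<..b i}"]) auto
  have prod_eq: "(\<Sum>n\<in>{n\<in>B. n + h \<in> B}. (\<Prod>i\<in>UNIV. u i (n $ i)) * (\<Prod>i\<in>UNIV. v i ((n + h) $ i)))
      = (\<Prod>i\<in>UNIV. R u v i)" for u v
    unfolding set_eq R_def corr_sum_def
    by (subst sum_prod_vbox[OF fin, symmetric]) (simp add: prod.distrib)
  have "fluct n * fluct (n + h) = (\<Prod>i\<in>UNIV. X i (n $ i)) * (\<Prod>i\<in>UNIV. X i ((n + h) $ i))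
      - (\<Prod>i\<in>UNIV. X i (n $ i)) * (\<Prod>i\<in>UNIV. W i ((n + h) $ i))
      - (\<Prod>i\<in>UNIV. W i (n $ i)) * (\<Prod>i\<in>UNIV. X i ((n + h) $ i))
      + (\<Prod>i\<in>UNIV. W i (n $ i)) * (\<Prod>i\<in>UNIV. W i ((n + h) $ i))" for n
    unfolding fluct_def W_def by (simp add: algebra_simps)
  then have "(\<Sum>n\<in>{n\<in>B. n + h \<in> B}. fluct n * fluct (n + h))
      = (\<Prod>i\<in>UNIV. R X X i) - (\<Prod>i\<in>UNIV. R X W i) - (\<Prod>i\<in>UNIV. R W X i) + (\<Prod>i\<in>UNIV. R W W i)"
    by (simp only: sum.distrib sum_subtractf prod_eq)
  moreover have "\<bar>(\<Prod>i\<in>UNIV. R X X i) - (\<Prod>i\<in>UNIV. R X W i) - (\<Prod>i\<in>UNIV. R W X i) + (\<Prod>i\<in>UNIV. R W W i)\<bar>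
      \<le> K2 * kernel_bound j {i. h $ i = 0}"
  proof -
    have R: "\<bar>R u v i\<bar> \<le> E i" if "u \<in> {X, W}" "v \<in> {X, W}" for u v i
      unfolding R_def E_def e_def by (rule corr_sum_le) (use ab that in \<open>auto simp: W_def\<close>)
    have PE: "(\<Prod>i\<in>UNIV. E i) = K1 ^ CARD('d) * (\<Prod>i\<in>UNIV. e i)"
      by (simp add: E_def prod.distrib)
    have PE0: "(\<Prod>i\<in>UNIV. E i) \<ge> 0" using E by (intro prod_nonneg) (auto simp: less_imp_le)
    have card: "real CARD('d) \<ge> 1" by (simp add: Suc_leI)
    show ?thesis
    proof (cases "\<forall>i. h $ i \<noteq> 0")
      case True
      define \<delta> where "\<delta> = 2 powr (- ((1 - 2 * \<alpha>) / 4) * real j)"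
      have D: "\<bar>R u v i - R W W i\<bar> \<le> \<delta> * E i" if "u \<in> {X, W}" "v \<in> {X, W}" for u v i
      proof -
        have "\<bar>R u v i - R W W i\<bar> \<le> C * 2 powr (3/4 * (1 - 2 * \<alpha>) * real j)"
          unfolding R_def W_def by (rule corr_sum_diff_le) (use ab that True in \<open>auto simp: W_def\<close>)
        also have "\<dots> \<le> K1 * 2 powr (3/4 * (1 - 2 * \<alpha>) * real j)"
          by (intro mult_right_mono K1) auto
        \<comment> \<open>\<open>\<delta>\<close> is the quarter of the exponent by which the
          deviation falls short of the mean.\<close>
        also have "2 powr (3/4 * (1 - 2 * \<alpha>) * real j) = \<delta> * e i"
          using True unfolding \<delta>_def e_def by (simp add: powr_add[symmetric] field_simps)
        finally show ?thesis by (simp add: E_def mult_ac)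
      qed
      have P: "\<bar>(\<Prod>i\<in>UNIV. R u v i) - (\<Prod>i\<in>UNIV. R W W i)\<bar> \<le> real CARD('d) * \<delta> * (\<Prod>i\<in>UNIV. E i)"
        if "u \<in> {X, W}" "v \<in> {X, W}" for u v
        by (rule abs_prod_diff_le) (use E R D that in auto)
      have "\<bar>(\<Prod>i\<in>UNIV. R X X i) - (\<Prod>i\<in>UNIV. R X W i) - (\<Prod>i\<in>UNIV. R W X i) + (\<Prod>i\<in>UNIV. R W W i)\<bar>
        \<le> 3 * (real CARD('d) * \<delta> * (\<Prod>i\<in>UNIV. E i))"
        using P[of X X] P[of X W] P[of W X] by (simp add: abs_le_iff)
      also have "\<dots> \<le> 4 * (real CARD('d) * \<delta> * (\<Prod>i\<in>UNIV. E i))"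
        using PE0 by (simp add: \<delta>_def)
      also have "\<dots> = K2 * kernel_bound j {i. h $ i = 0}"
        using True unfolding K2_def kernel_bound_def PE \<delta>_def e_def by simp
      finally show ?thesis .
    next
      case False
      have P: "\<bar>\<Prod>i\<in>UNIV. R u v i\<bar> \<le> (\<Prod>i\<in>UNIV. E i)" if "u \<in> {X, W}" "v \<in> {X, W}" for u v
        unfolding abs_prod using R[OF that] by (intro prod_mono) auto
      have "\<bar>(\<Prod>i\<in>UNIV. R X X i) - (\<Prod>i\<in>UNIV. R X W i) - (\<Prod>i\<in>UNIV. R W X i) + (\<Prod>i\<in>UNIV. R W W i)\<bar>
        \<le> 4 * (\<Prod>i\<in>UNIV. E i)"
        using P[of X X] P[of X W] P[of W X] P[of W W] by (simp add: abs_le_iff)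
      also have "\<dots> \<le> 4 * (real CARD('d) * (\<Prod>i\<in>UNIV. E i))"
        using mult_right_mono[OF card PE0] by simp
      also have "\<dots> = K2 * kernel_bound j {i. h $ i = 0}"
        using False unfolding K2_def kernel_bound_def PE e_def by auto
      finally show ?thesis .
    qed
  qed
  ultimately show ?thesis by simp
qed

end

lemma sum_pairs_by_difference:
  fixes B H :: "'a::ab_group_add set" and F :: "'a \<Rightarrow> 'a \<Rightarrow> 'b::comm_monoid_add"
  assumes "finite B" "finite H" "\<And>n m. n \<in> B \<Longrightarrow> m \<in> B \<Longrightarrow> m - n \<in> H"
  shows "(\<Sum>n\<in>B. \<Sum>m\<in>B. F n m) = (\<Sum>h\<in>H. \<Sum>n\<in>{n\<in>B. n + h \<in> B}. F n (n + h))"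
proof -
  have "(\<Sum>m\<in>B. F n m) = (\<Sum>h\<in>{h\<in>H. n + h \<in> B}. F n (n + h))" if "n \<in> B" for n
    by (rule sum.reindex_bij_witness[where i = "\<lambda>h. n + h" and j = "\<lambda>m. m - n"])
      (use assms(3) that in auto)
  then have "(\<Sum>n\<in>B. \<Sum>m\<in>B. F n m) = (\<Sum>n\<in>B. \<Sum>h\<in>{h\<in>H. n + h \<in> B}. F n (n + h))"
    by simp
  also have "\<dots> = (\<Sum>h\<in>H. \<Sum>n\<in>{n\<in>B. n + h \<in> B}. F n (n + h))"
    using assms by (intro sum.swap_restrict)
  finally show ?thesis .
qed

text \<open>Each \<open>h\<close> is charged to its zero set. The shifts with zero set
  \<open>Z\<close> may then be replaced by the whole rectangle flat in \<open>Z\<close>, the kind of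
  set over which the stopping conditions control sums.\<close>

lemma sum_rect_by_zero_set:
  fixes b :: "int ^ 'd::finite \<Rightarrow> real"
  assumes b: "\<And>h. b h \<ge> 0" and \<kappa>: "\<And>Z. \<kappa> Z \<ge> 0"
  shows "(\<Sum>h\<in>rect (\<lambda>_. r). \<kappa> {i. h $ i = 0} * b h)
    \<le> (\<Sum>Z\<in>UNIV. \<kappa> Z * (\<Sum>h\<in>rect (\<lambda>i. if i \<in> Z then 0 else r). b h))"
proof -
  have "(\<Sum>h\<in>rect (\<lambda>_. r). \<kappa> {i. h $ i = 0} * b h)
    = (\<Sum>Z\<in>UNIV. \<Sum>h\<in>{h. h \<in> rect (\<lambda>_. r) \<and> {i. h $ i = 0} = Z}. \<kappa> {i. h $ i = 0} * b h)"
    by (rule sum.group[symmetric]) auto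
  also have "\<dots> = (\<Sum>Z\<in>UNIV. \<kappa> Z * (\<Sum>h\<in>{h. h \<in> rect (\<lambda>_. r) \<and> {i. h $ i = 0} = Z}. b h))"
    unfolding sum_distrib_left by (intro sum.cong refl) auto
  also have "\<dots> \<le> (\<Sum>Z\<in>UNIV. \<kappa> Z * (\<Sum>h\<in>rect (\<lambda>i. if i \<in> Z then 0 else r). b h))"
    using b \<kappa> by (intro sum_mono mult_left_mono sum_mono2) (auto simp: mem_rect)
  finally show ?thesis .
qed

context sparse_set
begin

text \<open>The balance on which the L^2 method rests. With beta = 1 - alpha, a coordinate in
  \<open>Z\<close> contributes 2^(-2 beta j + beta j + beta k) = 2^(-beta (j - k)), and one outside
  contributes 2^(-2 beta j + (1 - 2 alpha) j + j) = 1, up to the factor 3. So a nonempty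
  \<open>Z\<close> gains by itself; for \<open>Z = {}\<close> the gain is the last factor of
  \<open>kernel_bound\<close>.\<close>

lemma kernel_gain:
  assumes kj: "k \<le> j"
  shows "(2 powr (- 2 * (1 - \<alpha>) * real j)) ^ CARD('d) * kernel_bound j Z *
      (\<Prod>i\<in>UNIV. if i \<in> Z then 2 powr ((1 - \<alpha>) * real k) else 3 * 2 ^ j)
    \<le> 3 ^ CARD('d) * 2 powr (- ((1 - 2 * \<alpha>) / 4) * (real j - real k))"
proof -
  define t where "t = real j - real k"
  have t: "t \<ge> 0" using kj by (simp add: t_def)
  define \<epsilon> where "\<epsilon> = (if Z = {} then 2 powr (- ((1 - 2 * \<alpha>) / 4) * real j) else 1)"
  define q where "q = (2::real) powr (- (1 - \<alpha>) * t)"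
  have q: "0 < q" "q \<le> 1"
    using t \<alpha> powr_mono[of "- (1 - \<alpha>) * t" 0 2] mult_nonneg_nonneg[of "1 - \<alpha>" t]
    by (simp_all add: q_def algebra_simps)
  have "(2 powr (- 2 * (1 - \<alpha>) * real j)) ^ CARD('d) * kernel_bound j Z *
      (\<Prod>i\<in>UNIV. if i \<in> Z then 2 powr ((1 - \<alpha>) * real k) else 3 * 2 ^ j)
    = (\<Prod>i\<in>UNIV. 2 powr (- 2 * (1 - \<alpha>) * real j) *
        (if i \<in> Z then 2 powr ((1 - \<alpha>) * real j) else 2 powr ((1 - 2 * \<alpha>) * real j)) *
        (if i \<in> Z then 2 powr ((1 - \<alpha>) * real k) else 3 * 2 ^ j)) * \<epsilon>"
    unfolding kernel_bound_def \<epsilon>_def prod.distrib by simp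
  also have "\<dots> = (\<Prod>i\<in>UNIV. if i \<in> Z then q else 3) * \<epsilon>"
  proof (intro arg_cong[where f = "\<lambda>x. x * \<epsilon>"] prod.cong refl)
    fix i
    have "2 powr (- 2 * (1 - \<alpha>) * real j) * 2 powr ((1 - \<alpha>) * real j) * 2 powr ((1 - \<alpha>) * real k) = q"
      unfolding q_def t_def powr_add[symmetric] by (simp add: algebra_simps)
    moreover have "2 powr (- 2 * (1 - \<alpha>) * real j) * 2 powr ((1 - 2 * \<alpha>) * real j) * 2 powr (real j) = (1::real)"
      unfolding powr_add[symmetric] by (simp add: algebra_simps)
    ultimately show "2 powr (- 2 * (1 - \<alpha>) * real j) *
        (if i \<in> Z then 2 powr ((1 - \<alpha>) * real j) else 2 powr ((1 - 2 * \<alpha>) * real j)) *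
        (if i \<in> Z then 2 powr ((1 - \<alpha>) * real k) else 3 * 2 ^ j) = (if i \<in> Z then q else 3)"
      by (simp add: powr_realpow)
  qed
  also have "\<dots> \<le> 3 ^ CARD('d) * 2 powr (- ((1 - 2 * \<alpha>) / 4) * t)"
  proof (cases "Z = {}")
    case True
    have "(1 - 2 * \<alpha>) / 4 * t \<le> (1 - 2 * \<alpha>) / 4 * real j"
      using \<alpha> by (intro mult_left_mono) (auto simp: t_def)
    then show ?thesis using True by (simp add: \<epsilon>_def)
  next
    case False
    then obtain i0 where i0: "i0 \<in> Z" by auto
    have "(\<Prod>i\<in>UNIV. if i \<in> Z then q else 3) = q * (\<Prod>i\<in>UNIV - {i0}. if i \<in> Z then q else 3)"
      using i0 by (subst prod.remove[of UNIV i0]) auto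
    also have "\<dots> \<le> q * (\<Prod>i\<in>UNIV - {i0}. 3)"
      using q by (intro mult_left_mono prod_mono) auto
    also have "\<dots> \<le> q * 3 ^ CARD('d)"
      using q by (intro mult_left_mono) (auto intro!: power_increasing simp: card_Diff_singleton)
    also have "q \<le> 2 powr (- ((1 - 2 * \<alpha>) / 4) * t)"
    proof -
      have "(1 - 2 * \<alpha>) / 4 * t \<le> (1 - \<alpha>) * t" using \<alpha> t by (intro mult_right_mono) auto
      then show ?thesis unfolding q_def by (simp add: field_simps)
    qed
    finally show ?thesis using False by (simp add: \<epsilon>_def mult_ac)
  qed
  finally show ?thesis unfolding t_def .
qed

end

section \<open>Mean square bounds for averages of the fluctuation\<close>

locale sparse_action = mp_action M T + sparse_set \<alpha> C X
  for M :: "'x measure" and T :: "int ^ 'd::finite \<Rightarrow> 'x \<Rightarrow> 'x"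
  and \<alpha> C :: real and X :: "'d \<Rightarrow> int \<Rightarrow> real"
begin

text \<open>The terms of the expanded square are grouped by the difference \<open>h\<close> of the
  two points. Invariance of the measure makes the integral depend on \<open>h\<close> alone, so the
  coefficients collapse to autocorrelations of \<open>fluct\<close>.\<close>

lemma integral_fluct_sq_le:
  fixes a b :: "'d \<Rightarrow> int" and g :: "'x \<Rightarrow> real"
  assumes ab: "\<And>i. 0 \<le> a i" "\<And>i. b i \<le> 2 ^ j"
    and g [measurable]: "g \<in> borel_measurable M" and bdd: "\<And>x. x \<in> space M \<Longrightarrow> \<bar>g x\<bar> \<le> D"
  defines "B \<equiv> vbox (\<lambda>i. {a i<..b i})"
  shows "(\<integral>x. (\<Sum>n\<in>B. fluct n * g (T n x))\<^sup>2 \<partial>M)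
    \<le> K2 * (\<Sum>Z\<in>UNIV. kernel_bound j Z *
        (\<Sum>h\<in>rect (\<lambda>i. if i \<in> Z then 0 else 2 ^ j). \<integral>x. \<bar>g (T 0 x)\<bar> * \<bar>g (T h x)\<bar> \<partial>M))"
proof -
  define H where "H = (rect (\<lambda>_. 2 ^ j) :: (int ^ 'd) set)"
  have fin: "finite B" "finite H" by (auto simp: B_def H_def)
  have D0: "D \<ge> 0"
  proof -
    obtain x where "x \<in> space M" using not_empty by blast
    from bdd[OF this] show ?thesis by linarith
  qed
  have diff: "m - n \<in> H" if "n \<in> B" "m \<in> B" for n m
  proof -
    have "\<bar>m $ i - n $ i\<bar> \<le> 2 ^ j" for i
    proof -
      have "a i < n $ i" "n $ i \<le> b i" "a i < m $ i" "m $ i \<le> b i" using that by (auto simp: B_def)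
      then show ?thesis using ab[of i] by linarith
    qed
    then show ?thesis by (simp add: H_def mem_rect)
  qed
  have int2: "integrable M (\<lambda>x. g (T n x) * g (T m x))" for n m
    by (rule integrable_const_bound[where B = "D * D"])
      (auto simp: abs_mult intro!: AE_I2 mult_mono bdd D0)
  \<comment> \<open>\<open>T 0\<close> is written out because it may differ from the
    identity.\<close>
  define c where "c = (\<lambda>h. \<integral>x. g (T 0 x) * g (T h x) \<partial>M)"
  have corr: "(\<integral>x. g (T n x) * g (T (n + h) x) \<partial>M) = c h" for n h
  proof -
    have "c h = (\<integral>x. g (T 0 (T n x)) * g (T h (T n x)) \<partial>M)"
      unfolding c_def by (rule integral_T[symmetric]) measurable
    also have "\<dots> = (\<integral>x. g (T n x) * g (T (n + h) x) \<partial>M)"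
      by (intro Bochner_Integration.integral_cong refl) (simp add: T_T add.commute)
    finally show ?thesis by simp
  qed
  have "(\<integral>x. (\<Sum>n\<in>B. fluct n * g (T n x))\<^sup>2 \<partial>M)
      = (\<integral>x. (\<Sum>n\<in>B. \<Sum>m\<in>B. (fluct n * fluct m) * (g (T n x) * g (T m x))) \<partial>M)"
    by (intro Bochner_Integration.integral_cong refl)
      (simp add: power2_eq_square sum_product mult_ac)
  also have "\<dots> = (\<Sum>n\<in>B. \<Sum>m\<in>B. (fluct n * fluct m) * (\<integral>x. g (T n x) * g (T m x) \<partial>M))"
    using int2 by (simp add: Bochner_Integration.integral_sum Bochner_Integration.integrable_sum)
  also have "\<dots> = (\<Sum>h\<in>H. \<Sum>n\<in>{n\<in>B. n + h \<in> B}. (fluct n * fluct (n + h)) * (\<integral>x. g (T n x) * g (T (n + h) x) \<partial>M))"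
    by (rule sum_pairs_by_difference[OF fin diff])
  also have "\<dots> = (\<Sum>h\<in>H. (\<Sum>n\<in>{n\<in>B. n + h \<in> B}. fluct n * fluct (n + h)) * c h)"
    by (simp only: corr sum_distrib_right)
  also have "\<dots> \<le> (\<Sum>h\<in>H. (K2 * kernel_bound j {i. h $ i = 0}) * (\<integral>x. \<bar>g (T 0 x)\<bar> * \<bar>g (T h x)\<bar> \<partial>M))"
  proof (rule sum_mono)
    fix h
    let ?s = "\<Sum>n\<in>{n\<in>B. n + h \<in> B}. fluct n * fluct (n + h)"
    have "?s * c h \<le> \<bar>?s\<bar> * \<bar>c h\<bar>" using abs_ge_self[of "?s * c h"] by (simp only: abs_mult)
    also have "\<dots> \<le> (K2 * kernel_bound j {i. h $ i = 0}) * (\<integral>x. \<bar>g (T 0 x)\<bar> * \<bar>g (T h x)\<bar> \<partial>M)"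
    proof (rule mult_mono)
      show "\<bar>?s\<bar> \<le> K2 * kernel_bound j {i. h $ i = 0}"
        unfolding B_def by (rule fluct_autocorrelation) (use ab in auto)
      show "\<bar>c h\<bar> \<le> (\<integral>x. \<bar>g (T 0 x)\<bar> * \<bar>g (T h x)\<bar> \<partial>M)"
        unfolding c_def abs_mult[symmetric] by (rule integral_abs_bound)
    qed (auto intro!: mult_nonneg_nonneg K2_nonneg kernel_bound_nonneg)
    finally show "?s * c h \<le> (K2 * kernel_bound j {i. h $ i = 0}) * (\<integral>x. \<bar>g (T 0 x)\<bar> * \<bar>g (T h x)\<bar> \<partial>M)" .
  qed
  also have "\<dots> = K2 * (\<Sum>h\<in>H. kernel_bound j {i. h $ i = 0} * (\<integral>x. \<bar>g (T 0 x)\<bar> * \<bar>g (T h x)\<bar> \<partial>M))"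
    by (simp add: sum_distrib_left mult_ac)
  also have "\<dots> \<le> K2 * (\<Sum>Z\<in>UNIV. kernel_bound j Z *
        (\<Sum>h\<in>rect (\<lambda>i. if i \<in> Z then 0 else 2 ^ j). \<integral>x. \<bar>g (T 0 x)\<bar> * \<bar>g (T h x)\<bar> \<partial>M))"
    unfolding H_def by (intro mult_left_mono K2_nonneg sum_rect_by_zero_set kernel_bound_nonneg) auto
  finally show ?thesis .
qed

text \<open>For a bounded function the trivial bound of the correlations already has the form
  required in \<open>kernel_gain\<close> with \<open>k = 0\<close>, so the full gain in
  \<open>j\<close> results. The 6 is 3 from there times 2 for the number of sets
  \<open>Z\<close>.\<close>

lemma integral_fluct_sq_bounded:
  fixes a b :: "'d \<Rightarrow> int" and g :: "'x \<Rightarrow> real"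
  assumes ab: "\<And>i. 0 \<le> a i" "\<And>i. b i \<le> 2 ^ j"
    and g [measurable]: "g \<in> borel_measurable M" and bdd: "\<And>x. x \<in> space M \<Longrightarrow> \<bar>g x\<bar> \<le> D"
  shows "(\<integral>x. ((2 powr (- (1 - \<alpha>) * real j)) ^ CARD('d) *
      (\<Sum>n\<in>vbox (\<lambda>i. {a i<..b i}). fluct n * g (T n x)))\<^sup>2 \<partial>M)
    \<le> K2 * 6 ^ CARD('d) * D\<^sup>2 * 2 powr (- ((1 - 2 * \<alpha>) / 4) * real j)"
proof -
  define G where "G = (2 powr (- 2 * (1 - \<alpha>) * real j)) ^ CARD('d)"
  define \<epsilon> where "\<epsilon> = 2 powr (- ((1 - 2 * \<alpha>) / 4) * real j)"
  have D0: "D \<ge> 0"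
  proof -
    obtain x where "x \<in> space M" using not_empty by blast
    from bdd[OF this] show ?thesis by linarith
  qed
  have Gsq: "((2 powr (- (1 - \<alpha>) * real j)) ^ CARD('d))\<^sup>2 = G"
    unfolding G_def power2_eq_square power_mult_distrib[symmetric] powr_add[symmetric] by (simp add: algebra_simps)
  have rect: "(\<Sum>h\<in>rect (\<lambda>i. if i \<in> Z then 0 else 2 ^ j). \<integral>x. \<bar>g (T 0 x)\<bar> * \<bar>g (T h x)\<bar> \<partial>M)
      \<le> (\<Prod>i\<in>UNIV. if i \<in> Z then 2 powr ((1 - \<alpha>) * real 0) else 3 * 2 ^ j) * D\<^sup>2" (is "_ \<le> ?P * _") for Z :: "'d set"
  proof -
    have "(\<integral>x. \<bar>g (T 0 x)\<bar> * \<bar>g (T h x)\<bar> \<partial>M) \<le> D\<^sup>2" for h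
    proof (rule integral_le_const)
      show "AE x in M. \<bar>g (T 0 x)\<bar> * \<bar>g (T h x)\<bar> \<le> D\<^sup>2"
        unfolding power2_eq_square by (intro AE_I2 mult_mono bdd D0 T_in_space) auto
      show "integrable M (\<lambda>x. \<bar>g (T 0 x)\<bar> * \<bar>g (T h x)\<bar>)"
        by (rule integrable_const_bound[where B = "D * D"])
          (auto simp: abs_mult intro!: AE_I2 mult_mono bdd D0)
    qed
    then have "(\<Sum>h\<in>rect (\<lambda>i. if i \<in> Z then 0 else 2 ^ j). \<integral>x. \<bar>g (T 0 x)\<bar> * \<bar>g (T h x)\<bar> \<partial>M)
      \<le> real (card (rect (\<lambda>i. if i \<in> Z then 0 else 2 ^ j))) * D\<^sup>2"
      by (intro sum_bounded_above)
    also have "real (card (rect (\<lambda>i. if i \<in> Z then 0 else 2 ^ j)))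
      = (\<Prod>i\<in>UNIV. if i \<in> Z then 1 else 2 * 2 ^ j + 1)"
      unfolding card_rect of_nat_prod by (intro prod.cong) auto
    also have "\<dots> \<le> ?P" by (intro prod_mono) auto
    finally show ?thesis by (simp add: mult_right_mono)
  qed
  have "(\<integral>x. ((2 powr (- (1 - \<alpha>) * real j)) ^ CARD('d) *
      (\<Sum>n\<in>vbox (\<lambda>i. {a i<..b i}). fluct n * g (T n x)))\<^sup>2 \<partial>M)
    = G * (\<integral>x. (\<Sum>n\<in>vbox (\<lambda>i. {a i<..b i}). fluct n * g (T n x))\<^sup>2 \<partial>M)"
    unfolding power_mult_distrib Gsq by simp
  also have "\<dots> \<le> G * (K2 * (\<Sum>Z\<in>UNIV. kernel_bound j Z *
        (\<Sum>h\<in>rect (\<lambda>i. if i \<in> Z then 0 else 2 ^ j). \<integral>x. \<bar>g (T 0 x)\<bar> * \<bar>g (T h x)\<bar> \<partial>M)))"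
    by (intro mult_left_mono integral_fluct_sq_le[where D = D] ab g bdd) (auto simp: G_def)
  also have "\<dots> \<le> G * (K2 * (\<Sum>Z\<in>UNIV. kernel_bound j Z *
        ((\<Prod>i\<in>UNIV. if i \<in> Z then 2 powr ((1 - \<alpha>) * real 0) else 3 * 2 ^ j) * D\<^sup>2)))"
    by (intro mult_left_mono sum_mono rect K2_nonneg kernel_bound_nonneg) (simp add: G_def)
  also have "\<dots> = K2 * D\<^sup>2 * (\<Sum>Z\<in>UNIV. G * kernel_bound j Z *
        (\<Prod>i\<in>UNIV. if i \<in> Z then 2 powr ((1 - \<alpha>) * real 0) else 3 * 2 ^ j))"
    unfolding sum_distrib_left by (intro sum.cong refl) (simp only: mult_ac)
  also have "\<dots> \<le> K2 * D\<^sup>2 * (\<Sum>Z\<in>(UNIV::'d set set). 3 ^ CARD('d) * \<epsilon>)"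
    unfolding G_def \<epsilon>_def using kernel_gain[of 0 j]
    by (intro mult_left_mono sum_mono mult_nonneg_nonneg K2_nonneg) auto
  also have "\<dots> = K2 * D\<^sup>2 * ((2 * 3) ^ CARD('d) * \<epsilon>)"
    unfolding power_mult_distrib by (simp add: card_UNIV_set)
  finally show ?thesis by (simp add: \<epsilon>_def mult_ac)
qed

end

lemma abs_diff_le_if_div_eq:
  fixes a b K :: int
  assumes "K > 0" "a div K = b div K"
  shows "\<bar>a - b\<bar> \<le> K"
proof -
  define r s where "r = a mod K" and "s = b mod K"
  have "a - b = r - s"
    by (simp add: r_def s_def minus_div_mult_eq_mod[symmetric] assms)
  moreover have "0 \<le> r" "r < K" "0 \<le> s" "s < K" using assms by (auto simp: r_def s_def)
  ultimately show ?thesis by linarith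
qed

text \<open>Division by \<open>2 ^ k\<close> cuts the rectangle into blocks. A block on which
  \<open>g\<close> does not vanish lies within distance \<open>2 ^ k\<close> of any of its points
  with \<open>g > 0\<close>, and there \<open>local\<close> applies. A local bound at points with
  \<open>g > 0\<close> is all that a truncated function offers.\<close>

lemma sum_rect_blocks_le:
  fixes g :: "int ^ 'd::finite \<Rightarrow> real"
  assumes g: "\<And>h. g h \<ge> 0" and V: "V \<ge> 0" and kj: "k \<le> j"
    and local: "\<And>h. g h > 0 \<Longrightarrow> (\<Sum>m\<in>rect (\<lambda>i. if i \<in> Z then 0 else 2 ^ k). g (m + h)) \<le> V"
  shows "(\<Sum>h\<in>rect (\<lambda>i. if i \<in> Z then 0 else 2 ^ j). g h)
    \<le> (\<Prod>i\<in>UNIV. if i \<in> Z then 1 else 3 * 2 ^ (j - k)) * V"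
proof -
  let ?R = "rect (\<lambda>i. if i \<in> Z then 0 else 2 ^ j) :: (int ^ 'd) set"
  let ?Q = "rect (\<lambda>i. if i \<in> Z then 0 else 2 ^ (j - k)) :: (int ^ 'd) set"
  define q where "q = (\<lambda>h::int ^ 'd. \<chi> i. h $ i div 2 ^ k)"
  have pow: "(2::int) ^ j = 2 ^ (j - k) * 2 ^ k" using kj by (simp add: power_add[symmetric])
  have qQ: "q h \<in> ?Q" if "h \<in> ?R" for h
    unfolding mem_rect
  proof
    fix i
    have h: "\<bar>h $ i\<bar> \<le> int (if i \<in> Z then 0 else 2 ^ j)" using that by (simp add: mem_rect)
    show "\<bar>q h $ i\<bar> \<le> int (if i \<in> Z then 0 else 2 ^ (j - k))"
    proof (cases "i \<in> Z")
      case True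
      then show ?thesis using h by (simp add: q_def)
    next
      case False
      then have h': "- (2 ^ j) \<le> h $ i" "h $ i \<le> 2 ^ j" using h by (auto simp: abs_le_iff)
      have "h $ i div 2 ^ k \<le> 2 ^ j div 2 ^ k" using h'(2) by (intro zdiv_mono1) auto
      moreover have "(- (2 ^ (j - k)) * 2 ^ k) div 2 ^ k \<le> h $ i div 2 ^ k"
        using h'(1) pow by (intro zdiv_mono1) auto
      then have "- (2 ^ (j - k)) \<le> h $ i div 2 ^ k"
        by (subst (asm) nonzero_mult_div_cancel_right) auto
      ultimately show ?thesis using False by (simp add: q_def pow abs_le_iff)
    qed
  qed
  have fiber: "(\<Sum>h\<in>{h. h \<in> ?R \<and> q h = z}. g h) \<le> V" for z
  proof (cases "\<exists>h\<in>?R. q h = z \<and> g h > 0")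
    case False
    have "g h = 0" if "h \<in> ?R" "q h = z" for h
    proof -
      have "\<not> g h > 0" using False that by blast
      then show ?thesis using g[of h] by linarith
    qed
    then have "(\<Sum>h\<in>{h. h \<in> ?R \<and> q h = z}. g h) = 0" by (intro sum.neutral) blast
    then show ?thesis using V by simp
  next
    case True
    then obtain h0 where h0: "h0 \<in> ?R" "q h0 = z" "g h0 > 0" by blast
    have sub: "{h. h \<in> ?R \<and> q h = z} \<subseteq> (\<lambda>m. m + h0) ` rect (\<lambda>i. if i \<in> Z then 0 else 2 ^ k)"
    proof
      fix h assume h: "h \<in> {h. h \<in> ?R \<and> q h = z}"
      have "\<bar>(h - h0) $ i\<bar> \<le> int (if i \<in> Z then 0 else 2 ^ k)" for i
      proof (cases "i \<in> Z")
        case True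
        have "\<bar>h $ i\<bar> \<le> int (if i \<in> Z then 0 else 2 ^ j)" "\<bar>h0 $ i\<bar> \<le> int (if i \<in> Z then 0 else 2 ^ j)"
          using h h0(1) unfolding mem_rect by blast+
        then show ?thesis using True by simp
      next
        case False
        have "q h $ i = q h0 $ i" using h h0(2) by simp
        then have "h $ i div 2 ^ k = h0 $ i div 2 ^ k" by (simp add: q_def)
        then have "\<bar>h $ i - h0 $ i\<bar> \<le> 2 ^ k" by (intro abs_diff_le_if_div_eq) auto
        then show ?thesis using False by simp
      qed
      then show "h \<in> (\<lambda>m. m + h0) ` rect (\<lambda>i. if i \<in> Z then 0 else 2 ^ k)"
        unfolding image_iff mem_rect by (intro bexI[of _ "h - h0"]) (auto simp: mem_rect)
    qed
    have "(\<Sum>h\<in>{h. h \<in> ?R \<and> q h = z}. g h)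
        \<le> (\<Sum>h\<in>(\<lambda>m. m + h0) ` rect (\<lambda>i. if i \<in> Z then 0 else 2 ^ k). g h)"
      using sub g by (intro sum_mono2) auto
    also have "\<dots> = (\<Sum>m\<in>rect (\<lambda>i. if i \<in> Z then 0 else 2 ^ k). g (m + h0))"
      by (simp add: sum.reindex o_def)
    also have "\<dots> \<le> V" by (rule local[OF h0(3)])
    finally show ?thesis .
  qed
  have "(\<Sum>h\<in>?R. g h) = (\<Sum>z\<in>?Q. \<Sum>h\<in>{h. h \<in> ?R \<and> q h = z}. g h)"
    using qQ by (intro sum.group[symmetric]) auto
  also have "\<dots> \<le> (\<Sum>z\<in>?Q. V)" by (intro sum_mono fiber)
  also have "\<dots> = real (card ?Q) * V" by simp
  also have "real (card ?Q) = (\<Prod>i\<in>UNIV. if i \<in> Z then 1 else 2 * 2 ^ (j - k) + 1)"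
    unfolding card_rect of_nat_prod by (intro prod.cong) auto
  also have "\<dots> \<le> (\<Prod>i\<in>UNIV. if i \<in> Z then 1 else 3 * 2 ^ (j - k))"
    by (intro prod_mono) auto
  finally show ?thesis using V by (simp add: mult_right_mono)
qed

text \<open>Cauchy-Schwarz with the weights \<open>\<sigma> ^ (j - k)\<close>. The loss in the
  denominator is paid for later by half of the decay in \<open>j - k\<close> of the mean
  squares.\<close>

lemma convolution_weighted_le:
  fixes \<Phi> :: "nat \<Rightarrow> real"
  assumes \<sigma>: "0 < \<sigma>" "\<sigma> < 1"
  shows "(\<Sum>k\<le>j. \<Phi> k)\<^sup>2 \<le> 1 / (1 - \<sigma>\<^sup>2) * (\<Sum>k\<le>j. (\<Phi> k)\<^sup>2 / \<sigma> ^ (2 * (j - k)))"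
proof -
  have "(\<Sum>k\<le>j. \<Phi> k)\<^sup>2 = (\<Sum>k\<le>j. \<sigma> ^ (j - k) * (\<Phi> k / \<sigma> ^ (j - k)))\<^sup>2"
    using \<sigma> by simp
  also have "\<dots> \<le> (\<Sum>k\<le>j. (\<sigma> ^ (j - k))\<^sup>2) * (\<Sum>k\<le>j. (\<Phi> k / \<sigma> ^ (j - k))\<^sup>2)"
    by (rule Cauchy_Schwarz_ineq_sum)
  also have "(\<Sum>k\<le>j. (\<Phi> k / \<sigma> ^ (j - k))\<^sup>2) = (\<Sum>k\<le>j. (\<Phi> k)\<^sup>2 / \<sigma> ^ (2 * (j - k)))"
    by (simp add: power_divide power_mult[symmetric] mult.commute)
  also have "(\<Sum>k\<le>j. (\<sigma> ^ (j - k))\<^sup>2) = (\<Sum>k\<le>j. (\<sigma>\<^sup>2) ^ k)"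
    by (subst sum.nat_diff_reindex[symmetric, of _ "Suc j", unfolded lessThan_Suc_atMost])
      (auto intro!: sum.cong simp: power_mult[symmetric] mult.commute)
  also have "(\<Sum>k\<le>j. (\<sigma>\<^sup>2) ^ k) * (\<Sum>k\<le>j. (\<Phi> k)\<^sup>2 / \<sigma> ^ (2 * (j - k)))
      \<le> 1 / (1 - \<sigma>\<^sup>2) * (\<Sum>k\<le>j. (\<Phi> k)\<^sup>2 / \<sigma> ^ (2 * (j - k)))"
  proof (intro mult_right_mono sum_nonneg)
    have "\<sigma>\<^sup>2 < 1" using \<sigma> by (simp add: power_less_one_iff abs_square_less_1)
    then have "norm (\<sigma>\<^sup>2) < 1" by simp
    then have "(\<Sum>k\<le>j. (\<sigma>\<^sup>2) ^ k) \<le> (\<Sum>k. (\<sigma>\<^sup>2) ^ k)"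
      by (intro sum_le_suminf summable_geometric) auto
    then show "(\<Sum>k\<le>j. (\<sigma>\<^sup>2) ^ k) \<le> 1 / (1 - \<sigma>\<^sup>2)"
      using \<open>norm (\<sigma>\<^sup>2) < 1\<close> by (simp add: suminf_geometric)
  qed (use \<sigma> in auto)
  finally show ?thesis .
qed

section \<open>Truncation at the stopping level\<close>

lemma prod_if_le_const_mult:
  fixes c :: real
  assumes "c \<ge> 1" "\<And>i. u i \<le> c * v i" "\<And>i. 0 \<le> u i"
  shows "(\<Prod>i\<in>(UNIV::'d::finite set). u i) \<le> c ^ CARD('d) * (\<Prod>i\<in>UNIV. v i)"
proof -
  have "(\<Prod>i\<in>UNIV. u i) \<le> (\<Prod>i\<in>UNIV. c * v i)" using assms by (intro prod_mono) auto
  then show ?thesis by (simp add: prod.distrib)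
qed

context sparse_set
begin

definition nrm :: "nat \<Rightarrow> real" where
  "nrm j = (2 powr (- (1 - \<alpha>) * real j)) ^ CARD('d)"

lemma nrm_pos: "nrm j > 0"
  by (simp add: nrm_def)

end

context sparse_action
begin

definition samp_avg :: "nat \<Rightarrow> ('x \<Rightarrow> real) \<Rightarrow> 'x \<Rightarrow> real" where
  "samp_avg j f x = nrm j * (\<Sum>n\<in>vbox (\<lambda>_. {0<..2 ^ j}). (\<Prod>i\<in>UNIV. X i (n $ i)) * f (T n x))"

definition fluct_avg :: "nat \<Rightarrow> ('x \<Rightarrow> real) \<Rightarrow> 'x \<Rightarrow> real" where
  "fluct_avg j f x = nrm j * (\<Sum>n\<in>vbox (\<lambda>_. {0<..2 ^ j}). fluct n * f (T n x))"

lemma samp_avg_split: "samp_avg j f x = mean_avg \<alpha> j f x + fluct_avg j f x"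
  unfolding samp_avg_def mean_avg_def fluct_avg_def nrm_def fluct_def wt_def
  by (simp add: sum.distrib[symmetric] distrib_left[symmetric] left_diff_distrib)

lemma samp_avg_measurable [measurable]:
  assumes [measurable]: "f \<in> borel_measurable M"
  shows "samp_avg j f \<in> borel_measurable M"
  unfolding samp_avg_def[abs_def] by measurable

lemma fluct_avg_measurable [measurable]:
  assumes [measurable]: "f \<in> borel_measurable M"
  shows "fluct_avg j f \<in> borel_measurable M"
  unfolding fluct_avg_def[abs_def] by measurable

lemma mean_avg_measurable [measurable]:
  assumes f: "f \<in> borel_measurable M"
  shows "mean_avg \<alpha> j f \<in> borel_measurable M"
  unfolding mean_avg_def[abs_def]
  by (intro borel_measurable_times borel_measurable_const borel_measurable_sum
      measurable_compose[OF T_measurable f])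

text \<open>Up to constants, \<open>t\<close> times the size of a set with side \<open>2 ^ k\<close>
  in the coordinates outside \<open>Z\<close> and, in those of \<open>Z\<close>, with as many points
  as the random set has up to \<open>2 ^ k\<close>. In \<open>heavy\<close>, \<open>Z = {}\<close>
  concerns averages over full cubes and \<open>Z = UNIV\<close> the single values of
  \<open>f\<close>.\<close>

definition threshold :: "real \<Rightarrow> 'd set \<Rightarrow> nat \<Rightarrow> real" where
  "threshold t Z k = t * (\<Prod>i\<in>UNIV. if i \<in> Z then 2 powr ((1 - \<alpha>) * real k) else 2 ^ k)"

text \<open>
  For each set \<open>Z\<close> of coordinates, the averages run over the coordinates outside \<open>Z\<close> only: pairs of
  points of a product set may agree in the coordinates in \<open>Z\<close>, and such pairs are more frequent by a
  factor \<open>2 powr (\<alpha> * k)\<close> per coordinate than the density suggests.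
\<close>

definition heavy :: "('x \<Rightarrow> real) \<Rightarrow> real \<Rightarrow> nat \<Rightarrow> 'x \<Rightarrow> bool" where
  "heavy f t k y \<longleftrightarrow> (\<exists>Z. threshold t Z k < (\<Sum>m\<in>rect (\<lambda>i. if i \<in> Z then 0 else 2 ^ k). f (T m y)))"

definition light_from :: "('x \<Rightarrow> real) \<Rightarrow> real \<Rightarrow> nat \<Rightarrow> nat \<Rightarrow> 'x \<Rightarrow> bool" where
  "light_from f t J k y \<longleftrightarrow> (\<forall>l\<in>{k..J}. \<not> heavy f t l y)"

definition truncated :: "('x \<Rightarrow> real) \<Rightarrow> real \<Rightarrow> nat \<Rightarrow> nat \<Rightarrow> 'x \<Rightarrow> real" where
  "truncated f t J j y = (if light_from f t J j y then f y else 0)"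

text \<open>For \<open>k \<le> J\<close> this is the part of \<open>f\<close> at the points whose
  last heavy scale up to \<open>J\<close> is \<open>k - 1\<close>, or which have no heavy scale when
  \<open>k = 0\<close>.\<close>

definition level :: "('x \<Rightarrow> real) \<Rightarrow> real \<Rightarrow> nat \<Rightarrow> nat \<Rightarrow> 'x \<Rightarrow> real" where
  "level f t J k y = (if light_from f t J k y \<and> (k = 0 \<or> heavy f t (k - 1) y) then f y else 0)"

lemma threshold_nonneg: "t \<ge> 0 \<Longrightarrow> threshold t Z k \<ge> 0"
  unfolding threshold_def by (intro mult_nonneg_nonneg prod_nonneg) auto

lemma heavy_measurable [measurable]:
  assumes [measurable]: "f \<in> borel_measurable M"
  shows "Measurable.pred M (heavy f t k)"
  unfolding heavy_def[abs_def] by measurable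

lemma light_from_measurable [measurable]:
  assumes [measurable]: "f \<in> borel_measurable M"
  shows "Measurable.pred M (light_from f t J k)"
  unfolding light_from_def[abs_def] by measurable

lemma truncated_measurable [measurable]:
  assumes [measurable]: "f \<in> borel_measurable M"
  shows "truncated f t J k \<in> borel_measurable M"
  unfolding truncated_def[abs_def] by measurable

lemma level_measurable [measurable]:
  assumes [measurable]: "f \<in> borel_measurable M"
  shows "level f t J k \<in> borel_measurable M"
  unfolding level_def[abs_def] by measurable

text \<open>A point that is light from \<open>j\<close> on belongs to exactly one level, the least
  index from which it is light.\<close>

lemma truncated_eq_sum_level:
  assumes "j \<le> J"
  shows "truncated f t J j y = (\<Sum>k\<le>j. level f t J k y)"
proof (cases "light_from f t J j y")
  case False
  then have "\<not> light_from f t J k y" if "k \<le> j" for k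
    using that by (auto simp: light_from_def)
  then show ?thesis using False by (simp add: truncated_def level_def)
next
  case True
  define k0 where "k0 = (LEAST k. light_from f t J k y)"
  have k0: "light_from f t J k0 y" "k0 \<le> j"
    unfolding k0_def using True by (rule LeastI, rule Least_le)
  have min: "k0 \<le> k" if "light_from f t J k y" for k
    unfolding k0_def using that by (rule Least_le)
  have "level f t J k y = (if k = k0 then f y else 0)" if "k \<le> j" for k
  proof -
    have uniq: "k = k0" if "light_from f t J k y" "k = 0 \<or> heavy f t (k - 1) y"
    proof (rule ccontr)
      assume "k \<noteq> k0"
      then have "k0 \<le> k - 1" "k \<noteq> 0" using min[OF that(1)] by auto
      moreover have "k - 1 \<le> J" using \<open>k \<le> j\<close> assms by simp
      ultimately show False using that(2) k0(1) by (auto simp: light_from_def)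
    qed
    have first: "k0 = 0 \<or> heavy f t (k0 - 1) y"
    proof (rule ccontr)
      assume *: "\<not> (k0 = 0 \<or> heavy f t (k0 - 1) y)"
      have "light_from f t J (k0 - 1) y"
        unfolding light_from_def
      proof
        fix l assume "l \<in> {k0 - 1..J}"
        then have "l = k0 - 1 \<or> l \<in> {k0..J}" by auto
        then show "\<not> heavy f t l y" using * k0(1) by (auto simp: light_from_def)
      qed
      then have "k0 \<le> k0 - 1" by (rule min)
      moreover have "k0 \<noteq> 0"
      proof
        assume "k0 = 0"
        then have "k0 = 0 \<or> heavy f t (k0 - 1) y" by (rule disjI1)
        with * show False by (rule notE)
      qed
      ultimately show False by linarith
    qed
    show ?thesis
    proof (cases "k = k0")
      case True
      then show ?thesis unfolding level_def using k0(1) first by presburger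
    next
      case False
      then have "\<not> (light_from f t J k y \<and> (k = 0 \<or> heavy f t (k - 1) y))"
        by (rule contrapos_nn) (elim conjE, rule uniq)
      then show ?thesis unfolding level_def by (simp only: False if_False)
    qed
  qed
  then have "(\<Sum>k\<le>j. level f t J k y) = (\<Sum>k\<le>j. if k = k0 then f y else 0)" by simp
  also have "\<dots> = f y" using k0(2) by simp
  finally show ?thesis using True by (simp add: truncated_def)
qed

context
  fixes f :: "'x \<Rightarrow> real" and t :: real and J :: nat
  assumes f: "integrable M f" "\<And>x. f x \<ge> 0" and t: "t > 0"
begin

lemma f_measurable [measurable]: "f \<in> borel_measurable M"
  using f by simp

lemma level_bounds: "0 \<le> level f t J k y" "level f t J k y \<le> f y"
  using f by (auto simp: level_def)

lemma integrable_level: "integrable M (level f t J k)"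
  using level_bounds f by (intro Bochner_Integration.integrable_bound[OF f(1)]) auto

text \<open>A point of level \<open>k\<close> is light at the scale \<open>k\<close> itself, for
  every \<open>Z\<close> at once, and passing from \<open>f\<close> to its level only decreases the
  sum.\<close>

lemma level_local_sum_le:
  assumes k: "k \<le> J" and y: "level f t J k y > 0"
  shows "(\<Sum>m\<in>rect (\<lambda>i. if i \<in> Z then 0 else 2 ^ k). level f t J k (T m y)) \<le> threshold t Z k"
proof -
  have "\<not> heavy f t k y" using y k by (auto simp: level_def light_from_def split: if_splits)
  then have "(\<Sum>m\<in>rect (\<lambda>i. if i \<in> Z then 0 else 2 ^ k). f (T m y)) \<le> threshold t Z k"
    unfolding heavy_def by (meson not_le)
  moreover have "(\<Sum>m\<in>rect (\<lambda>i. if i \<in> Z then 0 else 2 ^ k). level f t J k (T m y))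
      \<le> (\<Sum>m\<in>rect (\<lambda>i. if i \<in> Z then 0 else 2 ^ k). f (T m y))"
    by (intro sum_mono level_bounds)
  ultimately show ?thesis by linarith
qed

text \<open>Blocks carry the local bound from scale \<open>k\<close> to scale \<open>j\<close>.
  Outside \<open>Z\<close>, \<open>3 * 2 ^ (j - k)\<close> blocks of side \<open>2 ^ k\<close> give
  \<open>3 * 2 ^ j\<close>; in \<open>Z\<close> the bound stays at the smaller scale
  \<open>k\<close>, and this is the source of the gain for nonempty \<open>Z\<close>.\<close>

lemma level_sum_le:
  assumes k: "k \<le> j" "j \<le> J" and y: "y \<in> space M"
  shows "(\<Sum>h\<in>rect (\<lambda>i. if i \<in> Z then 0 else 2 ^ j). level f t J k (T h y))
    \<le> t * (\<Prod>i\<in>UNIV. if i \<in> Z then 2 powr ((1 - \<alpha>) * real k) else 3 * 2 ^ j)"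
proof -
  have "(\<Sum>h\<in>rect (\<lambda>i. if i \<in> Z then 0 else 2 ^ j). level f t J k (T h y))
    \<le> (\<Prod>i\<in>UNIV. if i \<in> Z then 1 else 3 * 2 ^ (j - k)) * threshold t Z k"
  proof (rule sum_rect_blocks_le)
    fix h assume "0 < level f t J k (T h y)"
    then show "(\<Sum>m\<in>rect (\<lambda>i. if i \<in> Z then 0 else 2 ^ k). level f t J k (T (m + h) y)) \<le> threshold t Z k"
      using level_local_sum_le[of k "T h y" Z] k y by (simp add: T_T)
  qed (use k t in \<open>auto simp: level_bounds threshold_nonneg\<close>)
  also have "\<dots> = t * (\<Prod>i\<in>UNIV. (if i \<in> Z then 1 else 3 * 2 ^ (j - k)) *
      (if i \<in> Z then 2 powr ((1 - \<alpha>) * real k) else 2 ^ k))"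
    unfolding threshold_def prod.distrib by simp
  also have "\<dots> = t * (\<Prod>i\<in>UNIV. if i \<in> Z then 2 powr ((1 - \<alpha>) * real k) else 3 * 2 ^ j)"
    using k by (intro arg_cong[where f = "(*) t"] prod.cong) (auto simp: power_add[symmetric])
  finally show ?thesis .
qed

text \<open>The rectangle with all radii 0 is the origin, so \<open>Z = UNIV\<close> turns lightness
  into a pointwise bound. It is what makes the level functions square integrable.\<close>

lemma level_le:
  assumes k: "k \<le> J" and y: "y \<in> space M"
  shows "level f t J k (T 0 y) \<le> threshold t UNIV k"
proof (cases "level f t J k (T 0 y) > 0")
  case True
  have "rect (\<lambda>i. if i \<in> UNIV then 0 else 2 ^ k) = {0 :: int ^ 'd}"
    by (auto simp: mem_rect vec_eq_iff)
  then show ?thesis using level_local_sum_le[OF k True, of UNIV] y by (simp add: T_T)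
next
  case False
  then show ?thesis using threshold_nonneg[of t UNIV k] t by simp
qed

text \<open>A sixteenth, so that the gain of \<open>kernel_gain\<close> is a fourth power: one
  square is spent in \<open>convolution_weighted_le\<close>, the other is summed over
  \<open>j\<close>.\<close>

definition decay :: real where "decay = 2 powr (- ((1 - 2 * \<alpha>) / 16))"

lemma decay: "0 < decay" "decay < 1"
proof -
  have "decay < 2 powr 0" unfolding decay_def using \<alpha> by (intro powr_less_mono) auto
  then show "0 < decay" "decay < 1" by (simp_all add: decay_def)
qed

lemma decay_power:
  "k \<le> j \<Longrightarrow> 2 powr (- ((1 - 2 * \<alpha>) / 4) * (real j - real k)) = decay ^ (4 * (j - k))"
proof -
  assume "k \<le> j"
  then have "real (4 * (j - k)) = 4 * (real j - real k)" by (simp add: of_nat_diff)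
  then have "decay ^ (4 * (j - k)) = 2 powr ((4 * (real j - real k)) * - ((1 - 2 * \<alpha>) / 16))"
    by (simp add: decay_def powr_power)
  also have "(4 * (real j - real k)) * - ((1 - 2 * \<alpha>) / 16) = - ((1 - 2 * \<alpha>) / 4) * (real j - real k)"
    by (simp add: field_simps)
  finally show ?thesis ..
qed

text \<open>In each correlation one factor is kept and integrated, while the other is summed over
  \<open>h\<close> by \<open>level_sum_le\<close>. The bound is therefore linear both in
  \<open>t\<close> and in the L^1 norm, as for the good part of a Calderon-Zygmund
  decomposition.\<close>

lemma integral_fluct_level_sq_le:
  assumes k: "k \<le> j" "j \<le> J"
  shows "(\<integral>x. (fluct_avg j (level f t J k) x)\<^sup>2 \<partial>M)
    \<le> K2 * 6 ^ CARD('d) * t * decay ^ (4 * (j - k)) * (\<integral>x. level f t J k x \<partial>M)"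
proof -
  define g where "g = (\<lambda>x. level f t J k (T 0 x))"
  have g_meas [measurable]: "g \<in> borel_measurable M" unfolding g_def by measurable
  have g_bdd: "\<bar>g x\<bar> \<le> threshold t UNIV k" if "x \<in> space M" for x
    using level_le[of k x] level_bounds(1)[of k "T 0 x"] k that by (simp add: g_def)
  have gT: "g (T n x) = level f t J k (T n x)" if "x \<in> space M" for n x
    using that by (simp add: g_def T_T)
  define I where "I = (\<integral>x. level f t J k x \<partial>M)"
  have I0: "I \<ge> 0" unfolding I_def by (simp add: level_bounds)
  let ?R = "\<lambda>Z. rect (\<lambda>i. if i \<in> Z then 0 else 2 ^ j) :: (int ^ 'd) set"
  let ?P = "\<lambda>Z. (\<Prod>i\<in>(UNIV::'d set). if i \<in> Z then 2 powr ((1 - \<alpha>) * real k) else 3 * 2 ^ j)"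
  let ?G = "(2 powr (- 2 * (1 - \<alpha>) * real j)) ^ CARD('d)"
  have nrm2: "(nrm j)\<^sup>2 = ?G"
    unfolding nrm_def power2_eq_square power_mult_distrib[symmetric] powr_add[symmetric]
    by (simp add: algebra_simps)
  have corr: "(\<Sum>h\<in>?R Z. \<integral>x. \<bar>g (T 0 x)\<bar> * \<bar>g (T h x)\<bar> \<partial>M) \<le> t * ?P Z * I" for Z
  proof -
    have "(\<Sum>h\<in>?R Z. \<integral>x. \<bar>g (T 0 x)\<bar> * \<bar>g (T h x)\<bar> \<partial>M)
        = (\<integral>x. (\<Sum>h\<in>?R Z. \<bar>g (T 0 x)\<bar> * \<bar>g (T h x)\<bar>) \<partial>M)"
    proof (rule Bochner_Integration.integral_sum[symmetric])
      fix h
      show "integrable M (\<lambda>x. \<bar>g (T 0 x)\<bar> * \<bar>g (T h x)\<bar>)"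
        by (rule integrable_const_bound[where B = "threshold t UNIV k * threshold t UNIV k"])
          (use t in \<open>auto simp: abs_mult threshold_nonneg intro!: AE_I2 mult_mono g_bdd\<close>)
    qed
    also have "\<dots> \<le> (\<integral>x. (t * ?P Z) * level f t J k (T 0 x) \<partial>M)"
    proof (rule integral_mono')
      fix x assume x: "x \<in> space M"
      have "(\<Sum>h\<in>?R Z. \<bar>g (T 0 x)\<bar> * \<bar>g (T h x)\<bar>)
          = level f t J k (T 0 x) * (\<Sum>h\<in>?R Z. level f t J k (T h x))"
        using x by (simp add: gT level_bounds sum_distrib_left)
      also have "\<dots> \<le> level f t J k (T 0 x) * (t * ?P Z)"
        by (intro mult_left_mono level_sum_le k x level_bounds)
      finally show "(\<Sum>h\<in>?R Z. \<bar>g (T 0 x)\<bar> * \<bar>g (T h x)\<bar>) \<le> (t * ?P Z) * level f t J k (T 0 x)"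
        by (simp add: mult.commute)
      show "0 \<le> (t * ?P Z) * level f t J k (T 0 x)"
        using t by (intro mult_nonneg_nonneg prod_nonneg level_bounds) auto
    qed (intro integrable_mult_right integrable_T integrable_level)
    also have "\<dots> = t * ?P Z * I"
      unfolding I_def by (simp add: integral_T)
    finally show ?thesis .
  qed
  have "(\<integral>x. (fluct_avg j (level f t J k) x)\<^sup>2 \<partial>M)
    = (\<integral>x. (nrm j)\<^sup>2 * (\<Sum>n\<in>vbox (\<lambda>_. {0<..2 ^ j}). fluct n * g (T n x))\<^sup>2 \<partial>M)"
    unfolding fluct_avg_def by (intro Bochner_Integration.integral_cong refl)
      (simp add: gT power_mult_distrib)
  also have "\<dots> = ?G * (\<integral>x. (\<Sum>n\<in>vbox (\<lambda>_. {0<..2 ^ j}). fluct n * g (T n x))\<^sup>2 \<partial>M)"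
    unfolding nrm2 by simp
  also have "\<dots> \<le> ?G * (K2 * (\<Sum>Z\<in>UNIV. kernel_bound j Z *
        (\<Sum>h\<in>?R Z. \<integral>x. \<bar>g (T 0 x)\<bar> * \<bar>g (T h x)\<bar> \<partial>M)))"
    by (intro mult_left_mono integral_fluct_sq_le[where D = "threshold t UNIV k"] g_meas g_bdd) auto
  also have "\<dots> \<le> ?G * (K2 * (\<Sum>Z\<in>UNIV. kernel_bound j Z * (t * ?P Z * I)))"
    by (intro mult_left_mono sum_mono corr K2_nonneg kernel_bound_nonneg) auto
  also have "\<dots> = K2 * t * I * (\<Sum>Z\<in>UNIV. ?G * kernel_bound j Z * ?P Z)"
    unfolding sum_distrib_left by (intro sum.cong refl) (simp only: mult_ac)
  also have "\<dots> \<le> K2 * t * I * (\<Sum>Z\<in>(UNIV::'d set set). 3 ^ CARD('d) * decay ^ (4 * (j - k)))"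
    unfolding decay_power[OF k(1), symmetric] using t
    by (intro mult_left_mono sum_mono mult_nonneg_nonneg K2_nonneg I0 kernel_gain k) auto
  also have "\<dots> = K2 * t * I * ((2 * 3) ^ CARD('d) * decay ^ (4 * (j - k)))"
    unfolding power_mult_distrib by (simp add: card_UNIV_set)
  finally show ?thesis by (simp add: I_def mult_ac)
qed

lemma integrable_fluct_level_sq:
  assumes k: "k \<le> J"
  shows "integrable M (\<lambda>x. (fluct_avg j (level f t J k) x)\<^sup>2)"
proof (rule integrable_const_bound)
  let ?D = "nrm j * (\<Sum>n\<in>vbox (\<lambda>_. {0<..2 ^ j}). \<bar>fluct n\<bar> * threshold t UNIV k)"
  show "AE x in M. norm ((fluct_avg j (level f t J k) x)\<^sup>2) \<le> ?D\<^sup>2"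
  proof (rule AE_I2)
    fix x assume x: "x \<in> space M"
    have "\<bar>\<Sum>n\<in>vbox (\<lambda>_. {0<..2 ^ j}). fluct n * level f t J k (T n x)\<bar>
        \<le> (\<Sum>n\<in>vbox (\<lambda>_. {0<..2 ^ j}). \<bar>fluct n\<bar> * threshold t UNIV k)"
    proof (rule order_trans[OF sum_abs], rule sum_mono)
      fix n
      show "\<bar>fluct n * level f t J k (T n x)\<bar> \<le> \<bar>fluct n\<bar> * threshold t UNIV k"
        using level_le[OF k T_in_space[OF x], of n] level_bounds(1)[of k "T n x"] x
        by (simp add: abs_mult T_T mult_left_mono)
    qed
    then have "\<bar>fluct_avg j (level f t J k) x\<bar> \<le> ?D"
      unfolding fluct_avg_def abs_mult using nrm_pos[of j] by (simp add: mult_left_mono)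
    then have "\<bar>fluct_avg j (level f t J k) x\<bar>\<^sup>2 \<le> ?D\<^sup>2" by (rule power_mono) simp
    then show "norm ((fluct_avg j (level f t J k) x)\<^sup>2) \<le> ?D\<^sup>2" by simp
  qed
qed measurable

text \<open>Markov's inequality for \<open>S\<close>, which dominates the squares at all scales
  simultaneously. The L^1 norms of the levels add up to at most that of \<open>f\<close>, and a
  bound linear in \<open>t\<close>, divided by the square of \<open>t\<close>, is of weak
  type.\<close>

lemma prob_fluct_truncated_le:
  "prob {x \<in> space M. \<exists>j\<le>J. t < fluct_avg j (truncated f t J j) x}
    \<le> (1 / (1 - decay\<^sup>2))\<^sup>2 * K2 * 6 ^ CARD('d) * (\<integral>x. f x \<partial>M) / t"
proof -
  let ?\<Phi> = "\<lambda>j k x. fluct_avg j (level f t J k) x"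
  let ?I = "\<lambda>k. (\<integral>x. level f t J k x \<partial>M)"
  define H where "H = 1 / (1 - decay\<^sup>2)"
  define A where "A = K2 * 6 ^ CARD('d) * t"
  have d2: "0 < decay\<^sup>2" "decay\<^sup>2 < 1" using decay by (auto simp: power_less_one_iff abs_square_less_1)
  have H0: "H \<ge> 0" using d2 by (simp add: H_def)
  have A0: "A \<ge> 0" using K2_nonneg t by (simp add: A_def)
  have I0: "?I k \<ge> 0" for k by (simp add: level_bounds)
  define S where "S = (\<lambda>x. \<Sum>j\<le>J. H * (\<Sum>k\<le>j. (?\<Phi> j k x)\<^sup>2 / decay ^ (2 * (j - k))))"
  have S_int: "integrable M S" unfolding S_def
    by (intro Bochner_Integration.integrable_sum integrable_mult_right integrable_divide_zero
        integrable_fluct_level_sq) auto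
  have S_meas [measurable]: "S \<in> borel_measurable M" using S_int by simp
  have terms0: "0 \<le> H * (\<Sum>k\<le>j. (?\<Phi> j k x)\<^sup>2 / decay ^ (2 * (j - k)))" for j x
    using H0 decay by (intro mult_nonneg_nonneg sum_nonneg) auto
  have S0: "S x \<ge> 0" for x unfolding S_def by (intro sum_nonneg terms0)
  have sq: "(fluct_avg j (truncated f t J j) x)\<^sup>2 \<le> S x" if "j \<le> J" for j x
  proof -
    have "fluct_avg j (truncated f t J j) x = (\<Sum>k\<le>j. ?\<Phi> j k x)"
      unfolding fluct_avg_def truncated_eq_sum_level[OF that] sum_distrib_left
      by (rule sum.swap)
    then have "(fluct_avg j (truncated f t J j) x)\<^sup>2 \<le> H * (\<Sum>k\<le>j. (?\<Phi> j k x)\<^sup>2 / decay ^ (2 * (j - k)))"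
      unfolding H_def using convolution_weighted_le[OF decay] by simp
    also have "\<dots> \<le> S x" unfolding S_def using that terms0
      by (intro member_le_sum[where f = "\<lambda>j. H * (\<Sum>k\<le>j. (?\<Phi> j k x)\<^sup>2 / decay ^ (2 * (j - k)))"]) auto
    finally show ?thesis .
  qed
  have "(\<integral>x. S x \<partial>M) = (\<Sum>j\<le>J. H * (\<Sum>k\<le>j. (\<integral>x. (?\<Phi> j k x)\<^sup>2 \<partial>M) / decay ^ (2 * (j - k))))"
  proof -
    have i: "integrable M (\<lambda>x. (?\<Phi> j k x)\<^sup>2 / decay ^ (2 * (j - k)))" if "j \<le> J" "k \<le> j" for j k
      using that by (intro integrable_divide_zero integrable_fluct_level_sq) auto
    have "(\<integral>x. S x \<partial>M) = (\<Sum>j\<le>J. \<integral>x. H * (\<Sum>k\<le>j. (?\<Phi> j k x)\<^sup>2 / decay ^ (2 * (j - k))) \<partial>M)"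
      unfolding S_def using i by (intro Bochner_Integration.integral_sum integrable_mult_right
        Bochner_Integration.integrable_sum) auto
    also have "\<dots> = (\<Sum>j\<le>J. H * (\<Sum>k\<le>j. (\<integral>x. (?\<Phi> j k x)\<^sup>2 \<partial>M) / decay ^ (2 * (j - k))))"
      using i by (intro sum.cong refl) (simp add: Bochner_Integration.integral_sum)
    finally show ?thesis .
  qed
  also have "\<dots> \<le> (\<Sum>j\<le>J. H * (\<Sum>k\<le>j. A * decay ^ (2 * (j - k)) * ?I k))"
  proof (intro sum_mono mult_left_mono H0)
    fix j k assume jk: "j \<in> {..J}" "k \<in> {..j}"
    have "(\<integral>x. (?\<Phi> j k x)\<^sup>2 \<partial>M) \<le> A * decay ^ (4 * (j - k)) * ?I k"
      unfolding A_def using jk by (intro integral_fluct_level_sq_le) auto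
    also have "\<dots> = (A * decay ^ (2 * (j - k)) * ?I k) * decay ^ (2 * (j - k))"
      by (simp add: power_add[symmetric])
    finally show "(\<integral>x. (?\<Phi> j k x)\<^sup>2 \<partial>M) / decay ^ (2 * (j - k)) \<le> A * decay ^ (2 * (j - k)) * ?I k"
      using decay by (simp add: divide_le_eq)
  qed
  also have "\<dots> = H * A * (\<Sum>j\<le>J. \<Sum>k\<le>j. decay ^ (2 * (j - k)) * ?I k)"
    by (simp add: sum_distrib_left mult_ac)
  \<comment> \<open>Interchanged, so that for each level \<open>k\<close> the scales
    \<open>j \<ge> k\<close> form a geometric series.\<close>
  also have "(\<Sum>j\<le>J. \<Sum>k\<le>j. decay ^ (2 * (j - k)) * ?I k)
      = (\<Sum>k\<le>J. \<Sum>j\<in>{k..J}. decay ^ (2 * (j - k)) * ?I k)"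
  proof -
    have "(\<Sum>j\<le>J. \<Sum>k\<le>j. decay ^ (2 * (j - k)) * ?I k)
        = (\<Sum>j\<in>{..J}. \<Sum>k\<in>{k\<in>{..J}. k \<le> j}. decay ^ (2 * (j - k)) * ?I k)"
      by (intro sum.cong) auto
    also have "\<dots> = (\<Sum>k\<in>{..J}. \<Sum>j\<in>{j\<in>{..J}. k \<le> j}. decay ^ (2 * (j - k)) * ?I k)"
      by (intro sum.swap_restrict) auto
    also have "\<dots> = (\<Sum>k\<le>J. \<Sum>j\<in>{k..J}. decay ^ (2 * (j - k)) * ?I k)"
      by (intro sum.cong) auto
    finally show ?thesis .
  qed
  also have "\<dots> \<le> (\<Sum>k\<le>J. H * ?I k)"
  proof (intro sum_mono)
    fix k assume "k \<in> {..J}"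
    have "(\<Sum>j\<in>{k..J}. decay ^ (2 * (j - k))) = (\<Sum>i\<in>{0..J - k}. (decay\<^sup>2) ^ i)"
      using \<open>k \<in> {..J}\<close> by (intro sum.reindex_bij_witness[where i = "\<lambda>i. i + k" and j = "\<lambda>j. j - k"])
        (auto simp: power_mult)
    also have "\<dots> \<le> (\<Sum>i. (decay\<^sup>2) ^ i)"
      using d2 by (intro sum_le_suminf summable_geometric) auto
    also have "\<dots> = H" using d2 by (simp add: suminf_geometric H_def)
    finally show "(\<Sum>j\<in>{k..J}. decay ^ (2 * (j - k)) * ?I k) \<le> H * ?I k"
      unfolding sum_distrib_right[symmetric] using I0 by (rule mult_right_mono)
  qed
  also have "\<dots> = H * (\<integral>x. (\<Sum>k\<le>J. level f t J k x) \<partial>M)"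
    by (simp add: sum_distrib_left[symmetric] Bochner_Integration.integral_sum integrable_level)
  also have "\<dots> \<le> H * (\<integral>x. f x \<partial>M)"
  proof (intro mult_left_mono H0 integral_mono f Bochner_Integration.integrable_sum integrable_level)
    fix x show "(\<Sum>k\<le>J. level f t J k x) \<le> f x"
      unfolding truncated_eq_sum_level[OF order_refl, symmetric] truncated_def using f by simp
  qed
  finally have S_le: "(\<integral>x. S x \<partial>M) \<le> H * A * (H * (\<integral>x. f x \<partial>M))"
    using H0 A0 by (simp add: mult_left_mono)
  have "prob {x \<in> space M. \<exists>j\<le>J. t < fluct_avg j (truncated f t J j) x} \<le> prob {x \<in> space M. t\<^sup>2 \<le> S x}"
  proof (rule finite_measure_mono)
    show "{x \<in> space M. \<exists>j\<le>J. t < fluct_avg j (truncated f t J j) x} \<subseteq> {x \<in> space M. t\<^sup>2 \<le> S x}"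
    proof clarify
      fix x j assume "j \<le> J" "t < fluct_avg j (truncated f t J j) x"
      then have "t\<^sup>2 \<le> (fluct_avg j (truncated f t J j) x)\<^sup>2" using t by (intro power_mono) auto
      then show "t\<^sup>2 \<le> S x" using sq[OF \<open>j \<le> J\<close>, of x] by linarith
    qed
  qed measurable
  also have "\<dots> \<le> (\<integral>x. S x \<partial>M) / t\<^sup>2"
    using S_int S0 t by (intro integral_Markov_inequality_measure[where A = "{}"]) auto
  also have "\<dots> \<le> H * A * (H * (\<integral>x. f x \<partial>M)) / t\<^sup>2"
    using S_le by (intro divide_right_mono) auto
  also have "\<dots> = H\<^sup>2 * K2 * 6 ^ CARD('d) * (\<integral>x. f x \<partial>M) / t"
    using t by (simp add: A_def power2_eq_square)
  finally show ?thesis by (simp add: H_def)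
qed

end

end

section \<open>The weak type inequality\<close>

context sparse_set
begin

text \<open>Contains the projections to the coordinates in \<open>Z\<close> of all sample points in
  the box of side \<open>2 ^ k\<close>.\<close>

definition selected :: "'d set \<Rightarrow> nat \<Rightarrow> (int ^ 'd) set" where
  "selected Z k = vbox (\<lambda>i. if i \<in> Z then {n\<in>{0<..2 ^ k}. X i n = 1} else {0})"

lemma sum_X_eq_card:
  assumes "a \<ge> 0"
  shows "(\<Sum>n\<in>{a<..b}. X i n) = real (card {n\<in>{a<..b}. X i n = 1})"
proof -
  have "(\<Sum>n\<in>{a<..b}. X i n) = (\<Sum>n\<in>{a<..b}. if X i n = 1 then 1 else 0)"
  proof (intro sum.cong refl)
    fix n assume "n \<in> {a<..b}"
    then have "n \<ge> 1" using assms by auto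
    from X[OF this, of i] show "X i n = (if X i n = 1 then 1 else 0)" by auto
  qed
  also have "\<dots> = (\<Sum>n\<in>{n\<in>{a<..b}. X i n = 1}. 1)"
    by (rule sum.inter_filter[symmetric]) simp
  finally show ?thesis by simp
qed

lemma finite_selected [simp, intro]: "finite (selected Z k)"
  unfolding selected_def by (intro finite_vbox) (auto intro: finite_subset[of _ "{0<..2 ^ k}"])

lemma selected_mono: "k \<le> l \<Longrightarrow> selected Z k \<subseteq> selected Z l"
proof -
  assume "k \<le> l"
  then have "(2::int) ^ k \<le> 2 ^ l" by (intro power_increasing) auto
  then have "n \<le> 2 ^ l" if "n \<le> 2 ^ k" for n :: int
    using that by (rule order_trans[rotated])
  then show ?thesis unfolding selected_def by (intro vbox_mono) auto
qed

lemma card_selected_le: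
  "real (card (selected Z k)) \<le> (\<Prod>i\<in>UNIV. if i \<in> Z then K1 * 2 powr ((1 - \<alpha>) * real k) else 1)"
proof -
  have "real (card (selected Z k)) = (\<Prod>i\<in>UNIV. if i \<in> Z then (\<Sum>n\<in>{0<..2 ^ k}. X i n) else 1)"
    unfolding selected_def card_vbox of_nat_prod sum_X_eq_card[OF order_refl] by (intro prod.cong) auto
  also have "\<dots> \<le> (\<Prod>i\<in>UNIV. if i \<in> Z then K1 * 2 powr ((1 - \<alpha>) * real k) else 1)"
    using sum_X_le[of 0 "2 ^ k" k] by (intro prod_mono) (auto intro!: sum_nonneg X_nonneg)
  finally show ?thesis .
qed

end

context sparse_action
begin

text \<open>The radius is doubled because replacing a sample point by its projection in
  \<open>selected Z k\<close> displaces the flat rectangle by up to \<open>2 ^ k\<close> outside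
  \<open>Z\<close>. In return only about 2^(beta k |Z|) shifts have to be considered, beta being 1 -
  alpha.\<close>

definition exceptional :: "('x \<Rightarrow> real) \<Rightarrow> real \<Rightarrow> nat \<Rightarrow> 'd set \<Rightarrow> 'x set" where
  "exceptional f t J Z = {x \<in> space M. \<exists>k\<le>J. \<exists>n\<in>selected Z k.
     threshold t Z k < (\<Sum>m\<in>rect (\<lambda>i. if i \<in> Z then 0 else 2 ^ (k + 1)). f (T m (T n x)))}"

lemma exceptional_sets:
  assumes [measurable]: "f \<in> borel_measurable M"
  shows "exceptional f t J Z \<in> sets M"
proof -
  have "exceptional f t J Z = (\<Union>k\<in>{..J}. \<Union>n\<in>selected Z k. {x \<in> space M.
     threshold t Z k < (\<Sum>m\<in>rect (\<lambda>i. if i \<in> Z then 0 else 2 ^ (k + 1)). f (T m (T n x)))})"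
    unfolding exceptional_def by blast
  also have "\<dots> \<in> sets M"
    by (intro sets.finite_UN finite_selected finite_atMost) measurable
  finally show ?thesis .
qed

text \<open>Number of shifts times volume is of order 2^((1 - alpha) k) per coordinate in
  \<open>Z\<close> and 2^k per coordinate outside, which is just what \<open>threshold\<close>
  balances. The 9 comes from \<open>4 * 2 ^ (k + 1) + 1 \<le> 9 * 2 ^ k\<close>, and 27 = 3 *
  9.\<close>

lemma prob_exceptional_le:
  assumes f: "integrable M f" "\<And>x. f x \<ge> 0" and t: "t > 0"
  shows "prob (exceptional f t J Z) \<le> (27 * K1) ^ CARD('d) * (\<integral>x. f x \<partial>M) / t"
proof -
  have "prob (exceptional f t J Z) \<le> 3 ^ CARD('d) * ((9 * K1) ^ CARD('d) / t) * (\<integral>x. f x \<partial>M)"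
    unfolding exceptional_def
  proof (rule maximal_transfer)
    fix k
    have "real (card (selected Z k)) * (\<Prod>i\<in>UNIV. 4 * real (if i \<in> Z then 0 else 2 ^ (k + 1)) + 1)
      \<le> (\<Prod>i\<in>UNIV. if i \<in> Z then K1 * 2 powr ((1 - \<alpha>) * real k) else 1) *
        (\<Prod>i\<in>UNIV. 4 * real (if i \<in> Z then 0 else 2 ^ (k + 1)) + 1)"
      by (intro mult_right_mono card_selected_le prod_nonneg) auto
    also have "\<dots> = (\<Prod>i\<in>UNIV. (if i \<in> Z then K1 * 2 powr ((1 - \<alpha>) * real k) else 1) *
        (4 * real (if i \<in> Z then 0 else 2 ^ (k + 1)) + 1))"
      by (simp only: prod.distrib)
    also have "\<dots> \<le> (9 * K1) ^ CARD('d) * (\<Prod>i\<in>UNIV. if i \<in> Z then 2 powr ((1 - \<alpha>) * real k) else 2 ^ k)"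
    proof (rule prod_if_le_const_mult)
      fix i
      have "(1::real) \<le> 2 ^ k" by simp
      then have "4 * 2 ^ (k + 1) + 1 \<le> 9 * (2::real) ^ k" by simp
      also have "\<dots> \<le> 9 * K1 * 2 ^ k" using K1(1) by (intro mult_right_mono) auto
      finally show "(if i \<in> Z then K1 * 2 powr ((1 - \<alpha>) * real k) else 1) *
        (4 * real (if i \<in> Z then 0 else 2 ^ (k + 1)) + 1)
        \<le> 9 * K1 * (if i \<in> Z then 2 powr ((1 - \<alpha>) * real k) else 2 ^ k)"
        using K1(1) by auto
      show "0 \<le> (if i \<in> Z then K1 * 2 powr ((1 - \<alpha>) * real k) else 1) *
        (4 * real (if i \<in> Z then 0 else 2 ^ (k + 1)) + 1)"
        using K1(1) by auto
    qed (use K1 in auto)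
    also have "\<dots> = (9 * K1) ^ CARD('d) / t * threshold t Z k"
      using t by (simp add: threshold_def)
    finally show "real (card (selected Z k)) * (\<Prod>i\<in>UNIV. 4 * real (if i \<in> Z then 0 else 2 ^ (k + 1)) + 1)
      \<le> (9 * K1) ^ CARD('d) / t * threshold t Z k" .
    show "(if i \<in> Z then 0 else 2 ^ (k + 1)) \<le> (if i \<in> Z then 0 else (2::nat) ^ (l + 1))" if "k \<le> l" for l i
      using that by (simp add: power_increasing)
  qed (use f t K1 selected_mono in auto)
  also have "\<dots> = (3 * (9 * K1)) ^ CARD('d) * (\<integral>x. f x \<partial>M) / t"
    unfolding power_mult_distrib by simp
  finally show ?thesis by (simp add: mult.assoc[symmetric])
qed

text \<open>If \<open>T n x\<close> were heavy at a scale from \<open>j\<close> to \<open>J\<close>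
  for some sample point \<open>n\<close>, then \<open>x\<close> would be exceptional. Off the
  exceptional sets the random average thus never reads a discarded value.\<close>

lemma samp_avg_truncated:
  assumes f: "\<And>x. f x \<ge> 0" and x: "x \<in> space M" "\<And>Z. x \<notin> exceptional f t J Z" and j: "j \<le> J"
  shows "samp_avg j f x = samp_avg j (truncated f t J j) x"
proof -
  have key: "(\<Prod>i\<in>UNIV. X i (n $ i)) * f (T n x) = (\<Prod>i\<in>UNIV. X i (n $ i)) * truncated f t J j (T n x)"
    if n: "n \<in> vbox (\<lambda>_. {0<..2 ^ j})" for n
  proof (cases "(\<Prod>i\<in>UNIV. X i (n $ i)) = 0")
    case False
    then have X1: "X i (n $ i) = 1" for i
    proof -
      have "X i (n $ i) \<noteq> 0" using False by auto
      moreover have "n $ i \<ge> 1" using n by (simp add: int_one_le_iff_zero_less)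
      ultimately show ?thesis using X[of "n $ i" i] by auto
    qed
    have "light_from f t J j (T n x)"
      unfolding light_from_def
    proof (intro ballI notI)
      fix l assume l: "l \<in> {j..J}" and "heavy f t l (T n x)"
      then obtain Z where Z: "threshold t Z l < (\<Sum>m\<in>rect (\<lambda>i. if i \<in> Z then 0 else 2 ^ l). f (T m (T n x)))"
        unfolding heavy_def by blast
      \<comment> \<open>The coordinates outside \<open>Z\<close> are dropped; \<open>n - n'\<close>
        has entries of size at most \<open>2 ^ l\<close> there, which the doubled radius
        absorbs.\<close>
      define n' where "n' = (\<chi> i. if i \<in> Z then n $ i else 0)"
      have pow: "(2::int) ^ j \<le> 2 ^ l" using l by (intro power_increasing) auto
      have n': "n' \<in> selected Z l"
        using n X1 pow unfolding selected_def n'_def by (auto intro: order_trans)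
      have "(\<Sum>m\<in>rect (\<lambda>i. if i \<in> Z then 0 else 2 ^ l). f (T m (T n x)))
          = (\<Sum>m\<in>(\<lambda>m. m + (n - n')) ` rect (\<lambda>i. if i \<in> Z then 0 else 2 ^ l). f (T m (T n' x)))"
        using x(1) by (subst sum.reindex) (simp_all add: inj_on_def T_T)
      also have "\<dots> \<le> (\<Sum>m\<in>rect (\<lambda>i. if i \<in> Z then 0 else 2 ^ (l + 1)). f (T m (T n' x)))"
      proof (intro sum_mono2 f finite_rect image_subsetI)
        fix m assume m: "m \<in> rect (\<lambda>i. if i \<in> Z then 0 else 2 ^ l)"
        have "\<bar>(m + (n - n')) $ i\<bar> \<le> int (if i \<in> Z then 0 else 2 ^ (l + 1))" for i
        proof -
          have 1: "\<bar>m $ i\<bar> \<le> int (if i \<in> Z then 0 else 2 ^ l)" using m by (simp add: mem_rect)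
          have 2: "0 < n $ i" "n $ i \<le> 2 ^ j" using n by auto
          have "n $ i \<le> 2 ^ l" using 2(2) pow by (rule order_trans)
          then show ?thesis using 1 2(1) by (auto simp: n'_def)
        qed
        then show "m + (n - n') \<in> rect (\<lambda>i. if i \<in> Z then 0 else 2 ^ (l + 1))"
          by (simp add: mem_rect)
      qed
      finally have "x \<in> exceptional f t J Z"
        unfolding exceptional_def using Z n' l x(1) by (auto intro!: exI[of _ l] bexI[of _ n'])
      then show False using x(2) by blast
    qed
    then show ?thesis by (simp add: truncated_def)
  qed simp
  show ?thesis unfolding samp_avg_def
    by (intro arg_cong[where f = "\<lambda>s. nrm j * s"] sum.cong refl key)
qed

text \<open>The truncation serves the fluctuation alone; in the mean average it is undone by
  monotonicity, as the weights and \<open>f\<close> are nonnegative.\<close>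

theorem samp_maximal:
  obtains c where "c > 0"
    "\<And>f t. integrable M f \<Longrightarrow> (\<And>x. f x \<ge> 0) \<Longrightarrow> t > 0 \<Longrightarrow>
       prob {x \<in> space M. \<exists>j. c * t < samp_avg j f x} \<le> c * (\<integral>x. f x \<partial>M) / t"
proof -
  obtain C0 where C0: "C0 > 0"
    and mean: "\<And>f t J. integrable M f \<Longrightarrow> (\<And>x. f x \<ge> 0) \<Longrightarrow> t > 0 \<Longrightarrow>
       prob {x \<in> space M. \<exists>j\<le>J. mean_avg \<alpha> j f x > C0 * t} \<le> C0 * (\<integral>x. f x \<partial>M) / t"
    using mean_maximal[of \<alpha>] \<alpha> by auto
  define C1 where "C1 = (1 / (1 - decay\<^sup>2))\<^sup>2 * K2 * 6 ^ CARD('d)"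
  define C2 where "C2 = 2 ^ CARD('d) * (27 * K1) ^ CARD('d)"
  have C12: "C1 \<ge> 0" "C2 \<ge> 0" using K2_nonneg K1 by (auto simp: C1_def C2_def)
  define C' where "C' = C0 + C1 + C2 + 1"
  have C': "C' > 0" using C0 C12 by (simp add: C'_def)
  show ?thesis
  proof (rule that[OF C'])
    fix f :: "'x \<Rightarrow> real" and t :: real
    assume f: "integrable M f" "\<And>x. f x \<ge> 0" and t: "t > 0"
    have [measurable]: "f \<in> borel_measurable M" using f by simp
    define I where "I = (\<integral>x. f x \<partial>M)"
    have I: "I \<ge> 0" unfolding I_def using f by simp
    have fin: "prob {x \<in> space M. \<exists>j\<le>J. C' * t < samp_avg j f x} \<le> C' * I / t" for J
    proof -
      let ?E = "\<Union>Z. exceptional f t J Z"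
      let ?F = "{x \<in> space M. \<exists>j\<le>J. mean_avg \<alpha> j f x > C0 * t}"
      let ?G = "{x \<in> space M. \<exists>j\<le>J. t < fluct_avg j (truncated f t J j) x}"
      have sets: "?E \<in> sets M" "?F \<in> sets M" "?G \<in> sets M"
        by (auto intro!: sets.finite_UN exceptional_sets)
      have "{x \<in> space M. \<exists>j\<le>J. C' * t < samp_avg j f x} \<subseteq> ?E \<union> ?F \<union> ?G"
      proof (rule subsetI, rule ccontr)
        fix x assume xA: "x \<in> {x \<in> space M. \<exists>j\<le>J. C' * t < samp_avg j f x}"
          and "x \<notin> ?E \<union> ?F \<union> ?G"
        then have notin: "x \<notin> ?E" "x \<notin> ?F" "x \<notin> ?G" by simp_all
        from xA obtain j where j: "x \<in> space M" "j \<le> J" "C' * t < samp_avg j f x" by blast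
        have nE: "x \<notin> exceptional f t J Z" for Z using notin(1) by (rule contrapos_nn) (rule UN_I[OF UNIV_I])
        note x = j(1) nE j(2) j(3) notin(2,3)
        have "samp_avg j f x = mean_avg \<alpha> j (truncated f t J j) x + fluct_avg j (truncated f t J j) x"
          using samp_avg_truncated[OF f(2) x(1,2,3)] samp_avg_split by simp
        also have "mean_avg \<alpha> j (truncated f t J j) x \<le> mean_avg \<alpha> j f x"
          unfolding mean_avg_def truncated_def using f
          by (intro mult_left_mono sum_mono prod_nonneg) auto
        also have "mean_avg \<alpha> j f x \<le> C0 * t" using x by (auto simp: not_less)
        also have "fluct_avg j (truncated f t J j) x \<le> t" using x by (auto simp: not_less)
        finally have "samp_avg j f x \<le> (C0 + 1) * t" by (simp add: algebra_simps)
        also have "\<dots> \<le> C' * t" using t C12 by (intro mult_right_mono) (auto simp: C'_def)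
        finally show False using x(4) by simp
      qed
      then have "prob {x \<in> space M. \<exists>j\<le>J. C' * t < samp_avg j f x} \<le> prob (?E \<union> ?F \<union> ?G)"
        by (rule finite_measure_mono) (use sets in auto)
      also have "\<dots> \<le> prob (?E \<union> ?F) + prob ?G"
        by (intro measure_Un_le sets.Un sets)
      also have "prob (?E \<union> ?F) \<le> prob ?E + prob ?F"
        by (intro measure_Un_le sets)
      also have "prob ?E \<le> (\<Sum>Z\<in>UNIV. prob (exceptional f t J Z))"
        by (intro finite_measure_subadditive_finite) (auto intro!: exceptional_sets)
      also have "\<dots> \<le> (\<Sum>Z\<in>(UNIV::'d set set). (27 * K1) ^ CARD('d) * I / t)"
        unfolding I_def by (intro sum_mono prob_exceptional_le f t)
      also have "\<dots> = C2 * I / t"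
        by (simp add: C2_def card_UNIV_set)
      also have "prob ?F \<le> C0 * I / t" unfolding I_def by (rule mean[OF f t])
      also have "prob ?G \<le> C1 * I / t"
        unfolding I_def C1_def by (rule prob_fluct_truncated_le[OF f t])
      also have "C2 * I / t + C0 * I / t + C1 * I / t \<le> C' * I / t"
        using I t by (simp add: C'_def add_divide_distrib[symmetric] divide_right_mono algebra_simps)
      finally show ?thesis by simp
    qed
    \<comment> \<open>The bound is uniform in the horizon \<open>J\<close>, so continuity from below
      removes it.\<close>
    let ?A = "\<lambda>J. {x \<in> space M. \<exists>j\<le>J. C' * t < samp_avg j f x}"
    have "(\<lambda>J. prob (?A J)) \<longlonglongrightarrow> prob (\<Union>J. ?A J)"
    proof (rule finite_Lim_measure_incseq)
      show "incseq ?A" unfolding incseq_def by (blast intro: order_trans)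
    qed auto
    moreover have "(\<Union>J. ?A J) = {x \<in> space M. \<exists>j. C' * t < samp_avg j f x}" by auto
    ultimately have "(\<lambda>J. prob (?A J)) \<longlonglongrightarrow> prob {x \<in> space M. \<exists>j. C' * t < samp_avg j f x}" by simp
    then show "prob {x \<in> space M. \<exists>j. C' * t < samp_avg j f x} \<le> C' * (\<integral>x. f x \<partial>M) / t"
      by (rule LIMSEQ_le_const2) (use fin in \<open>auto simp: I_def\<close>)
  qed
qed

end

section \<open>Enumerations ordered by the norm\<close>

lemma euclid_norm_eq_L2: "euclid_norm n = L2_set (\<lambda>i. real_of_int (n $ i)) UNIV"
  by (simp add: euclid_norm_def norm_vec_def L2_set_def)

lemma euclid_norm_mono:
  assumes "\<And>i. 0 \<le> u $ i" "\<And>i. u $ i \<le> v $ i"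
  shows "euclid_norm u \<le> euclid_norm v"
  unfolding euclid_norm_eq_L2 using assms by (intro L2_set_mono) auto

lemma euclid_norm_strict_mono:
  assumes "\<And>i. 0 \<le> u $ i" "\<And>i. u $ i < v $ i"
  shows "euclid_norm u < euclid_norm v"
  unfolding euclid_norm_eq_L2 using assms by (intro L2_set_strict_mono) auto

lemma abs_component_le_euclid_norm: "\<bar>real_of_int (n $ i)\<bar> \<le> euclid_norm n"
  using component_le_norm_cart[of "\<chi> i. real_of_int (n $ i)" i] by (simp add: euclid_norm_def)

lemma euclid_norm_le_card_mult:
  fixes n :: "int ^ 'd::finite"
  assumes "\<And>i. \<bar>real_of_int (n $ i)\<bar> \<le> K"
  shows "euclid_norm n \<le> real CARD('d) * K"
proof -
  have "euclid_norm n \<le> (\<Sum>i\<in>UNIV. \<bar>real_of_int (n $ i)\<bar>)"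
    using norm_le_l1_cart[of "\<chi> i. real_of_int (n $ i)"] by (simp add: euclid_norm_def)
  also have "\<dots> \<le> (\<Sum>i\<in>(UNIV::'d set). K)" using assms by (intro sum_mono)
  finally show ?thesis by simp
qed

lemma euclid_norm_scale:
  "euclid_norm (\<chi> i. c * n $ i) = \<bar>real_of_int c\<bar> * euclid_norm n"
proof -
  have "(\<chi> i. real_of_int ((\<chi> i. c * n $ i) $ i)) = real_of_int c *\<^sub>R (\<chi> i. real_of_int (n $ i))"
    by (simp add: vec_eq_iff)
  then show ?thesis unfolding euclid_norm_def by (simp only: norm_scaleR)
qed

lemma dyadic_bracket:
  assumes "r \<ge> 1"
  obtains j where "2 ^ j \<le> r" "r < (2::real) ^ (j + 1)"
proof -
  define j where "j = (LEAST j. r < (2::real) ^ (j + 1))"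
  have "\<exists>j. r < (2::real) ^ (j + 1)"
  proof -
    obtain n where "r < 2 ^ n" using real_arch_pow[of 2 r] by auto
    also have "(2::real) ^ n \<le> 2 ^ (n + 1)" by (intro power_increasing) auto
    finally show ?thesis by blast
  qed
  then have 1: "r < (2::real) ^ (j + 1)" unfolding j_def by (rule LeastI_ex)
  have 2: "2 ^ j \<le> r"
  proof (cases j)
    case (Suc i)
    have "\<not> r < (2::real) ^ (i + 1)"
    proof
      assume "r < (2::real) ^ (i + 1)"
      then have "j \<le> i" unfolding j_def by (rule Least_le)
      then show False using Suc by simp
    qed
    then show ?thesis using Suc by simp
  qed (use assms in auto)
  show ?thesis by (rule that[OF 2 1])
qed

definition cube :: "nat \<Rightarrow> int ^ 'd::finite \<Rightarrow> (int ^ 'd) set" where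
  "cube m u = vbox (\<lambda>i. {2 ^ m * u $ i<..2 ^ m * (u $ i + 1)})"

text \<open>\<open>u\<close> and \<open>u + 1\<close>, with the all-ones vector \<open>1\<close>,
  are the corners of a unit cube nearest to and farthest from the origin; so these are the cubes cut
  by the sphere of radius \<open>r\<close>. Scaling by \<open>2 ^ m\<close> gives
  \<open>cube m u\<close>.\<close>

definition boundary_cubes :: "nat \<Rightarrow> real \<Rightarrow> (int ^ 'd::finite) set" where
  "boundary_cubes q r =
     {u \<in> vbox (\<lambda>_. {0..<2 ^ (q + 1)}). euclid_norm u < r \<and> r \<le> euclid_norm (u + 1)}"

text \<open>Each line in the diagonal direction contains at most one boundary cube.\<close>

lemma card_boundary_cubes_le:
  "real (card (boundary_cubes q r :: (int ^ 'd::finite) set))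
    \<le> real CARD('d) * (2 ^ (q + 1)) ^ (CARD('d) - 1)"
proof -
  let ?B = "boundary_cubes q r :: (int ^ 'd) set"
  define mn where "mn = (\<lambda>u::int ^ 'd. Min (range (\<lambda>i. u $ i)))"
  \<comment> \<open>Sliding along the diagonal until some coordinate is 0 sends each diagonal line
    to one point of a face of the box.\<close>
  define \<pi> where "\<pi> = (\<lambda>u::int ^ 'd. \<chi> i. u $ i - mn u)"
  define W where "W = (\<lambda>k::'d. vbox (\<lambda>i. if i = k then {0} else {0..<2 ^ (q + 1)}))"
  have mn: "mn u \<le> u $ i" for u i unfolding mn_def by (intro Min_le) auto
  have mn_ex: "\<exists>i. mn u = u $ i" for u
  proof -
    have "mn u \<in> range (\<lambda>i. u $ i)" unfolding mn_def by (intro Min_in) auto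
    then show ?thesis by (simp add: image_iff)
  qed
  have fin: "finite (\<Union>k. W k)" unfolding W_def by (auto intro!: finite_vbox)
  have no: False if "u \<in> ?B" "v \<in> ?B" "\<pi> u = \<pi> v" "mn u < mn v" for u v
  proof -
    have "u $ i + 1 \<le> v $ i" for i
    proof -
      have "u $ i - mn u = v $ i - mn v" using that(3) by (auto simp: \<pi>_def vec_eq_iff)
      then show ?thesis using that(4) by linarith
    qed
    moreover have "0 \<le> u $ i" for i using that(1) by (auto simp: boundary_cubes_def)
    ultimately have "euclid_norm (u + 1) \<le> euclid_norm v" by (intro euclid_norm_mono) auto
    then show False using that(1,2) by (auto simp: boundary_cubes_def)
  qed
  have "inj_on \<pi> ?B"
  proof (rule inj_onI)
    fix u v assume uv: "u \<in> ?B" "v \<in> ?B" "\<pi> u = \<pi> v"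
    have "mn u = mn v" using no[OF uv] no[OF uv(2,1) uv(3)[symmetric]]
      by (cases "mn u" "mn v" rule: linorder_cases) auto
    then show "u = v" using uv(3) by (auto simp: \<pi>_def vec_eq_iff)
  qed
  moreover have "\<pi> ` ?B \<subseteq> (\<Union>k. W k)"
  proof (rule image_subsetI)
    fix u assume u: "u \<in> ?B"
    obtain k where k: "mn u = u $ k" using mn_ex by blast
    have "\<pi> u $ i \<in> {0..<2 ^ (q + 1)}" for i
    proof -
      have "0 \<le> u $ i" "u $ i < 2 ^ (q + 1)" "0 \<le> u $ k" using u by (auto simp: boundary_cubes_def)
      then show ?thesis using mn[of u i] k by (simp add: \<pi>_def)
    qed
    moreover have "\<pi> u $ k = 0" using k by (simp add: \<pi>_def)
    ultimately have "\<pi> u \<in> W k" by (auto simp: W_def)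
    then show "\<pi> u \<in> (\<Union>k. W k)" by blast
  qed
  ultimately have "card ?B \<le> card (\<Union>k. W k)" using fin by (intro card_inj_on_le)
  also have "\<dots> \<le> (\<Sum>k\<in>UNIV. card (W k))" by (rule card_UN_le) simp
  also have "\<dots> = (\<Sum>k\<in>(UNIV::'d set). (2 ^ (q + 1)) ^ (CARD('d) - 1))"
  proof (rule sum.cong[OF refl])
    fix k :: 'd
    have nat: "nat (2 ^ (q + 1)) = 2 ^ (q + 1)" by (subst nat_power_eq) auto
    have "card (W k) = (\<Prod>i\<in>UNIV. if i = k then 1 else nat (2 ^ (q + 1)))"
      unfolding W_def card_vbox by (intro prod.cong refl) simp
    also have "\<dots> = (\<Prod>i\<in>UNIV - {k}. 2 ^ (q + 1))"
      unfolding nat by (subst prod.remove[of UNIV k]) (auto intro!: prod.cong)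
    also have "\<dots> = (2 ^ (q + 1)) ^ card (UNIV - {k})" by (rule prod_constant)
    also have "card (UNIV - {k}) = CARD('d) - 1" by (simp add: card_Diff_singleton)
    finally show "card (W k) = (2 ^ (q + 1)) ^ (CARD('d) - 1)" .
  qed
  also have "\<dots> = CARD('d) * (2 ^ (q + 1)) ^ (CARD('d) - 1)" by simp
  finally have "real (card ?B) \<le> real (CARD('d) * (2 ^ (q + 1)) ^ (CARD('d) - 1))"
    by (rule of_nat_mono)
  then show ?thesis by simp
qed

lemma exists_exp_ge:
  fixes c K :: real assumes "c > 0"
  obtains l0 :: nat where "\<And>l. l \<ge> l0 \<Longrightarrow> K \<le> 2 powr (c * real l)"
proof -
  have "1 < (2::real) powr c" using assms by simp
  then obtain l0 where l0: "K < (2 powr c) ^ l0" using real_arch_pow by blast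
  show ?thesis
  proof (rule that)
    fix l assume "l \<ge> l0"
    then have "(2 powr c) ^ l0 \<le> (2 powr c) ^ l" using \<open>1 < 2 powr c\<close> by (intro power_increasing) auto
    then have "K \<le> (2 powr c) ^ l" using l0 by linarith
    then show "K \<le> 2 powr (c * real l)" by (simp add: powr_power mult.commute)
  qed
qed

section \<open>Sizes of the random set in dyadic intervals and shells\<close>

context sparse_set
begin

definition support :: "(int ^ 'd) set" where
  "support = {n. \<forall>i. n $ i \<ge> 1 \<and> X i (n $ i) = 1}"

lemma prod_X_eq_indicator:
  assumes "\<And>i. n $ i \<ge> 1"
  shows "(\<Prod>i\<in>UNIV. X i (n $ i)) = (if n \<in> support then 1 else 0)"
proof (cases "n \<in> support")
  case False
  then obtain i where "X i (n $ i) \<noteq> 1" using assms by (auto simp: support_def)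
  then have "X i (n $ i) = 0" using X[of "n $ i" i] assms by auto
  then show ?thesis using False by (auto intro!: prod_zero)
qed (auto simp: support_def)

lemma sum_support_vbox:
  fixes a b :: "'d \<Rightarrow> int"
  assumes "\<And>i. 0 \<le> a i"
  shows "(\<Sum>n\<in>vbox (\<lambda>i. {a i<..b i}). (\<Prod>i\<in>UNIV. X i (n $ i)) * \<phi> n)
    = (\<Sum>n\<in>support \<inter> vbox (\<lambda>i. {a i<..b i}). \<phi> n)"
proof -
  let ?B = "vbox (\<lambda>i. {a i<..b i})"
  have "(\<Sum>n\<in>?B. (\<Prod>i\<in>UNIV. X i (n $ i)) * \<phi> n) = (\<Sum>n\<in>?B. if n \<in> support then \<phi> n else 0)"
  proof (rule sum.cong[OF refl])
    fix n assume "n \<in> ?B"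
    then have "n $ i \<in> {a i<..b i}" for i by simp
    then have "n $ i \<ge> 1" for i using assms[of i] by (smt (verit) greaterThanAtMost_iff)
    then show "(\<Prod>i\<in>UNIV. X i (n $ i)) * \<phi> n = (if n \<in> support then \<phi> n else 0)"
      by (simp add: prod_X_eq_indicator)
  qed
  also have "\<dots> = (\<Sum>n\<in>{n\<in>?B. n \<in> support}. \<phi> n)"
    by (rule sum.inter_filter[symmetric]) auto
  also have "{n\<in>?B. n \<in> support} = support \<inter> ?B" by blast
  finally show ?thesis .
qed

lemma card_support_vbox:
  fixes a b :: "'d \<Rightarrow> int"
  assumes "\<And>i. 0 \<le> a i"
  shows "real (card (support \<inter> vbox (\<lambda>i. {a i<..b i}))) = (\<Prod>i\<in>UNIV. \<Sum>n\<in>{a i<..b i}. X i n)"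
  using sum_support_vbox[OF assms, where \<phi> = "\<lambda>_. 1" and b = b]
  by (simp add: sum_prod_vbox)

text \<open>Each of the \<open>2 ^ l\<close> weights is at least
  \<open>2 powr (-\<alpha> * l)\<close>, and from some \<open>l\<close> on the discrepancy is at
  most half of the resulting sum.\<close>

lemma sum_X_ge:
  obtains l0 where "\<And>l i. l \<ge> l0 \<Longrightarrow> (\<Sum>n\<in>{0<..2 ^ l}. X i n) \<ge> 2 powr ((1 - \<alpha>) * real l) / 2"
proof -
  obtain l0 where l0: "\<And>l. l \<ge> l0 \<Longrightarrow> 2 * C \<le> 2 powr ((1 - \<alpha>) / 4 * real l)"
    using exists_exp_ge[of "(1 - \<alpha>) / 4" "2 * C"] \<alpha> by auto
  show ?thesis
  proof (rule that)
    fix l i assume "l \<ge> l0"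
    have "(\<Sum>n\<in>{0<..2 ^ l}. wt \<alpha> n) \<ge> (\<Sum>n\<in>{0<..(2::int) ^ l}. 2 powr (-\<alpha> * real l))"
    proof (rule sum_mono)
      fix n assume n: "n \<in> {0<..(2::int) ^ l}"
      then have "real_of_int n \<le> real_of_int (2 ^ l)" by (simp only: of_int_le_iff greaterThanAtMost_iff)
      then have "real_of_int n \<le> 2 powr real l" by (simp add: powr_realpow)
      then have "(2 powr real l) powr (-\<alpha>) \<le> wt \<alpha> n"
        unfolding wt_def using n \<alpha> by (intro powr_mono2') auto
      then show "2 powr (-\<alpha> * real l) \<le> wt \<alpha> n" by (simp add: powr_powr mult.commute)
    qed
    also have "(\<Sum>n\<in>{0<..(2::int) ^ l}. 2 powr (-\<alpha> * real l)) = 2 powr real l * 2 powr (-\<alpha> * real l)"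
      by (simp add: powr_realpow)
    also have "\<dots> = 2 powr ((1 - \<alpha>) * real l)"
      by (simp add: powr_add[symmetric] algebra_simps)
    finally have 1: "2 powr ((1 - \<alpha>) * real l) \<le> (\<Sum>n\<in>{0<..2 ^ l}. wt \<alpha> n)" .
    have "2 * (C * 2 powr (3/4 * (1 - \<alpha>) * real l)) \<le> 2 powr ((1 - \<alpha>) / 4 * real l) * 2 powr (3/4 * (1 - \<alpha>) * real l)"
      using l0[OF \<open>l \<ge> l0\<close>] mult_right_mono[of "2 * C" "2 powr ((1 - \<alpha>) / 4 * real l)" "2 powr (3/4 * (1 - \<alpha>) * real l)"]
      by simp
    also have "\<dots> = 2 powr ((1 - \<alpha>) * real l)"
    proof -
      have "(1 - \<alpha>) / 4 * real l + 3/4 * (1 - \<alpha>) * real l = (1 - \<alpha>) * real l"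
        by (simp add: field_simps)
      then show ?thesis by (simp only: powr_add[symmetric])
    qed
    finally have 2: "C * 2 powr (3/4 * (1 - \<alpha>) * real l) \<le> 2 powr ((1 - \<alpha>) * real l) / 2" by simp
    have "\<bar>\<Sum>n\<in>{0<..2 ^ l}. X i n - wt \<alpha> n\<bar> \<le> C * 2 powr (3/4 * (1 - \<alpha>) * real l)"
      by (rule discrepancy) auto
    then show "2 powr ((1 - \<alpha>) * real l) / 2 \<le> (\<Sum>n\<in>{0<..2 ^ l}. X i n)"
      using 1 2 by (simp add: sum_subtractf)
  qed
qed

text \<open>For \<open>u \<ge> 1\<close> the ends of the shell differ by a factor of at most 2, so
  the weights in it are comparable. The bound is stated with \<open>u + 1\<close> so that it
  includes the shell \<open>u = 0\<close>, where \<open>wt \<alpha> u\<close> is 0.\<close>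

lemma sum_wt_shell_le:
  assumes "u \<ge> 0"
  shows "(\<Sum>n\<in>{2 ^ m * u<..2 ^ m * (u + 1)}. wt \<alpha> n) \<le> 2 * wt \<alpha> (u + 1) * 2 powr ((1 - \<alpha>) * real m)"
proof (cases "u = 0")
  case True
  have "(\<Sum>n\<in>{0<..2 ^ m}. wt \<alpha> n) \<le> 1 / (1 - \<alpha>) * 2 powr ((1 - \<alpha>) * real m)"
    by (rule sum_wt_le) auto
  also have "\<dots> \<le> 2 * 2 powr ((1 - \<alpha>) * real m)"
    using \<alpha> by (intro mult_right_mono) (auto simp: field_simps)
  finally show ?thesis using True by (simp add: wt_def)
next
  case False
  then have u: "u \<ge> 1" using assms by simp
  have "(\<Sum>n\<in>{2 ^ m * u<..2 ^ m * (u + 1)}. wt \<alpha> n)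
      \<le> (\<Sum>n\<in>{2 ^ m * u<..2 ^ m * (u + 1)}. 2 * wt \<alpha> (u + 1) * 2 powr (-\<alpha> * real m))"
  proof (rule sum_mono)
    fix n assume n: "n \<in> {2 ^ m * u<..2 ^ m * (u + 1)}"
    have "2 ^ m * (u + 1) \<le> 2 * (2 ^ m * u)" using u by (simp add: algebra_simps)
    also have "\<dots> \<le> 2 * n" using n by simp
    finally have "real_of_int (2 ^ m * (u + 1)) \<le> real_of_int (2 * n)" by (simp only: of_int_le_iff)
    then have le: "2 powr real m * real_of_int (u + 1) / 2 \<le> real_of_int n" by (simp add: powr_realpow)
    have "wt \<alpha> n \<le> (2 powr real m * real_of_int (u + 1) / 2) powr (-\<alpha>)"
      unfolding wt_def using le \<alpha> u by (intro powr_mono2') auto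
    also have "\<dots> = 2 powr (-\<alpha> * real m) * wt \<alpha> (u + 1) * 2 powr \<alpha>"
      using u unfolding wt_def by (simp add: powr_divide powr_mult powr_powr powr_minus_divide mult.commute)
    also have "\<dots> \<le> 2 powr (-\<alpha> * real m) * wt \<alpha> (u + 1) * 2"
      using \<alpha> powr_mono[of \<alpha> 1 2] by (intro mult_left_mono) auto
    finally show "wt \<alpha> n \<le> 2 * wt \<alpha> (u + 1) * 2 powr (-\<alpha> * real m)" by (simp add: mult_ac)
  qed
  also have "\<dots> = 2 * wt \<alpha> (u + 1) * (2 powr real m * 2 powr (-\<alpha> * real m))"
    by (simp add: powr_realpow algebra_simps)
  also have "2 powr real m * 2 powr (-\<alpha> * real m) = 2 powr ((1 - \<alpha>) * real m)"
    by (simp add: powr_add[symmetric] algebra_simps)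
  finally show ?thesis .
qed

text \<open>For fixed \<open>q\<close> the main terms grow like 2^((1 - alpha) m) and the
  discrepancy with only 3/4 of that exponent. The shells must be few compared with their length,
  hence \<open>m0\<close> depends on \<open>q\<close>.\<close>

lemma sum_X_shell_le:
  obtains m0 where "\<And>m u i. m \<ge> m0 \<Longrightarrow> 0 \<le> u \<Longrightarrow> u < 2 ^ (q + 1) \<Longrightarrow>
    (\<Sum>n\<in>{2 ^ m * u<..2 ^ m * (u + 1)}. X i n) \<le> 3 * wt \<alpha> (u + 1) * 2 powr ((1 - \<alpha>) * real m)"
proof -
  define K where "K = C * 2 powr (3/4 * (1 - \<alpha>) * real (q + 1)) * 2 powr (\<alpha> * real (q + 1))"
  obtain m0 where m0: "\<And>m. m \<ge> m0 \<Longrightarrow> K \<le> 2 powr ((1 - \<alpha>) / 4 * real m)"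
    using exists_exp_ge[of "(1 - \<alpha>) / 4" K] \<alpha> by auto
  show ?thesis
  proof (rule that)
    fix m u i assume m: "m \<ge> m0" and u: "0 \<le> u" "u < (2::int) ^ (q + 1)"
    have "2 ^ m * (u + 1) \<le> 2 ^ m * (2::int) ^ (q + 1)" using u by (intro mult_left_mono) auto
    then have le: "2 ^ m * (u + 1) \<le> (2::int) ^ (m + q + 1)" by (simp add: power_add mult_ac)
    have "\<bar>\<Sum>n\<in>{2 ^ m * u<..2 ^ m * (u + 1)}. X i n - wt \<alpha> n\<bar> \<le> C * 2 powr (3/4 * (1 - \<alpha>) * real (m + q + 1))"
      using u le by (intro discrepancy) auto
    also have "\<dots> \<le> wt \<alpha> (u + 1) * 2 powr ((1 - \<alpha>) * real m)"
    proof -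
      have "real_of_int (u + 1) \<le> real_of_int (2 ^ (q + 1))" using u by (simp only: of_int_le_iff)
      then have "real_of_int (u + 1) \<le> 2 powr real (q + 1)" by (simp add: powr_realpow[symmetric] powr_add)
      then have "(2 powr real (q + 1)) powr (-\<alpha>) \<le> wt \<alpha> (u + 1)"
        unfolding wt_def using u \<alpha> by (intro powr_mono2') auto
      then have w: "2 powr (- (\<alpha> * real (q + 1))) \<le> wt \<alpha> (u + 1)" by (simp add: powr_powr mult.commute)
      have "C * 2 powr (3/4 * (1 - \<alpha>) * real (m + q + 1))
        = K * (2 powr (- (\<alpha> * real (q + 1))) * 2 powr (3/4 * (1 - \<alpha>) * real m))"
      proof -
        have e: "3/4 * (1 - \<alpha>) * real (m + q + 1) = 3/4 * (1 - \<alpha>) * real (q + 1) + \<alpha> * real (q + 1)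
            + - (\<alpha> * real (q + 1)) + 3/4 * (1 - \<alpha>) * real m" by (simp add: field_simps)
        show ?thesis unfolding K_def e powr_add by (simp only: mult_ac)
      qed
      also have "\<dots> \<le> 2 powr ((1 - \<alpha>) / 4 * real m) * (wt \<alpha> (u + 1) * 2 powr (3/4 * (1 - \<alpha>) * real m))"
        using m0[OF m] w by (intro mult_mono) auto
      also have "\<dots> = wt \<alpha> (u + 1) * 2 powr ((1 - \<alpha>) * real m)"
      proof -
        have "(1 - \<alpha>) * real m = (1 - \<alpha>) / 4 * real m + 3/4 * (1 - \<alpha>) * real m"
          by (simp add: field_simps)
        then show ?thesis by (simp only: powr_add mult_ac)
      qed
      finally show ?thesis .
    qed
    finally have "\<bar>\<Sum>n\<in>{2 ^ m * u<..2 ^ m * (u + 1)}. X i n - wt \<alpha> n\<bar>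
      \<le> wt \<alpha> (u + 1) * 2 powr ((1 - \<alpha>) * real m)" .
    then show "(\<Sum>n\<in>{2 ^ m * u<..2 ^ m * (u + 1)}. X i n) \<le> 3 * wt \<alpha> (u + 1) * 2 powr ((1 - \<alpha>) * real m)"
      using sum_wt_shell_le[OF u(1), of m] by (simp add: sum_subtractf)
  qed
qed

text \<open>Put Q = 2^(q + 1). The weights are large near the coordinate hyperplanes, so
  Cauchy-Schwarz is used: at most d Q^(d - 1) boundary cubes, and a sum of squared weights of order
  Q^((1 - 2 alpha) d). Compared with Q^(2 (1 - alpha) d), the square of the order of the total
  weight, one factor Q is saved.\<close>

lemma boundary_weight_sq_le:
  "(\<Sum>u\<in>(boundary_cubes q r :: (int ^ 'd) set). \<Prod>i\<in>UNIV. wt \<alpha> (u $ i + 1))\<^sup>2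
    \<le> real CARD('d) / (1 - 2 * \<alpha>) ^ CARD('d) * ((2 powr ((1 - \<alpha>) * real (q + 1))) ^ CARD('d))\<^sup>2 / 2 ^ (q + 1)"
proof -
  let ?B = "boundary_cubes q r :: (int ^ 'd) set"
  let ?U = "vbox (\<lambda>_. {0..<2 ^ (q + 1)}) :: (int ^ 'd) set"
  let ?Q = "(2::real) ^ (q + 1)"
  define g where "g = (2::real) powr ((1 - 2 * \<alpha>) * real (q + 1))"
  have "(\<Sum>u\<in>?B. \<Prod>i\<in>UNIV. wt \<alpha> (u $ i + 1))\<^sup>2 = (\<Sum>u\<in>?B. 1 * (\<Prod>i\<in>UNIV. wt \<alpha> (u $ i + 1)))\<^sup>2" by simp
  also have "\<dots> \<le> (\<Sum>u\<in>?B. 1\<^sup>2) * (\<Sum>u\<in>?B. (\<Prod>i\<in>UNIV. wt \<alpha> (u $ i + 1))\<^sup>2)"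
    by (rule Cauchy_Schwarz_ineq_sum)
  also have "\<dots> \<le> (real CARD('d) * ?Q ^ (CARD('d) - 1)) * (g / (1 - 2 * \<alpha>)) ^ CARD('d)"
  proof (rule mult_mono)
    show "(\<Sum>u\<in>?B. 1\<^sup>2) \<le> real CARD('d) * ?Q ^ (CARD('d) - 1)"
      using card_boundary_cubes_le[of q r] by simp
    have "(\<Sum>u\<in>?B. (\<Prod>i\<in>UNIV. wt \<alpha> (u $ i + 1))\<^sup>2) \<le> (\<Sum>u\<in>?U. (\<Prod>i\<in>UNIV. wt \<alpha> (u $ i + 1))\<^sup>2)"
      by (intro sum_mono2) (auto simp: boundary_cubes_def)
    also have "\<dots> = (\<Sum>u\<in>?U. \<Prod>i\<in>UNIV. (wt \<alpha> (u $ i + 1))\<^sup>2)"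
      by (simp add: prod_power_distrib)
    also have "\<dots> = (\<Prod>i\<in>(UNIV::'d set). \<Sum>v\<in>{0..<2 ^ (q + 1)}. (wt \<alpha> (v + 1))\<^sup>2)"
      by (rule sum_prod_vbox) simp
    also have "(\<Sum>v\<in>{0..<2 ^ (q + 1)}. (wt \<alpha> (v + 1))\<^sup>2) = (\<Sum>v\<in>{0<..2 ^ (q + 1)}. (wt \<alpha> v)\<^sup>2)"
      by (rule sum.reindex_bij_witness[where i = "\<lambda>v. v - 1" and j = "\<lambda>v. v + 1"]) auto
    also have "(\<Prod>i\<in>(UNIV::'d set). \<Sum>v\<in>{0<..2 ^ (q + 1)}. (wt \<alpha> v)\<^sup>2) \<le> (\<Prod>i\<in>(UNIV::'d set). g / (1 - 2 * \<alpha>))"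
      using sum_wt_sq_le[of 0 "2 ^ (q + 1)" "q + 1"] unfolding g_def
      by (intro prod_mono conjI sum_nonneg) auto
    finally show "(\<Sum>u\<in>?B. (\<Prod>i\<in>UNIV. wt \<alpha> (u $ i + 1))\<^sup>2) \<le> (g / (1 - 2 * \<alpha>)) ^ CARD('d)" by simp
  qed (auto intro!: sum_nonneg)
  also have "?Q ^ (CARD('d) - 1) = ?Q ^ CARD('d) / ?Q"
    by (subst power_eq_if[of ?Q "CARD('d)"]) simp
  also have "(real CARD('d) * (?Q ^ CARD('d) / ?Q)) * (g / (1 - 2 * \<alpha>)) ^ CARD('d)
    = real CARD('d) / (1 - 2 * \<alpha>) ^ CARD('d) * (?Q * g) ^ CARD('d) / ?Q"
    by (simp add: power_mult_distrib power_divide mult_ac)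
  also have "?Q * g = 2 powr ((1 - \<alpha>) * real (q + 1)) * 2 powr ((1 - \<alpha>) * real (q + 1))"
  proof -
    have "?Q = 2 powr real (q + 1)" by (simp only: powr_realpow zero_less_numeral)
    then show ?thesis unfolding g_def by (simp only: powr_add[symmetric]) (simp add: algebra_simps)
  qed
  finally show ?thesis by (simp only: power_mult_distrib power2_eq_square)
qed

end

text \<open>The 1 is subtracted because the cubes are open at the lower end and closed at the upper
  one.\<close>

definition cube_index :: "nat \<Rightarrow> int ^ 'd::finite \<Rightarrow> int ^ 'd" where
  "cube_index m n = (\<chi> i. (n $ i - 1) div 2 ^ m)"

lemma div_eq_iff_shell: "(n - 1) div K = u \<longleftrightarrow> K * u < n \<and> n \<le> K * (u + 1)" if "K > 0" for n K u :: int
proof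
  assume u: "(n - 1) div K = u"
  define r where "r = (n - 1) mod K"
  have "n - 1 = K * u + r" unfolding r_def u[symmetric] by simp
  moreover have "0 \<le> r" "r < K" using that by (auto simp: r_def)
  ultimately show "K * u < n \<and> n \<le> K * (u + 1)" by (simp add: distrib_left)
next
  assume "K * u < n \<and> n \<le> K * (u + 1)"
  then show "(n - 1) div K = u"
    by (intro int_div_pos_eq[where r = "n - 1 - K * u"]) (auto simp: distrib_left)
qed

lemma mem_cube_iff: "n \<in> cube m u \<longleftrightarrow> cube_index m n = u"
  by (auto simp: cube_def cube_index_def vec_eq_iff div_eq_iff_shell)

lemma finite_cube [simp, intro]: "finite (cube m u)"
  by (simp add: cube_def)

section \<open>From norm balls to dyadic cubes\<close>

context sparse_set
begin

lemma nrm_add: "nrm (m + k) = nrm m * nrm k"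
proof -
  have "- (1 - \<alpha>) * real (m + k) = - (1 - \<alpha>) * real m + - (1 - \<alpha>) * real k"
    by (simp add: algebra_simps)
  then show ?thesis unfolding nrm_def by (simp only: powr_add power_mult_distrib)
qed

lemma nrm_le_1: "nrm k \<le> 1"
proof -
  have "2 powr (- (1 - \<alpha>) * real k) \<le> 2 powr 0"
    using \<alpha> by (intro two_powr_le) (simp add: mult_nonneg_nonneg mult_nonpos_nonneg)
  then show ?thesis unfolding nrm_def by (intro power_le_one) auto
qed

lemma nrm_inverse: "(2 powr ((1 - \<alpha>) * real k)) ^ CARD('d) * nrm k = 1"
  unfolding nrm_def power_mult_distrib[symmetric] powr_add[symmetric] by (simp add: algebra_simps)

lemma support_pos: "n \<in> support \<Longrightarrow> n $ i \<ge> 1"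
  by (simp add: support_def)

context
  fixes a :: "nat \<Rightarrow> int ^ 'd"
  assumes a: "norm_ordered_enumeration a support"
begin

lemma enum_mem: "k \<ge> 1 \<Longrightarrow> a k \<in> support"
  using a by (auto simp: norm_ordered_enumeration_def bij_betw_def)

lemma enum_inj: "inj_on a {1..}"
  using a by (auto simp: norm_ordered_enumeration_def bij_betw_def)

lemma enum_norm_mono: "1 \<le> k \<Longrightarrow> k \<le> l \<Longrightarrow> euclid_norm (a k) \<le> euclid_norm (a l)"
  using a by (auto simp: norm_ordered_enumeration_def mono_on_def)

text \<open>The inequality between the norms is strict because points of equal norm may be
  enumerated in any order.\<close>

lemma enum_before:
  assumes "n \<in> support" "euclid_norm n < euclid_norm (a N)" "N \<ge> 1"
  shows "n \<in> a ` {1..N}"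
proof -
  have "n \<in> a ` {1..}" using assms a by (simp add: norm_ordered_enumeration_def bij_betw_def)
  then obtain k where k: "k \<ge> 1" "n = a k" by auto
  have "k \<le> N" using enum_norm_mono[of N k] k assms by (cases "k \<le> N") auto
  then show ?thesis using k by auto
qed

lemma enum_norm_unbounded:
  obtains N0 where "\<And>N. N \<ge> N0 \<Longrightarrow> r < euclid_norm (a N)"
proof -
  have "\<exists>k\<ge>1. r < euclid_norm (a k)"
  proof (rule ccontr)
    assume "\<not> ?thesis"
    then have le: "euclid_norm (a k) \<le> r" if "k \<ge> 1" for k using that by (meson not_le)
    have "a ` {1..} \<subseteq> rect (\<lambda>_. nat \<lceil>r\<rceil>)"
    proof (rule image_subsetI)
      fix k :: nat assume k: "k \<in> {1..}"
      have "\<bar>a k $ i\<bar> \<le> int (nat \<lceil>r\<rceil>)" for i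
      proof -
        have "\<bar>real_of_int (a k $ i)\<bar> \<le> r"
          using abs_component_le_euclid_norm[of "a k" i] le[of k] k by simp
        then have "real_of_int \<bar>a k $ i\<bar> \<le> real_of_int \<lceil>r\<rceil>" by linarith
        then show ?thesis by linarith
      qed
      then show "a k \<in> rect (\<lambda>_. nat \<lceil>r\<rceil>)" by (simp add: mem_rect)
    qed
    then have "finite (a ` {1..})" by (rule finite_subset) auto
    then have "finite {1::nat..}" using enum_inj by (rule finite_imageD)
    then show False using infinite_Ici by blast
  qed
  then obtain k where k: "k \<ge> 1" "r < euclid_norm (a k)" by blast
  show ?thesis
  proof (rule that)
    fix N assume "N \<ge> k"
    then show "r < euclid_norm (a N)" using enum_norm_mono[of k N] k by linarith
  qed
qed

text \<open>With \<open>2 ^ D > 2 * CARD('d)\<close>, all sample points in the cube of side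
  \<open>2 ^ (j - D)\<close> have smaller norm than \<open>a N\<close> and come before it. Their
  number, by \<open>sum_X_ge\<close> of order 1 / \<open>nrm j\<close>, is thus at most
  \<open>N\<close>.\<close>

lemma enum_count_ge:
  obtains c where "c > 0" "\<And>N j. N \<ge> 1 \<Longrightarrow> 2 ^ j \<le> 2 * euclid_norm (a N) \<Longrightarrow> c \<le> real N * nrm j"
proof -
  obtain l0 where l0: "\<And>l i. l \<ge> l0 \<Longrightarrow> (\<Sum>n\<in>{0<..2 ^ l}. X i n) \<ge> 2 powr ((1 - \<alpha>) * real l) / 2"
    using sum_X_ge by blast
  obtain D where D: "2 * real CARD('d) < 2 ^ D" using real_arch_pow[of 2 "2 * real CARD('d)"] by auto
  define c where "c = (2 powr (- (1 - \<alpha>) * real (D + l0)) / 2) ^ CARD('d)"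
  have c: "c > 0" by (simp add: c_def)
  show ?thesis
  proof (rule that[OF c])
    fix N j assume N: "N \<ge> 1" and j: "2 ^ j \<le> 2 * euclid_norm (a N)"
    show "c \<le> real N * nrm j"
    proof (cases "j \<ge> D + l0")
      case True
      define l where "l = j - D"
      have l: "l \<ge> l0" "j = D + l" using True by (auto simp: l_def)
      let ?B = "vbox (\<lambda>_. {0<..2 ^ l}) :: (int ^ 'd) set"
      have "support \<inter> ?B \<subseteq> a ` {1..N}"
      proof
        fix n assume n: "n \<in> support \<inter> ?B"
        have "euclid_norm n \<le> real CARD('d) * 2 ^ l"
        proof (rule euclid_norm_le_card_mult)
          fix i
          have "0 < n $ i" "n $ i \<le> 2 ^ l" using n by auto
          then have "\<bar>real_of_int (n $ i)\<bar> \<le> real_of_int (2 ^ l)" by (simp only: of_int_le_iff abs_of_pos of_int_0_less_iff)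
          then show "\<bar>real_of_int (n $ i)\<bar> \<le> 2 ^ l" by simp
        qed
        then have "2 * euclid_norm n \<le> (2 * real CARD('d)) * 2 ^ l" by simp
        also have "\<dots> < 2 ^ D * 2 ^ l" using D by (intro mult_strict_right_mono) auto
        also have "\<dots> \<le> 2 * euclid_norm (a N)" using j l(2) by (simp add: power_add)
        finally have "euclid_norm n < euclid_norm (a N)" by simp
        then show "n \<in> a ` {1..N}" using n enum_before N by blast
      qed
      then have "card (support \<inter> ?B) \<le> card (a ` {1..N})" by (intro card_mono) auto
      also have "\<dots> \<le> N" using card_image_le[of "{1..N}" a] by simp
      finally have card: "real (card (support \<inter> ?B)) \<le> real N" by simp
      have "c \<le> (2 powr (- (1 - \<alpha>) * real D) / 2) ^ CARD('d)"
        unfolding c_def using \<alpha> by (intro power_mono divide_right_mono two_powr_le) (auto simp: algebra_simps intro!: mult_left_le_one_le)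
      also have "2 powr (- (1 - \<alpha>) * real D) = 2 powr ((1 - \<alpha>) * real l) * 2 powr (- (1 - \<alpha>) * real j)"
        unfolding powr_add[symmetric] l(2) by (simp add: algebra_simps)
      also have "(2 powr ((1 - \<alpha>) * real l) * 2 powr (- (1 - \<alpha>) * real j) / 2) ^ CARD('d)
          = (\<Prod>i\<in>(UNIV::'d set). 2 powr ((1 - \<alpha>) * real l) / 2) * nrm j"
        unfolding nrm_def by (simp add: power_mult_distrib power_divide)
      also have "\<dots> \<le> (\<Prod>i\<in>(UNIV::'d set). \<Sum>n\<in>{0<..2 ^ l}. X i n) * nrm j"
        using l0[OF l(1)] nrm_pos[of j] by (intro mult_right_mono prod_mono) auto
      also have "\<dots> = real (card (support \<inter> ?B)) * nrm j"
        by (subst card_support_vbox) auto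
      also have "\<dots> \<le> real N * nrm j" using card nrm_pos[of j] by (intro mult_right_mono) auto
      finally show ?thesis .
    next
      case False
      \<comment> \<open>The finitely many remaining scales are settled by \<open>N \<ge> 1\<close>
        and the monotonicity of \<open>nrm\<close>.\<close>
      have le: "- (1 - \<alpha>) * real (D + l0) \<le> - (1 - \<alpha>) * real j"
        using False \<alpha> by (intro mult_left_mono_neg) auto
      have "c \<le> nrm j"
      proof -
        have "2 powr (- (1 - \<alpha>) * real (D + l0)) / 2 \<le> 2 powr (- (1 - \<alpha>) * real (D + l0))" by simp
        also have "\<dots> \<le> 2 powr (- (1 - \<alpha>) * real j)" by (rule two_powr_le[OF le])
        finally show ?thesis unfolding c_def nrm_def by (rule power_mono) simp
      qed
      also have "\<dots> \<le> real N * nrm j" using N nrm_pos[of j] by simp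
      finally show ?thesis .
    qed
  qed
qed

end

end

context sparse_set
begin

text \<open>A cube inside the ball is enumerated completely and one outside not at all. Which points
  of a boundary cube have been enumerated is unknown, so there the sum is bounded by the number of
  sample points.\<close>

lemma enum_sum_cubes_le:
  assumes a: "norm_ordered_enumeration a support" and N: "N \<ge> 1"
    and R: "euclid_norm (a N) < 2 ^ (m + q + 1)"
    and \<phi>: "\<And>n. \<bar>\<phi> n\<bar> \<le> B"
  shows "\<bar>\<Sum>k=1..N. \<phi> (a k)\<bar>
    \<le> (\<Sum>u\<in>vbox (\<lambda>_. {0..<2 ^ (q + 1)}). \<bar>\<Sum>n\<in>cube m u. (\<Prod>i\<in>UNIV. X i (n $ i)) * \<phi> n\<bar>)
      + B * (\<Sum>u\<in>boundary_cubes q (euclid_norm (a N) / 2 ^ m). real (card (support \<inter> cube m u)))"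
proof -
  define U where "U = (vbox (\<lambda>_. {0..<2 ^ (q + 1)}) :: (int ^ 'd) set)"
  define r where "r = euclid_norm (a N) / 2 ^ m"
  define F where "F = a ` {1..N}"
  define Bd where "Bd = (boundary_cubes q r :: (int ^ 'd) set)"
  have B0: "B \<ge> 0" using \<phi>[of 0] by linarith
  have finU: "finite U" "finite F" by (auto simp: U_def F_def)
  have BdU: "Bd \<subseteq> U" by (auto simp: Bd_def U_def boundary_cubes_def)
  have F_norm: "euclid_norm n \<le> euclid_norm (a N)" if "n \<in> F" for n
    using that enum_norm_mono[OF a] by (auto simp: F_def)
  have F_supp: "n \<in> support" if "n \<in> F" for n
    using that enum_mem[OF a] by (auto simp: F_def)
  have cubeD: "2 ^ m * u $ i < n $ i \<and> n $ i \<le> 2 ^ m * (u $ i + 1)" if "cube_index m n = u" for n u :: "int ^ 'd" and i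
    using that mem_cube_iff[of n m u] by (auto simp: cube_def)
  have U_mem: "cube_index m n \<in> U" if n: "n \<in> F" for n
  proof -
    have "0 \<le> cube_index m n $ i \<and> cube_index m n $ i < 2 ^ (q + 1)" for i
    proof
      have n1: "n $ i \<ge> 1" using F_supp[OF n] by (rule support_pos)
      then show "0 \<le> cube_index m n $ i" by (simp add: cube_index_def pos_imp_zdiv_nonneg_iff)
      have "real_of_int (n $ i) \<le> euclid_norm (a N)"
        using abs_component_le_euclid_norm[of n i] F_norm[OF n] by linarith
      then have "real_of_int (n $ i) < real_of_int (2 ^ (m + q + 1))" using R by simp
      then have "n $ i < 2 ^ (m + q + 1)" by (simp only: of_int_less_iff)
      moreover have "2 ^ m * cube_index m n $ i < n $ i" using cubeD[OF refl, of n i] by simp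
      ultimately have "2 ^ m * cube_index m n $ i < 2 ^ (m + q + 1)" by (rule less_trans[rotated])
      also have "(2::int) ^ (m + q + 1) = 2 ^ m * 2 ^ (q + 1)" by (simp add: power_add)
      finally have "2 ^ m * cube_index m n $ i < 2 ^ m * 2 ^ (q + 1)" .
      then show "cube_index m n $ i < 2 ^ (q + 1)" by (subst (asm) mult_less_cancel_left_pos) auto
    qed
    then show ?thesis by (simp add: U_def)
  qed
  have "(\<Sum>k=1..N. \<phi> (a k)) = (\<Sum>n\<in>F. \<phi> n)"
    unfolding F_def using enum_inj[OF a] by (subst sum.reindex) (auto intro: inj_on_subset)
  also have "\<dots> = (\<Sum>u\<in>U. \<Sum>n\<in>{n. n \<in> F \<and> cube_index m n = u}. \<phi> n)"
    using finU U_mem by (intro sum.group[symmetric]) auto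
  finally have "\<bar>\<Sum>k=1..N. \<phi> (a k)\<bar> \<le> (\<Sum>u\<in>U. \<bar>\<Sum>n\<in>{n. n \<in> F \<and> cube_index m n = u}. \<phi> n\<bar>)"
    by (simp only: sum_abs)
  also have "\<dots> \<le> (\<Sum>u\<in>U. \<bar>\<Sum>n\<in>cube m u. (\<Prod>i\<in>UNIV. X i (n $ i)) * \<phi> n\<bar>
      + (if u \<in> Bd then B * real (card (support \<inter> cube m u)) else 0))"
  proof (rule sum_mono)
    fix u assume u: "u \<in> U"
    let ?G = "{n. n \<in> F \<and> cube_index m n = u}"
    have u0: "0 \<le> u $ i" for i using u by (auto simp: U_def)
    have sub: "?G \<subseteq> support \<inter> cube m u" using F_supp by (auto simp: mem_cube_iff)
    have nonneg: "0 \<le> B * real (card (support \<inter> cube m u))" using B0 by simp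
    have scale: "euclid_norm (\<chi> i. 2 ^ m * v $ i) = 2 ^ m * euclid_norm v" for v :: "int ^ 'd"
      using euclid_norm_scale[of "2 ^ m" v] by simp
    \<comment> \<open>All points of \<open>cube m u\<close> lie strictly beyond the corner
      \<open>2 ^ m * u\<close>, so \<open>r \<le> euclid_norm u\<close> excludes the cube even in
      the case of equality.\<close>
    consider "euclid_norm (u + 1) < r" | "r \<le> euclid_norm u" | "euclid_norm u < r" "r \<le> euclid_norm (u + 1)"
      by linarith
    then show "\<bar>\<Sum>n\<in>?G. \<phi> n\<bar> \<le> \<bar>\<Sum>n\<in>cube m u. (\<Prod>i\<in>UNIV. X i (n $ i)) * \<phi> n\<bar>
      + (if u \<in> Bd then B * real (card (support \<inter> cube m u)) else 0)"
    proof cases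
      case 1
      have "support \<inter> cube m u \<subseteq> ?G"
      proof
        fix n assume n: "n \<in> support \<inter> cube m u"
        then have ci: "cube_index m n = u" by (simp add: mem_cube_iff)
        have "euclid_norm n \<le> euclid_norm (\<chi> i. 2 ^ m * (u + 1) $ i)"
        proof (rule euclid_norm_mono)
          fix i
          show "0 \<le> n $ i" using n support_pos[of n i] by auto
          show "n $ i \<le> (\<chi> i. 2 ^ m * (u + 1) $ i) $ i" using cubeD[OF ci, of i] by simp
        qed
        also have "\<dots> < euclid_norm (a N)" unfolding scale using 1 by (simp add: r_def field_simps)
        finally have "n \<in> F" unfolding F_def using n N by (intro enum_before[OF a]) auto
        then show "n \<in> ?G" using ci by simp
      qed
      with sub have "?G = support \<inter> cube m u" by blast
      moreover have "(\<Sum>n\<in>cube m u. (\<Prod>i\<in>UNIV. X i (n $ i)) * \<phi> n) = (\<Sum>n\<in>support \<inter> cube m u. \<phi> n)"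
        unfolding cube_def using u0 by (intro sum_support_vbox) auto
      ultimately show ?thesis using nonneg by auto
    next
      case 2
      have "?G = {}"
      proof (rule ccontr)
        assume "?G \<noteq> {}"
        then obtain n where n: "n \<in> F" "cube_index m n = u" by blast
        have "euclid_norm (\<chi> i. 2 ^ m * u $ i) < euclid_norm n"
          using cubeD[OF n(2)] u0 by (intro euclid_norm_strict_mono) auto
        then have "2 ^ m * euclid_norm u < euclid_norm (a N)" unfolding scale using F_norm[OF n(1)] by linarith
        then show False using 2 by (simp add: r_def field_simps)
      qed
      then have "(\<Sum>n\<in>?G. \<phi> n) = 0" by (simp only: sum.empty)
      then show ?thesis using nonneg by auto
    next
      case 3
      have "u \<in> Bd" using 3 u by (auto simp: Bd_def boundary_cubes_def U_def)
      have "\<bar>\<Sum>n\<in>?G. \<phi> n\<bar> \<le> (\<Sum>n\<in>?G. \<bar>\<phi> n\<bar>)" by (rule sum_abs)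
      also have "\<dots> \<le> (\<Sum>n\<in>?G. B)" by (intro sum_mono \<phi>)
      also have "\<dots> = B * real (card ?G)" by simp
      also have "\<dots> \<le> B * real (card (support \<inter> cube m u))"
        using sub B0 by (intro mult_left_mono of_nat_mono card_mono) auto
      finally show ?thesis using \<open>u \<in> Bd\<close> by simp
    qed
  qed
  also have "\<dots> = (\<Sum>u\<in>U. \<bar>\<Sum>n\<in>cube m u. (\<Prod>i\<in>UNIV. X i (n $ i)) * \<phi> n\<bar>)
      + (\<Sum>u\<in>U. if u \<in> Bd then B * real (card (support \<inter> cube m u)) else 0)"
    by (rule sum.distrib)
  also have "(\<Sum>u\<in>U. if u \<in> Bd then B * real (card (support \<inter> cube m u)) else 0)
      = (\<Sum>u\<in>{u\<in>U. u \<in> Bd}. B * real (card (support \<inter> cube m u)))"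
    using finU by (intro sum.inter_filter[symmetric])
  also have "{u\<in>U. u \<in> Bd} = Bd" using BdU by blast
  finally show ?thesis unfolding U_def Bd_def r_def by (simp add: sum_distrib_left)
qed

text \<open>The shell bounds are multiplied over the coordinates and summed by
  \<open>boundary_weight_sq_le\<close>, whose saved factor \<open>2 ^ (q + 1)\<close> becomes a
  square root. Uniformity in \<open>r\<close> matters, as the radius is dictated by the
  enumeration.\<close>

lemma boundary_count_le:
  obtains m0 where "\<And>m r. m \<ge> m0 \<Longrightarrow>
    nrm (m + (q + 1)) * (\<Sum>u\<in>boundary_cubes q r. real (card (support \<inter> cube m u)))
      \<le> 3 ^ CARD('d) * sqrt (real CARD('d) / (1 - 2 * \<alpha>) ^ CARD('d)) / sqrt (2 ^ (q + 1))"
proof -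
  obtain m0 where m0: "\<And>m u i. m \<ge> m0 \<Longrightarrow> 0 \<le> u \<Longrightarrow> u < 2 ^ (q + 1) \<Longrightarrow>
    (\<Sum>n\<in>{2 ^ m * u<..2 ^ m * (u + 1)}. X i n) \<le> 3 * wt \<alpha> (u + 1) * 2 powr ((1 - \<alpha>) * real m)"
    using sum_X_shell_le[of q] by blast
  show ?thesis
  proof (rule that)
    fix m r assume m: "m \<ge> m0"
    let ?Bd = "boundary_cubes q r :: (int ^ 'd) set"
    define W where "W = (\<Sum>u\<in>?Bd. \<Prod>i\<in>UNIV. wt \<alpha> (u $ i + 1))"
    define P where "P = (2 powr ((1 - \<alpha>) * real (q + 1))) ^ CARD('d)"
    define S where "S = real CARD('d) / (1 - 2 * \<alpha>) ^ CARD('d)"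
    have S0: "S \<ge> 0" using \<alpha> by (simp add: S_def)
    have P0: "P > 0" by (simp add: P_def)
    have "W\<^sup>2 \<le> S * P\<^sup>2 / 2 ^ (q + 1)"
      unfolding W_def P_def S_def by (rule boundary_weight_sq_le)
    then have "W \<le> sqrt (S * P\<^sup>2 / 2 ^ (q + 1))" by (rule real_le_rsqrt)
    also have "\<dots> = sqrt S / sqrt (2 ^ (q + 1)) * P"
      using P0 by (simp add: real_sqrt_mult real_sqrt_divide)
    finally have W: "W \<le> sqrt S / sqrt (2 ^ (q + 1)) * P" .
    have "(\<Sum>u\<in>?Bd. real (card (support \<inter> cube m u)))
        \<le> (\<Sum>u\<in>?Bd. \<Prod>i\<in>UNIV. 3 * wt \<alpha> (u $ i + 1) * 2 powr ((1 - \<alpha>) * real m))"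
    proof (rule sum_mono)
      fix u assume u: "u \<in> ?Bd"
      then have u': "0 \<le> u $ i" "u $ i < 2 ^ (q + 1)" for i by (auto simp: boundary_cubes_def)
      have "real (card (support \<inter> cube m u)) = (\<Prod>i\<in>UNIV. \<Sum>n\<in>{2 ^ m * u $ i<..2 ^ m * (u $ i + 1)}. X i n)"
        unfolding cube_def using u' by (intro card_support_vbox) auto
      also have "\<dots> \<le> (\<Prod>i\<in>UNIV. 3 * wt \<alpha> (u $ i + 1) * 2 powr ((1 - \<alpha>) * real m))"
      proof (intro prod_mono conjI m0 m u' sum_nonneg X_nonneg)
        fix i n assume "n \<in> {2 ^ m * u $ i<..2 ^ m * (u $ i + 1)}"
        moreover have "0 \<le> 2 ^ m * u $ i" using u'(1) by simp
        ultimately show "1 \<le> n" by simp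
      qed
      finally show "real (card (support \<inter> cube m u))
        \<le> (\<Prod>i\<in>UNIV. 3 * wt \<alpha> (u $ i + 1) * 2 powr ((1 - \<alpha>) * real m))" .
    qed
    also have "\<dots> = 3 ^ CARD('d) * (2 powr ((1 - \<alpha>) * real m)) ^ CARD('d) * W"
      by (simp add: prod.distrib W_def sum_distrib_left mult_ac)
    finally have "nrm (m + (q + 1)) * (\<Sum>u\<in>?Bd. real (card (support \<inter> cube m u)))
        \<le> nrm (m + (q + 1)) * (3 ^ CARD('d) * (2 powr ((1 - \<alpha>) * real m)) ^ CARD('d) * W)"
      using nrm_pos[of "m + (q + 1)"] by (intro mult_left_mono) auto
    also have "\<dots> = 3 ^ CARD('d) * ((2 powr ((1 - \<alpha>) * real m)) ^ CARD('d) * nrm m) * (nrm (q + 1) * W)"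
      unfolding nrm_add[of m "q + 1"] by (simp only: mult_ac)
    also have "\<dots> = 3 ^ CARD('d) * (nrm (q + 1) * W)" by (simp only: nrm_inverse mult_1_right)
    also have "\<dots> \<le> 3 ^ CARD('d) * (nrm (q + 1) * (sqrt S / sqrt (2 ^ (q + 1)) * P))"
      using W nrm_pos[of "q + 1"] by (intro mult_left_mono) auto
    also have "\<dots> = 3 ^ CARD('d) * (sqrt S / sqrt (2 ^ (q + 1))) * (P * nrm (q + 1))"
      by (simp only: mult_ac)
    also have "P * nrm (q + 1) = 1" unfolding P_def by (rule nrm_inverse)
    finally show "nrm (m + (q + 1)) * (\<Sum>u\<in>?Bd. real (card (support \<inter> cube m u)))
      \<le> 3 ^ CARD('d) * sqrt (real CARD('d) / (1 - 2 * \<alpha>) ^ CARD('d)) / sqrt (2 ^ (q + 1))"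
      by (simp add: S_def)
  qed
qed

text \<open>The order of choices: \<open>q\<close> makes the boundary term small, then
  \<open>m\<close> has to be large for the finitely many translates \<open>u\<close> belonging to
  this \<open>q\<close>, and finally \<open>N\<close> is large enough to force such an
  \<open>m\<close>.\<close>

lemma enum_average_tendsto_0:
  assumes a: "norm_ordered_enumeration a support"
    and \<phi>: "\<And>n. \<bar>\<phi> n\<bar> \<le> B"
    and cubes: "\<And>u. (\<And>i. 0 \<le> u $ i) \<Longrightarrow>
      (\<lambda>m. nrm m * (\<Sum>n\<in>cube m u. (\<Prod>i\<in>UNIV. X i (n $ i)) * \<phi> n)) \<longlonglongrightarrow> 0"
  shows "(\<lambda>N. (\<Sum>k=1..N. \<phi> (a k)) / real N) \<longlonglongrightarrow> 0"
proof (rule LIMSEQ_I)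
  fix e :: real assume e: "e > 0"
  have B0: "B \<ge> 0" using \<phi>[of 0] by linarith
  obtain c where c: "c > 0" "\<And>N j. N \<ge> 1 \<Longrightarrow> 2 ^ j \<le> 2 * euclid_norm (a N) \<Longrightarrow> c \<le> real N * nrm j"
    using enum_count_ge[OF a] by blast
  define K where "K = 3 ^ CARD('d) * sqrt (real CARD('d) / (1 - 2 * \<alpha>) ^ CARD('d))"
  have K0: "K \<ge> 0" using \<alpha> by (simp add: K_def)
  obtain q where q: "B * (K / sqrt (2 ^ (q + 1))) < c * e / 2"
  proof -
    have "(\<lambda>q. B * (K * (1 / sqrt 2) ^ q)) \<longlonglongrightarrow> B * (K * 0)"
      by (intro tendsto_mult_left LIMSEQ_power_zero) auto
    moreover have "B * (K * 0) < c * e / 2" using c(1) e by simp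
    ultimately have "eventually (\<lambda>q. B * (K * (1 / sqrt 2) ^ q) < c * e / 2) sequentially"
      by (rule order_tendstoD(2))
    then obtain q where "\<forall>p\<ge>q. B * (K * (1 / sqrt 2) ^ p) < c * e / 2"
      unfolding eventually_sequentially by blast
    then have "B * (K * (1 / sqrt 2) ^ (q + 1)) < c * e / 2" by (meson le_add1)
    then show ?thesis by (intro that[of q]) (simp add: real_sqrt_power power_divide real_sqrt_mult)
  qed
  let ?U = "vbox (\<lambda>_. {0..<2 ^ (q + 1)}) :: (int ^ 'd) set"
  let ?S = "\<lambda>m u. \<Sum>n\<in>cube m u. (\<Prod>i\<in>UNIV. X i (n $ i)) * \<phi> n"
  have "(\<lambda>m. \<Sum>u\<in>?U. \<bar>nrm m * ?S m u\<bar>) \<longlonglongrightarrow> (\<Sum>u\<in>?U. 0)"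
    by (intro tendsto_sum tendsto_rabs_zero cubes) auto
  then have "eventually (\<lambda>m. (\<Sum>u\<in>?U. \<bar>nrm m * ?S m u\<bar>) < c * e / 2) sequentially"
    by (rule order_tendstoD(2)) (use c(1) e in simp)
  then obtain m1 where m1: "\<And>m. m \<ge> m1 \<Longrightarrow> (\<Sum>u\<in>?U. \<bar>nrm m * ?S m u\<bar>) < c * e / 2"
    by (auto simp: eventually_sequentially)
  obtain m0 where m0: "\<And>m r. m \<ge> m0 \<Longrightarrow>
    nrm (m + (q + 1)) * (\<Sum>u\<in>boundary_cubes q r. real (card (support \<inter> cube m u))) \<le> K / sqrt (2 ^ (q + 1))"
    unfolding K_def using boundary_count_le[of q] by blast
  define m2 where "m2 = max m0 m1"
  obtain N0 where N0: "\<And>N. N \<ge> N0 \<Longrightarrow> 2 ^ (m2 + q) < euclid_norm (a N)"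
    using enum_norm_unbounded[OF a] by blast
  show "\<exists>no. \<forall>N\<ge>no. norm ((\<Sum>k=1..N. \<phi> (a k)) / real N - 0) < e"
  proof (intro exI allI impI)
    fix N assume "N \<ge> max 1 N0"
    then have N: "N \<ge> 1" "N \<ge> N0" by auto
    have "(2::real) ^ m2 \<le> euclid_norm (a N) / 2 ^ q"
      using N0[OF N(2)] by (simp add: power_add field_simps)
    moreover have "(1::real) \<le> 2 ^ m2" by simp
    ultimately have "1 \<le> euclid_norm (a N) / 2 ^ q" by linarith
    \<comment> \<open>\<open>m\<close> is adapted to \<open>N\<close>: the ball has a radius between
      \<open>2 ^ (m + q)\<close> and \<open>2 ^ (m + q + 1)\<close>.\<close>
    then obtain m where m: "2 ^ m \<le> euclid_norm (a N) / 2 ^ q" "euclid_norm (a N) / 2 ^ q < 2 ^ (m + 1)"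
      by (rule dyadic_bracket)
    have "(2::real) ^ m2 < 2 ^ (m + 1)" using \<open>2 ^ m2 \<le> euclid_norm (a N) / 2 ^ q\<close> m(2) by linarith
    then have "m2 < m + 1" by (simp only: power_strict_increasing_iff one_less_numeral_iff semiring_norm)
    then have mm: "m \<ge> m0" "m \<ge> m1" by (auto simp: m2_def)
    have R: "euclid_norm (a N) < 2 ^ (m + q + 1)" using m(2) by (simp add: power_add field_simps)
    have R': "2 ^ (m + (q + 1)) \<le> 2 * euclid_norm (a N)" using m(1) by (simp add: power_add field_simps)
    define \<nu> where "\<nu> = nrm (m + (q + 1))"
    have \<nu>: "\<nu> > 0" unfolding \<nu>_def by (rule nrm_pos)
    have cN: "c \<le> real N * \<nu>" unfolding \<nu>_def by (rule c(2)[OF N(1) R'])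
    have "\<nu> * \<bar>\<Sum>k=1..N. \<phi> (a k)\<bar> \<le> \<nu> * ((\<Sum>u\<in>?U. \<bar>?S m u\<bar>)
      + B * (\<Sum>u\<in>boundary_cubes q (euclid_norm (a N) / 2 ^ m). real (card (support \<inter> cube m u))))"
      using \<nu> by (intro mult_left_mono enum_sum_cubes_le a N R \<phi>) auto
    also have "\<dots> = (\<Sum>u\<in>?U. \<nu> * \<bar>?S m u\<bar>)
      + B * (\<nu> * (\<Sum>u\<in>boundary_cubes q (euclid_norm (a N) / 2 ^ m). real (card (support \<inter> cube m u))))"
      by (simp add: distrib_left sum_distrib_left mult_ac)
    also have "\<dots> \<le> (\<Sum>u\<in>?U. \<bar>nrm m * ?S m u\<bar>) + B * (K / sqrt (2 ^ (q + 1)))"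
    proof (intro add_mono sum_mono mult_left_mono B0)
      fix u
      have "\<nu> \<le> nrm m * 1" unfolding \<nu>_def nrm_add[of m "q + 1"] using nrm_pos[of m] nrm_le_1[of "q + 1"]
        by (intro mult_left_mono) auto
      then show "\<nu> * \<bar>?S m u\<bar> \<le> \<bar>nrm m * ?S m u\<bar>"
        using nrm_pos[of m] by (simp add: abs_mult mult_right_mono)
      show "\<nu> * (\<Sum>u\<in>boundary_cubes q (euclid_norm (a N) / 2 ^ m). real (card (support \<inter> cube m u)))
        \<le> K / sqrt (2 ^ (q + 1))" unfolding \<nu>_def by (rule m0[OF mm(1)])
    qed
    also have "\<dots> < c * e" using m1[OF mm(2)] q by linarith
    also have "\<dots> \<le> (real N * \<nu>) * e" using cN e by (intro mult_right_mono) auto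
    finally have "\<nu> * \<bar>\<Sum>k=1..N. \<phi> (a k)\<bar> < \<nu> * (real N * e)" by (simp add: mult_ac)
    then have "\<bar>\<Sum>k=1..N. \<phi> (a k)\<bar> < real N * e" using \<nu> by (simp only: mult_less_cancel_left_pos)
    then show "norm ((\<Sum>k=1..N. \<phi> (a k)) / real N - 0) < e" using N by (simp add: field_simps)
  qed
qed

end

context sparse_action
begin

text \<open>The first \<open>N\<close> points lie in a dyadic box of side at most twice
  \<open>euclid_norm (a N)\<close>, while \<open>N\<close> is at least a fixed multiple of 1 /
  \<open>nrm\<close> for that box. For nonnegative \<open>f\<close> the average is then at most a
  constant times \<open>samp_avg\<close>.\<close>

theorem enum_maximal:
  assumes a: "norm_ordered_enumeration a support"
  obtains c where "c > 0"
    "\<And>f t. integrable M f \<Longrightarrow> (\<And>x. f x \<ge> 0) \<Longrightarrow> t > 0 \<Longrightarrow>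
       prob {x \<in> space M. \<exists>N\<ge>1. c * t < (\<Sum>k=1..N. f (T (a k) x)) / real N} \<le> c * (\<integral>x. f x \<partial>M) / t"
proof -
  obtain c0 where c0: "c0 > 0" "\<And>N j. N \<ge> 1 \<Longrightarrow> 2 ^ j \<le> 2 * euclid_norm (a N) \<Longrightarrow> c0 \<le> real N * nrm j"
    using enum_count_ge[OF a] by blast
  obtain c1 where c1: "c1 > 0" "\<And>f t. integrable M f \<Longrightarrow> (\<And>x. f x \<ge> 0) \<Longrightarrow> t > 0 \<Longrightarrow>
       prob {x \<in> space M. \<exists>j. c1 * t < samp_avg j f x} \<le> c1 * (\<integral>x. f x \<partial>M) / t"
    using samp_maximal by blast
  define c where "c = c1 / c0 + c1"
  have c: "c > 0" using c0 c1 by (simp add: c_def add_pos_pos)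
  show ?thesis
  proof (rule that[OF c])
    fix f :: "'x \<Rightarrow> real" and t :: real
    assume f: "integrable M f" "\<And>x. f x \<ge> 0" and t: "t > 0"
    have [measurable]: "f \<in> borel_measurable M" using f by simp
    have le: "\<exists>j. (\<Sum>k=1..N. f (T (a k) x)) / real N \<le> samp_avg j f x / c0" if N: "N \<ge> 1" for N x
    proof -
      have "1 \<le> \<bar>real_of_int (a N $ i)\<bar>" for i
        using support_pos[OF enum_mem[OF a N], of i] by linarith
      then have "1 \<le> euclid_norm (a N)"
        using abs_component_le_euclid_norm[of "a N"] order_trans by blast
      then obtain j where j: "2 ^ j \<le> euclid_norm (a N)" "euclid_norm (a N) < 2 ^ (j + 1)"
        by (rule dyadic_bracket)
      let ?B = "vbox (\<lambda>_. {0<..2 ^ (j + 1)}) :: (int ^ 'd) set"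
      have sub: "a ` {1..N} \<subseteq> support \<inter> ?B"
      proof (rule image_subsetI)
        fix k assume k: "k \<in> {1..N}"
        have s: "a k \<in> support" using k enum_mem[OF a] by simp
        have "0 < a k $ i \<and> a k $ i \<le> 2 ^ (j + 1)" for i
        proof
          show "0 < a k $ i" using support_pos[OF s, of i] by linarith
          have "real_of_int (a k $ i) \<le> euclid_norm (a k)"
            using abs_component_le_euclid_norm[of "a k" i] by linarith
          also have "\<dots> \<le> euclid_norm (a N)" using k enum_norm_mono[OF a] by simp
          also have "\<dots> \<le> real_of_int (2 ^ (j + 1))" using j(2) by simp
          finally show "a k $ i \<le> 2 ^ (j + 1)" by (simp only: of_int_le_iff)
        qed
        then show "a k \<in> support \<inter> ?B" using s by simp
      qed
      have "(\<Sum>k=1..N. f (T (a k) x)) = (\<Sum>n\<in>a ` {1..N}. f (T n x))"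
        using enum_inj[OF a] by (subst sum.reindex) (auto intro: inj_on_subset)
      also have "\<dots> \<le> (\<Sum>n\<in>support \<inter> ?B. f (T n x))"
        using sub f by (intro sum_mono2) auto
      also have "\<dots> = samp_avg (j + 1) f x / nrm (j + 1)"
        unfolding samp_avg_def using nrm_pos[of "j + 1"]
        by (subst sum_support_vbox) (auto simp: less_le)
      finally have 1: "(\<Sum>k=1..N. f (T (a k) x)) \<le> samp_avg (j + 1) f x / nrm (j + 1)" .
      have s0: "samp_avg (j + 1) f x \<ge> 0"
        unfolding samp_avg_def using nrm_pos[of "j + 1"] f
        by (intro mult_nonneg_nonneg sum_nonneg prod_nonneg X_nonneg) (auto simp: int_one_le_iff_zero_less)
      have "c0 \<le> real N * nrm (j + 1)" using j by (intro c0(2) N) simp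
      then have "samp_avg (j + 1) f x / (real N * nrm (j + 1)) \<le> samp_avg (j + 1) f x / c0"
        using s0 c0 by (intro divide_left_mono) auto
      moreover have "(\<Sum>k=1..N. f (T (a k) x)) / real N \<le> samp_avg (j + 1) f x / (real N * nrm (j + 1))"
        using divide_right_mono[OF 1, of "real N"] by (simp add: mult.commute)
      ultimately show ?thesis by (intro exI[of _ "j + 1"]) linarith
    qed
    have "prob {x \<in> space M. \<exists>N\<ge>1. c * t < (\<Sum>k=1..N. f (T (a k) x)) / real N}
      \<le> prob {x \<in> space M. \<exists>j. c1 * t < samp_avg j f x}"
    proof (rule finite_measure_mono)
      show "{x \<in> space M. \<exists>N\<ge>1. c * t < (\<Sum>k=1..N. f (T (a k) x)) / real N}
        \<subseteq> {x \<in> space M. \<exists>j. c1 * t < samp_avg j f x}"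
      proof clarify
        fix x N assume "1 \<le> N" and *: "c * t < (\<Sum>k=1..N. f (T (a k) x)) / real N"
        then obtain j where "(\<Sum>k=1..N. f (T (a k) x)) / real N \<le> samp_avg j f x / c0" using le by blast
        then have "c * t < samp_avg j f x / c0" using * by linarith
        moreover have "c1 / c0 * t \<le> c * t" using t c1 by (intro mult_right_mono) (auto simp: c_def)
        ultimately have "c1 / c0 * t < samp_avg j f x / c0" by linarith
        then have "c1 * t < samp_avg j f x" using c0(1) by (simp add: field_simps)
        then show "\<exists>j. c1 * t < samp_avg j f x" by blast
      qed
    qed measurable
    also have "\<dots> \<le> c1 * (\<integral>x. f x \<partial>M) / t" by (rule c1(2)[OF f t])
    also have "\<dots> \<le> c * (\<integral>x. f x \<partial>M) / t"
      using c0 c1 f t by (intro divide_right_mono mult_right_mono) (auto simp: c_def)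
    finally show "prob {x \<in> space M. \<exists>N\<ge>1. c * t < (\<Sum>k=1..N. f (T (a k) x)) / real N}
      \<le> c * (\<integral>x. f x \<partial>M) / t" .
  qed
qed

end

section \<open>Approximation by null and invariant functions\<close>

lemma AE_summable_of_summable_integral:
  fixes f :: "nat \<Rightarrow> 'x \<Rightarrow> real"
  assumes f: "\<And>i. integrable M (f i)" "\<And>i x. f i x \<ge> 0"
    and s: "summable (\<lambda>i. \<integral>x. f i x \<partial>M)"
  shows "AE x in M. summable (\<lambda>i. f i x)"
proof -
  have [measurable]: "f i \<in> borel_measurable M" for i using f(1) by simp
  have "(\<integral>\<^sup>+x. (\<Sum>i. ennreal (f i x)) \<partial>M) = (\<Sum>i. \<integral>\<^sup>+x. ennreal (f i x) \<partial>M)"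
    by (rule nn_integral_suminf) measurable
  also have "\<dots> = (\<Sum>i. ennreal (\<integral>x. f i x \<partial>M))"
    using f by (intro suminf_cong nn_integral_eq_integral) auto
  also have "\<dots> = ennreal (\<Sum>i. \<integral>x. f i x \<partial>M)"
    using f s by (intro suminf_ennreal2) auto
  finally have "(\<integral>\<^sup>+x. (\<Sum>i. ennreal (f i x)) \<partial>M) \<noteq> \<infinity>" by simp
  then have "AE x in M. (\<Sum>i. ennreal (f i x)) \<noteq> \<infinity>"
    by (intro nn_integral_noteq_infinite) measurable
  then show ?thesis
    by (rule AE_mp) (use f in \<open>auto intro!: AE_I2 summable_suminf_not_top\<close>)
qed

context mp_action
begin

lemma integrable_bounded:
  fixes f :: "'x \<Rightarrow> real"
  assumes "f \<in> borel_measurable M" "\<And>x. \<bar>f x\<bar> \<le> B"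
  shows "integrable M f"
  using assms by (intro integrable_const_bound[where B = B]) auto

text \<open>Cauchy-Schwarz on a probability space, in the form that a variance is
  nonnegative.\<close>

lemma integral_abs_le_sqrt:
  fixes f :: "'x \<Rightarrow> real"
  assumes f [measurable]: "f \<in> borel_measurable M" and B: "\<And>x. \<bar>f x\<bar> \<le> B" and d: "(\<integral>x. (f x)\<^sup>2 \<partial>M) \<le> d\<^sup>2" "d \<ge> 0"
  shows "(\<integral>x. \<bar>f x\<bar> \<partial>M) \<le> d"
proof -
  have i1: "integrable M (\<lambda>x. \<bar>f x\<bar>)" using B by (intro integrable_bounded[where B = B]) auto
  have "\<bar>(\<bar>f x\<bar>)\<^sup>2\<bar> \<le> B\<^sup>2" for x
    using power_mono[OF B[of x], of 2] by simp
  then have i2: "integrable M (\<lambda>x. (\<bar>f x\<bar>)\<^sup>2)" by (intro integrable_bounded[where B = "B\<^sup>2"]) auto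
  have "0 \<le> variance (\<lambda>x. \<bar>f x\<bar>)" by simp
  also have "\<dots> = (\<integral>x. (\<bar>f x\<bar>)\<^sup>2 \<partial>M) - (\<integral>x. \<bar>f x\<bar> \<partial>M)\<^sup>2" by (rule variance_eq[OF i1 i2])
  finally have "(\<integral>x. \<bar>f x\<bar> \<partial>M)\<^sup>2 \<le> (\<integral>x. (\<bar>f x\<bar>)\<^sup>2 \<partial>M)" by linarith
  also have "\<dots> \<le> d\<^sup>2" using d(1) by (simp only: power2_abs)
  finally show ?thesis using d(2) by (rule power2_le_imp_le)
qed

definition bounded_measurable :: "('x \<Rightarrow> real) \<Rightarrow> bool" where
  "bounded_measurable f \<longleftrightarrow> f \<in> borel_measurable M \<and> (\<exists>B. \<forall>x. \<bar>f x\<bar> \<le> B)"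

lemma bounded_measurable_add:
  assumes "bounded_measurable f" "bounded_measurable g"
  shows "bounded_measurable (\<lambda>x. f x + g x)"
proof -
  from assms obtain A B where "\<And>x. \<bar>f x\<bar> \<le> A" "\<And>x. \<bar>g x\<bar> \<le> B" by (auto simp: bounded_measurable_def)
  then have "\<bar>f x + g x\<bar> \<le> A + B" for x by (meson abs_triangle_ineq add_mono order_trans)
  then show ?thesis using assms by (auto simp: bounded_measurable_def)
qed

lemma bounded_measurable_scale:
  assumes "bounded_measurable f"
  shows "bounded_measurable (\<lambda>x. c * f x)"
proof -
  from assms obtain A where "\<And>x. \<bar>f x\<bar> \<le> A" by (auto simp: bounded_measurable_def)
  then have "\<bar>c * f x\<bar> \<le> \<bar>c\<bar> * A" for x by (simp add: abs_mult mult_left_mono)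
  then show ?thesis using assms by (auto simp: bounded_measurable_def)
qed

lemma bounded_measurable_diff:
  assumes "bounded_measurable f" "bounded_measurable g"
  shows "bounded_measurable (\<lambda>x. f x - g x)"
  using bounded_measurable_add[OF assms(1) bounded_measurable_scale[OF assms(2), of "-1"]] by simp

lemma bounded_measurable_T:
  assumes "bounded_measurable f"
  shows "bounded_measurable (\<lambda>x. f (T n x))"
  using assms by (auto simp: bounded_measurable_def)

lemma bounded_measurable_imp_integrable:
  assumes "bounded_measurable f"
  shows "integrable M f"
  using assms by (auto simp: bounded_measurable_def intro: integrable_bounded)

lemma bounded_measurable_square:
  assumes "bounded_measurable f"
  shows "bounded_measurable (\<lambda>x. (f x)\<^sup>2)"
proof -
  from assms obtain A where A: "\<And>x. \<bar>f x\<bar> \<le> A" by (auto simp: bounded_measurable_def)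
  have "\<bar>(f x)\<^sup>2\<bar> \<le> A\<^sup>2" for x using power_mono[OF A[of x], of 2] by simp
  then show ?thesis using assms by (auto simp: bounded_measurable_def)
qed

text \<open>
  The invariant part is the limit of a minimising sequence for the distance of \<open>f\<close> from the null
  functions. By the parallelogram identity such a sequence is Cauchy, and since the set of
  differences is stable under the action, its limit is invariant.
\<close>

lemma mean_ergodic_decomposition:
  fixes \<N> :: "('x \<Rightarrow> real) set"
  assumes bm: "\<And>h. h \<in> \<N> \<Longrightarrow> bounded_measurable h"
    and add: "\<And>h h'. h \<in> \<N> \<Longrightarrow> h' \<in> \<N> \<Longrightarrow> (\<lambda>x. h x + h' x) \<in> \<N>"
    and scale: "\<And>h c. h \<in> \<N> \<Longrightarrow> (\<lambda>x. c * h x) \<in> \<N>"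
    and cob: "\<And>g n. n \<in> G \<Longrightarrow> bounded_measurable g \<Longrightarrow> (\<lambda>x. g (T n x) - g x) \<in> \<N>"
    and ne: "\<N> \<noteq> {}"
    and f: "bounded_measurable f" and e: "e > 0"
  obtains h F where "h \<in> \<N>" "integrable M F" "\<And>n. n \<in> G \<Longrightarrow> AE x in M. F (T n x) = F x"
    "(\<integral>x. \<bar>f x - h x - F x\<bar> \<partial>M) < e"
proof -
  define E where "E = (\<lambda>h. \<integral>x. (f x - h x)\<^sup>2 \<partial>M)"
  have fh: "bounded_measurable (\<lambda>x. f x - h x)" if "h \<in> \<N>" for h
    by (intro bounded_measurable_diff f bm that)
  have E0: "E h \<ge> 0" for h unfolding E_def by simp
  define \<delta> where "\<delta> = Inf (E ` \<N>)"
  have bdd: "bdd_below (E ` \<N>)" by (rule bdd_belowI[of _ 0]) (auto simp: E0)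
  have \<delta>_le: "\<delta> \<le> E h" if "h \<in> \<N>" for h unfolding \<delta>_def using that bdd by (intro cInf_lower) auto
  have close: "(\<integral>x. \<bar>h x - h' x\<bar> \<partial>M) \<le> 2 * \<eta>"
    if h: "h \<in> \<N>" "h' \<in> \<N>" "E h \<le> \<delta> + \<eta>\<^sup>2" "E h' \<le> \<delta> + \<eta>\<^sup>2" "\<eta> \<ge> 0" for h h' \<eta>
  proof -
    have mid: "(\<lambda>x. 1/2 * (h x + h' x)) \<in> \<N>" by (intro scale add h)
    have i: "integrable M (\<lambda>x. (f x - h x)\<^sup>2)" "integrable M (\<lambda>x. (f x - h' x)\<^sup>2)"
      "integrable M (\<lambda>x. (f x - 1/2 * (h x + h' x))\<^sup>2)"
      by (intro bounded_measurable_imp_integrable bounded_measurable_square fh h mid)+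
    have "(\<integral>x. (h x - h' x)\<^sup>2 \<partial>M)
        = (\<integral>x. 2 * (f x - h x)\<^sup>2 + 2 * (f x - h' x)\<^sup>2 - 4 * (f x - 1/2 * (h x + h' x))\<^sup>2 \<partial>M)"
      by (intro Bochner_Integration.integral_cong refl) (simp add: power2_eq_square field_simps)
    also have "\<dots> = 2 * E h + 2 * E h' - 4 * E (\<lambda>x. 1/2 * (h x + h' x))"
      unfolding E_def using i by simp
    also have "\<dots> \<le> (2 * \<eta>)\<^sup>2"
      using \<delta>_le[OF mid] h(3,4) by (simp add: power2_eq_square)
    finally have sq: "(\<integral>x. (h x - h' x)\<^sup>2 \<partial>M) \<le> (2 * \<eta>)\<^sup>2" .
    have "bounded_measurable (\<lambda>x. h x - h' x)" by (intro bounded_measurable_diff bm h)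
    then obtain B where "(\<lambda>x. h x - h' x) \<in> borel_measurable M" "\<And>x. \<bar>h x - h' x\<bar> \<le> B"
      by (auto simp: bounded_measurable_def)
    then show ?thesis using sq h(5) by (intro integral_abs_le_sqrt[where B = B]) auto
  qed
  have "\<exists>h\<in>\<N>. E h < \<delta> + ((1/2) ^ m)\<^sup>2" for m :: nat
  proof -
    have "Inf (E ` \<N>) < \<delta> + ((1/2) ^ m)\<^sup>2" by (simp add: \<delta>_def)
    then show ?thesis using ne bdd by (subst (asm) cInf_less_iff) auto
  qed
  then obtain h where h: "\<And>m. h m \<in> \<N>" "\<And>m. E (h m) < \<delta> + ((1/2) ^ m)\<^sup>2" by metis
  have h_bm: "bounded_measurable (h m)" for m by (intro bm h)
  have h_meas [measurable]: "h m \<in> borel_measurable M" for m using h_bm by (auto simp: bounded_measurable_def)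
  have h_int: "integrable M (h m)" for m by (intro bounded_measurable_imp_integrable h_bm)
  have f_meas [measurable]: "f \<in> borel_measurable M" using f by (auto simp: bounded_measurable_def)
  have f_int: "integrable M f" by (intro bounded_measurable_imp_integrable f)
  \<comment> \<open>The gaps of the minimising sequence are summable in L^1, so the whole sequence
    converges almost everywhere, and \<open>2 * w\<close> dominates the differences from its
    limit.\<close>
  define D where "D = (\<lambda>k x. h (Suc k) x - h k x)"
  have D_int: "integrable M (D k)" for k unfolding D_def using h_int by simp
  have D_le: "(\<integral>x. \<bar>D k x\<bar> \<partial>M) \<le> 2 * (1/2) ^ k" for k
  proof -
    have "((1/2::real) ^ Suc k)\<^sup>2 \<le> ((1/2) ^ k)\<^sup>2" by (intro power_mono power_decreasing) auto
    then have "E (h (Suc k)) \<le> \<delta> + ((1/2) ^ k)\<^sup>2" using h(2)[of "Suc k"] by linarith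
    then show ?thesis unfolding D_def
      using h(2)[of k] by (intro close h(1)) auto
  qed
  have D_sum: "summable (\<lambda>k. \<integral>x. \<bar>D k x\<bar> \<partial>M)"
  proof (rule summable_comparison_test')
    show "summable (\<lambda>k. 2 * (1/2 :: real) ^ k)" by (intro summable_mult summable_geometric) simp
    show "norm (\<integral>x. \<bar>D k x\<bar> \<partial>M) \<le> 2 * (1/2) ^ k" if "k \<ge> 0" for k using D_le[of k] by simp
  qed
  have D_AE: "AE x in M. summable (\<lambda>k. \<bar>D k x\<bar>)"
    using D_sum by (intro AE_summable_of_summable_integral) (auto intro: D_int)
  define w where "w = (\<lambda>x. \<bar>h 0 x\<bar> + (\<Sum>k. \<bar>D k x\<bar>))"
  have w_int: "integrable M w" unfolding w_def
  proof (intro Bochner_Integration.integrable_add)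
    show "integrable M (\<lambda>x. \<Sum>k. \<bar>D k x\<bar>)"
      by (rule integrable_suminf) (use D_int D_AE D_sum in auto)
  qed (use h_int in auto)
  define H where "H = (\<lambda>x. h 0 x + (\<Sum>k. D k x))"
  have H_int: "integrable M H" unfolding H_def
  proof (intro Bochner_Integration.integrable_add)
    show "integrable M (\<lambda>x. \<Sum>k. D k x)"
      by (rule integrable_suminf) (use D_int D_AE D_sum in auto)
  qed (use h_int in auto)
  have H_meas [measurable]: "H \<in> borel_measurable M" using H_int by simp
  have h_sum: "h m x = h 0 x + (\<Sum>k<m. D k x)" for m x
    unfolding D_def by (subst sum_lessThan_telescope) simp
  have conv: "AE x in M. (\<lambda>m. \<bar>H x - h m x\<bar>) \<longlonglongrightarrow> 0"
    using D_AE
  proof (rule AE_mp, intro AE_I2 impI)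
    fix x assume "summable (\<lambda>k. \<bar>D k x\<bar>)"
    then have "summable (\<lambda>k. D k x)" by (rule summable_rabs_cancel)
    then have "(\<lambda>m. \<Sum>k<m. D k x) \<longlonglongrightarrow> (\<Sum>k. D k x)" by (rule summable_LIMSEQ)
    then have "(\<lambda>m. h m x) \<longlonglongrightarrow> H x" unfolding H_def by (subst h_sum) (intro tendsto_intros)
    then show "(\<lambda>m. \<bar>H x - h m x\<bar>) \<longlonglongrightarrow> 0"
      using tendsto_rabs_zero[OF LIM_zero] by (simp add: abs_minus_commute)
  qed
  have dom: "AE x in M. norm \<bar>H x - h m x\<bar> \<le> 2 * w x" for m
    using D_AE
  proof (rule AE_mp, intro AE_I2 impI)
    fix x assume s: "summable (\<lambda>k. \<bar>D k x\<bar>)"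
    have "\<bar>\<Sum>k<m. D k x\<bar> \<le> (\<Sum>k<m. \<bar>D k x\<bar>)" by (rule sum_abs)
    also have "\<dots> \<le> (\<Sum>k. \<bar>D k x\<bar>)" by (rule sum_le_suminf[OF s]) auto
    finally have 1: "\<bar>h m x\<bar> \<le> w x" unfolding w_def using h_sum[of m x] by linarith
    have "\<bar>\<Sum>k. D k x\<bar> \<le> (\<Sum>k. \<bar>D k x\<bar>)" by (rule summable_rabs[OF s])
    then have "\<bar>H x\<bar> \<le> w x" unfolding w_def H_def by linarith
    then show "norm \<bar>H x - h m x\<bar> \<le> 2 * w x" using 1 by simp
  qed
  have lim: "(\<lambda>m. \<integral>x. \<bar>H x - h m x\<bar> \<partial>M) \<longlonglongrightarrow> (\<integral>x. 0 \<partial>M)"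
    by (rule integral_dominated_convergence[where w = "\<lambda>x. 2 * w x"]) (use w_int conv dom in auto)
  then have lim0: "(\<lambda>m. \<integral>x. \<bar>H x - h m x\<bar> \<partial>M) \<longlonglongrightarrow> 0" by simp
  define F where "F = (\<lambda>x. f x - H x)"
  have F_int: "integrable M F" unfolding F_def using f_int H_int by simp
  have F_meas [measurable]: "F \<in> borel_measurable M" using F_int by simp
  have inv: "AE x in M. F (T n x) = F x" if n: "n \<in> G" for n
  proof -
    have step: "(\<integral>x. \<bar>F (T n x) - F x\<bar> \<partial>M) \<le> 2 * (\<integral>x. \<bar>H x - h m x\<bar> \<partial>M) + 2 * (1/2) ^ m" for m
    proof -
      define c where "c = (\<lambda>x. f x - h m x)"
      have c_bm: "bounded_measurable c" unfolding c_def by (intro fh h)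
      have c_int: "integrable M c" by (intro bounded_measurable_imp_integrable c_bm)
      have c_meas [measurable]: "c \<in> borel_measurable M" using c_int by simp
      \<comment> \<open>Chosen so that \<open>f - h'\<close> is \<open>c\<close> composed with
        \<open>T n\<close>. By invariance of the measure \<open>h'\<close> is as near to
        \<open>f\<close> as \<open>h m\<close>, so \<open>close\<close> applies to the two.\<close>
      define h' where "h' = (\<lambda>x. h m x + (-1) * (c (T n x) - c x))"
      have h': "h' \<in> \<N>" unfolding h'_def by (intro add h scale cob n c_bm)
      have "E h' = (\<integral>x. (c (T n x))\<^sup>2 \<partial>M)" unfolding E_def h'_def c_def by simp
      also have "\<dots> = (\<integral>x. (c x)\<^sup>2 \<partial>M)" by (rule integral_T) measurable
      also have "\<dots> = E (h m)" by (simp add: E_def c_def)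
      finally have "E h' = E (h m)" .
      then have "(\<integral>x. \<bar>h m x - h' x\<bar> \<partial>M) \<le> 2 * (1/2) ^ m"
        using h(2)[of m] by (intro close h(1) h') auto
      then have 1: "(\<integral>x. \<bar>c (T n x) - c x\<bar> \<partial>M) \<le> 2 * (1/2) ^ m" by (simp add: h'_def)
      have Hh: "integrable M (\<lambda>x. \<bar>H x - h m x\<bar>)" using H_int h_int by simp
      have 2: "(\<integral>x. \<bar>H (T n x) - h m (T n x)\<bar> \<partial>M) = (\<integral>x. \<bar>H x - h m x\<bar> \<partial>M)"
        by (rule integral_T) measurable
      have i2: "integrable M (\<lambda>x. \<bar>H (T n x) - h m (T n x)\<bar>)" by (rule integrable_T[OF Hh])
      have i1: "integrable M (\<lambda>x. \<bar>c (T n x) - c x\<bar>)" using c_int integrable_T[OF c_int] by simp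
      have "(\<integral>x. \<bar>F (T n x) - F x\<bar> \<partial>M)
          \<le> (\<integral>x. \<bar>H (T n x) - h m (T n x)\<bar> + \<bar>c (T n x) - c x\<bar> + \<bar>H x - h m x\<bar> \<partial>M)"
        using i1 i2 Hh F_int integrable_T[OF F_int]
        by (intro integral_mono Bochner_Integration.integrable_add) (auto simp: F_def c_def)
      also have "\<dots> = (\<integral>x. \<bar>H (T n x) - h m (T n x)\<bar> \<partial>M) + (\<integral>x. \<bar>c (T n x) - c x\<bar> \<partial>M)
          + (\<integral>x. \<bar>H x - h m x\<bar> \<partial>M)"
        using i1 i2 Hh by simp
      finally show ?thesis using 1 2 by simp
    qed
    have "(\<lambda>m. 2 * (\<integral>x. \<bar>H x - h m x\<bar> \<partial>M) + 2 * (1/2) ^ m) \<longlonglongrightarrow> 2 * 0 + 2 * 0"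
      by (intro tendsto_intros lim0 LIMSEQ_power_zero) auto
    then have "(\<integral>x. \<bar>F (T n x) - F x\<bar> \<partial>M) \<le> 2 * 0 + 2 * 0"
      by (rule LIMSEQ_le_const) (use step in auto)
    moreover have "0 \<le> (\<integral>x. \<bar>F (T n x) - F x\<bar> \<partial>M)" by (rule Bochner_Integration.integral_nonneg) simp
    ultimately have "(\<integral>x. \<bar>F (T n x) - F x\<bar> \<partial>M) = 0" by linarith
    moreover have "integrable M (\<lambda>x. \<bar>F (T n x) - F x\<bar>)" using F_int integrable_T[OF F_int] by simp
    ultimately have "AE x in M. \<bar>F (T n x) - F x\<bar> = 0"
      by (subst (asm) integral_nonneg_eq_0_iff_AE) auto
    then show ?thesis by simp
  qed
  have "eventually (\<lambda>m. (\<integral>x. \<bar>H x - h m x\<bar> \<partial>M) < e) sequentially"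
    using order_tendstoD(2)[OF lim0 e] .
  then obtain m where m: "(\<integral>x. \<bar>H x - h m x\<bar> \<partial>M) < e" by (auto simp: eventually_sequentially)
  show ?thesis
  proof (rule that[OF h(1) F_int inv])
    show "(\<integral>x. \<bar>f x - h m x - F x\<bar> \<partial>M) < e" using m by (simp add: F_def)
  qed
qed

end

text \<open>The variation of a decreasing function cut off to an interval: the jump at the left end
  is \<open>w (a + 1)\<close>, and the decrease inside together with the jump at the right end adds
  the same amount.\<close>

lemma sum_abs_diff_decreasing_le:
  fixes w :: "int \<Rightarrow> real"
  assumes w: "\<And>n. a < n \<Longrightarrow> 0 \<le> w n \<and> w n \<le> 1" "\<And>n m. a < n \<Longrightarrow> n \<le> m \<Longrightarrow> w m \<le> w n"
    and ab: "a < b"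
  defines "v \<equiv> \<lambda>n. if n \<in> {a<..b} then w n else 0"
  shows "(\<Sum>n\<in>{a<..b + 1}. \<bar>v (n - 1) - v n\<bar>) \<le> 2"
proof -
  have tele: "(\<Sum>n\<in>{a + 1<..c}. \<bar>w (n - 1) - w n\<bar>) = w (a + 1) - w c" if "c \<ge> a + 1" for c
    using that
  proof (induction rule: int_ge_induct)
    case (step c)
    have "{a + 1<..c + 1} = insert (c + 1) {a + 1<..c}" using step.hyps by auto
    moreover have "w (c + 1) \<le> w c" using step.hyps by (intro w(2)) auto
    ultimately show ?case using step.IH by simp
  qed simp
  have "{a<..b + 1} = insert (a + 1) (insert (b + 1) {a + 1<..b})" using ab by auto
  then have "(\<Sum>n\<in>{a<..b + 1}. \<bar>v (n - 1) - v n\<bar>)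
      = \<bar>v a - v (a + 1)\<bar> + (\<bar>v b - v (b + 1)\<bar> + (\<Sum>n\<in>{a + 1<..b}. \<bar>v (n - 1) - v n\<bar>))"
    using ab by simp
  also have "(\<Sum>n\<in>{a + 1<..b}. \<bar>v (n - 1) - v n\<bar>) = (\<Sum>n\<in>{a + 1<..b}. \<bar>w (n - 1) - w n\<bar>)"
    by (intro sum.cong refl) (auto simp: v_def)
  also have "\<dots> = w (a + 1) - w b" using ab by (intro tele) auto
  also have "\<bar>v a - v (a + 1)\<bar> = w (a + 1)" using ab w(1)[of "a + 1"] by (simp add: v_def)
  also have "\<bar>v b - v (b + 1)\<bar> = w b" using ab w(1)[of b] by (simp add: v_def)
  finally show ?thesis using w(1)[of "a + 1"] by simp
qed

lemma wt_antimono: "\<alpha> \<ge> 0 \<Longrightarrow> 0 < n \<Longrightarrow> n \<le> m \<Longrightarrow> wt \<alpha> m \<le> wt \<alpha> n"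
  unfolding wt_def by (intro powr_mono2') auto

context sparse_set
begin

text \<open>Summation by parts moves the difference from \<open>G\<close> to the weights. In the
  direction \<open>i0\<close> their variation is at most 2, while in each other direction their sum
  is bounded by a multiple of 2^((1 - alpha) m). Since \<open>nrm m\<close> divides by this power in
  all directions, one power is gained.\<close>

lemma weighted_coboundary_sum_le:
  fixes G :: "int ^ 'd \<Rightarrow> real" and i0 :: 'd
  assumes G: "\<And>n. \<bar>G n\<bar> \<le> B" and u: "\<And>i. 0 \<le> u $ i"
  shows "\<bar>nrm m * (\<Sum>n\<in>cube m u. (\<Prod>i\<in>UNIV. wt \<alpha> (n $ i)) * (G (n + axis i0 1) - G n))\<bar>
    \<le> B * 2 ^ CARD('d) * 2 powr (- (1 - \<alpha>) * real m)"
proof -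
  define I where "I = (\<lambda>i. {2 ^ m * u $ i<..2 ^ m * (u $ i + 1)})"
  define e where "e = (axis i0 1 :: int ^ 'd)"
  define v where "v = (\<lambda>i n. if n \<in> I i then wt \<alpha> n else 0)"
  \<comment> \<open>One longer in the direction \<open>i0\<close>, so as to contain both the box and
    its translate by \<open>e\<close>.\<close>
  define I' where "I' = (\<lambda>i. if i = i0 then {2 ^ m * u $ i<..2 ^ m * (u $ i + 1) + 1} else I i)"
  define V where "V = (\<lambda>n::int ^ 'd. \<Prod>i\<in>UNIV. v i (n $ i))"
  define W where "W = (\<lambda>i n. if i = i0 then \<bar>v i (n - 1) - v i n\<bar> else v i n)"
  have B0: "B \<ge> 0" using G[of 0] by linarith
  have cube: "cube m u = vbox I" by (simp add: cube_def I_def)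
  have finI': "finite (I' i)" for i by (simp add: I'_def I_def)
  have sub: "vbox I \<subseteq> vbox I'" by (intro vbox_mono) (auto simp: I'_def I_def)
  have e_comp: "e $ i = (if i = i0 then 1 else 0)" for i by (simp add: e_def axis_def)
  have V_eq: "V n = (if n \<in> vbox I then (\<Prod>i\<in>UNIV. wt \<alpha> (n $ i)) else 0)" for n
    unfolding V_def v_def using prod_if_all[of "\<lambda>i. n $ i \<in> I i" "\<lambda>i. wt \<alpha> (n $ i)"] by simp
  have v0: "0 \<le> v i n" for i n by (simp add: v_def)
  have diff: "\<bar>V (n - e) - V n\<bar> = (\<Prod>i\<in>UNIV. W i (n $ i))" for n
  proof -
    have "V (n - e) = v i0 (n $ i0 - 1) * (\<Prod>i\<in>UNIV - {i0}. v i (n $ i))"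
      unfolding V_def by (subst prod.remove[of UNIV i0]) (auto simp: e_comp intro!: prod.cong)
    moreover have "V n = v i0 (n $ i0) * (\<Prod>i\<in>UNIV - {i0}. v i (n $ i))"
      unfolding V_def by (subst prod.remove[of UNIV i0]) auto
    moreover have "(\<Prod>i\<in>UNIV. W i (n $ i)) = \<bar>v i0 (n $ i0 - 1) - v i0 (n $ i0)\<bar> * (\<Prod>i\<in>UNIV - {i0}. v i (n $ i))"
      by (subst prod.remove[of UNIV i0]) (auto simp: W_def intro!: prod.cong)
    moreover have "0 \<le> (\<Prod>i\<in>UNIV - {i0}. v i (n $ i))" by (intro prod_nonneg v0)
    ultimately show ?thesis by (simp add: abs_mult left_diff_distrib[symmetric])
  qed
  have "(\<Sum>n\<in>cube m u. (\<Prod>i\<in>UNIV. wt \<alpha> (n $ i)) * G (n + e)) = (\<Sum>n\<in>vbox I. V n * G (n + e))"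
    unfolding cube by (intro sum.cong refl) (simp add: V_eq del: mem_vbox)
  also have "\<dots> = (\<Sum>n\<in>(\<lambda>n. n + e) ` vbox I. V (n - e) * G n)"
    by (subst sum.reindex) (auto simp: inj_on_def)
  also have "\<dots> = (\<Sum>n\<in>vbox I'. V (n - e) * G n)"
  proof (intro sum.mono_neutral_left ballI)
    show "(\<lambda>n. n + e) ` vbox I \<subseteq> vbox I'"
    proof (rule image_subsetI)
      fix n assume n: "n \<in> vbox I"
      have "(n + e) $ i \<in> I' i" for i
      proof -
        have "n $ i \<in> I i" using n by simp
        then show ?thesis by (auto simp: I'_def I_def e_comp)
      qed
      then show "n + e \<in> vbox I'" by simp
    qed
    fix n assume n: "n \<in> vbox I' - (\<lambda>n. n + e) ` vbox I"
    have "n - e \<notin> vbox I"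
    proof
      assume "n - e \<in> vbox I"
      then have "n - e + e \<in> (\<lambda>n. n + e) ` vbox I" by (rule imageI)
      then show False using n by simp
    qed
    then show "V (n - e) * G n = 0" unfolding V_eq by (simp only: if_False mult_zero_left)
  qed (use finI' in auto)
  finally have 1: "(\<Sum>n\<in>cube m u. (\<Prod>i\<in>UNIV. wt \<alpha> (n $ i)) * G (n + e)) = (\<Sum>n\<in>vbox I'. V (n - e) * G n)" .
  have "(\<Sum>n\<in>cube m u. (\<Prod>i\<in>UNIV. wt \<alpha> (n $ i)) * G n) = (\<Sum>n\<in>vbox I. V n * G n)"
    unfolding cube by (intro sum.cong refl) (simp add: V_eq del: mem_vbox)
  also have "\<dots> = (\<Sum>n\<in>vbox I'. V n * G n)"
    using sub finI' by (intro sum.mono_neutral_left) (auto simp: V_eq simp del: mem_vbox)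
  finally have 2: "(\<Sum>n\<in>cube m u. (\<Prod>i\<in>UNIV. wt \<alpha> (n $ i)) * G n) = (\<Sum>n\<in>vbox I'. V n * G n)" .
  have "(\<Sum>n\<in>cube m u. (\<Prod>i\<in>UNIV. wt \<alpha> (n $ i)) * (G (n + e) - G n)) = (\<Sum>n\<in>vbox I'. (V (n - e) - V n) * G n)"
    by (simp only: right_diff_distrib left_diff_distrib sum_subtractf 1 2)
  then have "\<bar>\<Sum>n\<in>cube m u. (\<Prod>i\<in>UNIV. wt \<alpha> (n $ i)) * (G (n + e) - G n)\<bar>
      \<le> (\<Sum>n\<in>vbox I'. \<bar>(V (n - e) - V n) * G n\<bar>)" by (simp only: sum_abs)
  also have "\<dots> \<le> (\<Sum>n\<in>vbox I'. B * (\<Prod>i\<in>UNIV. W i (n $ i)))"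
  proof (rule sum_mono)
    fix n
    have "\<bar>(V (n - e) - V n) * G n\<bar> = (\<Prod>i\<in>UNIV. W i (n $ i)) * \<bar>G n\<bar>"
      by (simp only: abs_mult diff)
    also have "\<dots> \<le> (\<Prod>i\<in>UNIV. W i (n $ i)) * B"
      by (intro mult_left_mono G prod_nonneg) (auto simp: W_def v0)
    finally show "\<bar>(V (n - e) - V n) * G n\<bar> \<le> B * (\<Prod>i\<in>UNIV. W i (n $ i))" by (simp add: mult.commute)
  qed
  also have "\<dots> = B * (\<Prod>i\<in>UNIV. \<Sum>n\<in>I' i. W i n)"
    unfolding sum_distrib_left[symmetric] by (subst sum_prod_vbox[where F = W, OF finI']) (rule refl)
  also have "(\<Prod>i\<in>UNIV. \<Sum>n\<in>I' i. W i n)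
      = (\<Sum>n\<in>I' i0. W i0 n) * (\<Prod>i\<in>UNIV - {i0}. \<Sum>n\<in>I' i. W i n)"
    by (rule prod.remove) auto
  also have "\<dots> \<le> 2 * (\<Prod>i\<in>UNIV - {i0}. 2 * 2 powr ((1 - \<alpha>) * real m))"
  proof (rule mult_mono)
    have "(\<Sum>n\<in>{2 ^ m * u $ i0<..2 ^ m * (u $ i0 + 1) + 1}. \<bar>v i0 (n - 1) - v i0 n\<bar>) \<le> 2"
      unfolding v_def I_def
    proof (rule sum_abs_diff_decreasing_le)
      have nn: "0 \<le> 2 ^ m * u $ i0" using u[of i0] by simp
      show "0 \<le> wt \<alpha> n \<and> wt \<alpha> n \<le> 1" if "2 ^ m * u $ i0 < n" for n
        using that nn wt_le_1[OF \<alpha>(1), of n] by simp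
      show "wt \<alpha> k \<le> wt \<alpha> n" if "2 ^ m * u $ i0 < n" "n \<le> k" for n k
        using that nn \<alpha>(1) by (intro wt_antimono) auto
    qed (simp add: distrib_left)
    then show "(\<Sum>n\<in>I' i0. W i0 n) \<le> 2" by (simp add: I'_def W_def)
    show "(\<Prod>i\<in>UNIV - {i0}. \<Sum>n\<in>I' i. W i n) \<le> (\<Prod>i\<in>UNIV - {i0}. 2 * 2 powr ((1 - \<alpha>) * real m))"
    proof (intro prod_mono conjI)
      fix i assume i: "i \<in> UNIV - {i0}"
      then have eq: "(\<Sum>n\<in>I' i. W i n) = (\<Sum>n\<in>I i. wt \<alpha> n)"
        by (intro sum.cong) (auto simp: I'_def W_def v_def)
      show "0 \<le> (\<Sum>n\<in>I' i. W i n)" unfolding eq by (intro sum_nonneg) auto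
      have "(\<Sum>n\<in>I i. wt \<alpha> n) \<le> 2 * wt \<alpha> (u $ i + 1) * 2 powr ((1 - \<alpha>) * real m)"
        unfolding I_def by (rule sum_wt_shell_le[OF u])
      also have "\<dots> \<le> 2 * 1 * 2 powr ((1 - \<alpha>) * real m)"
        using u[of i] \<alpha> by (intro mult_right_mono mult_left_mono wt_le_1) auto
      finally show "(\<Sum>n\<in>I' i. W i n) \<le> 2 * 2 powr ((1 - \<alpha>) * real m)" unfolding eq by simp
    qed
  qed (auto intro!: prod_nonneg sum_nonneg simp: W_def v0)
  also have "\<dots> = 2 * (2 * 2 powr ((1 - \<alpha>) * real m)) ^ (CARD('d) - 1)"
    by (simp add: card_Diff_singleton)
  finally have 3: "\<bar>\<Sum>n\<in>cube m u. (\<Prod>i\<in>UNIV. wt \<alpha> (n $ i)) * (G (n + e) - G n)\<bar>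
      \<le> B * (2 * (2 * 2 powr ((1 - \<alpha>) * real m)) ^ (CARD('d) - 1))"
    using B0 by (simp add: mult_left_mono)
  obtain d' where d': "CARD('d) = Suc d'" using zero_less_card_finite[where 'a = 'd] gr0_implies_Suc by blast
  have inv: "2 powr (- (1 - \<alpha>) * real m) * 2 powr ((1 - \<alpha>) * real m) = (1::real)"
    unfolding powr_add[symmetric] by (simp add: algebra_simps)
  have "\<bar>nrm m * (\<Sum>n\<in>cube m u. (\<Prod>i\<in>UNIV. wt \<alpha> (n $ i)) * (G (n + e) - G n))\<bar>
      \<le> nrm m * (B * (2 * (2 * 2 powr ((1 - \<alpha>) * real m)) ^ (CARD('d) - 1)))"
    unfolding abs_mult using 3 nrm_pos[of m] by (simp add: mult_left_mono)
  also have "\<dots> = B * 2 ^ CARD('d) * 2 powr (- (1 - \<alpha>) * real m) *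
      (2 powr (- (1 - \<alpha>) * real m) * 2 powr ((1 - \<alpha>) * real m)) ^ d'"
    unfolding nrm_def d' power_mult_distrib by (simp add: mult_ac)
  also have "\<dots> = B * 2 ^ CARD('d) * 2 powr (- (1 - \<alpha>) * real m)" unfolding inv by simp
  finally show ?thesis unfolding e_def .
qed

end

section \<open>Functions with vanishing averages over cubes\<close>

context sparse_action
begin

text \<open>A condition on a single point, because the passage from cubes to the enumeration is
  deterministic.\<close>

definition cubes_vanish :: "('x \<Rightarrow> real) \<Rightarrow> 'x \<Rightarrow> bool" where
  "cubes_vanish h x \<longleftrightarrow> (\<forall>u. (\<forall>i. 0 \<le> u $ i) \<longrightarrow>
     (\<lambda>m. nrm m * (\<Sum>n\<in>cube m u. (\<Prod>i\<in>UNIV. X i (n $ i)) * h (T n x))) \<longlonglongrightarrow> 0)"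

definition null_functions :: "('x \<Rightarrow> real) set" where
  "null_functions = {h. bounded_measurable h \<and> (AE x in M. cubes_vanish h x)}"

text \<open>The mean squares decay geometrically in \<open>m\<close>, so the squares are summable
  almost everywhere.\<close>

lemma fluct_cube_tendsto_0:
  assumes h: "bounded_measurable h" and u: "\<And>i. 0 \<le> u $ i"
  shows "AE x in M. (\<lambda>m. nrm m * (\<Sum>n\<in>cube m u. fluct n * h (T n x))) \<longlonglongrightarrow> 0"
proof -
  from h obtain D where D: "\<And>x. \<bar>h x\<bar> \<le> D" and [measurable]: "h \<in> borel_measurable M"
    by (auto simp: bounded_measurable_def)
  define \<Phi> where "\<Phi> = (\<lambda>m x. nrm m * (\<Sum>n\<in>cube m u. fluct n * h (T n x)))"
  have [measurable]: "\<Phi> m \<in> borel_measurable M" for m unfolding \<Phi>_def by measurable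
  \<comment> \<open>The translated cube lies in the box of side \<open>2 ^ (m + q)\<close>, where
    the mean square bound applies; the different normalisation costs the constant
    \<open>nrm q\<close>.\<close>
  obtain q where q: "\<And>i. u $ i + 1 \<le> 2 ^ q"
  proof -
    have "(1::real) < 2" by simp
    from real_arch_pow[OF this, of "real (nat (Max (range (\<lambda>i. u $ i)) + 1))"]
    obtain q where q: "real (nat (Max (range (\<lambda>i. u $ i)) + 1)) < 2 ^ q" by blast
    have "u $ i + 1 \<le> 2 ^ q" for i
    proof -
      have "u $ i \<le> Max (range (\<lambda>i. u $ i))" by (intro Max_ge) auto
      then have "real_of_int (u $ i + 1) \<le> real (nat (Max (range (\<lambda>i. u $ i)) + 1))" by linarith
      then have "real_of_int (u $ i + 1) \<le> 2 ^ q" using q by linarith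
      then have "real_of_int (u $ i + 1) \<le> real_of_int (2 ^ q)" by simp
      then show ?thesis by (simp only: of_int_le_iff)
    qed
    then show ?thesis by (rule that)
  qed
  define A where "A = K2 * 6 ^ CARD('d) * D\<^sup>2 / (nrm q)\<^sup>2"
  define \<theta> where "\<theta> = 2 powr (- ((1 - 2 * \<alpha>) / 4))"
  have "\<theta> < 2 powr 0" unfolding \<theta>_def using \<alpha> by (intro powr_less_mono) auto
  then have \<theta>: "0 < \<theta>" "\<theta> < 1" by (simp_all add: \<theta>_def)
  have A0: "A \<ge> 0" unfolding A_def using K2_nonneg by simp
  have bound: "(\<integral>x. (\<Phi> m x)\<^sup>2 \<partial>M) \<le> A * \<theta> ^ m" for m
  proof -
    have le: "2 ^ m * (u $ i + 1) \<le> 2 ^ (m + q)" for i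
      using q[of i] by (simp add: power_add)
    have sq: "(\<integral>x. (nrm (m + q) * (\<Sum>n\<in>cube m u. fluct n * h (T n x)))\<^sup>2 \<partial>M)
      \<le> K2 * 6 ^ CARD('d) * D\<^sup>2 * 2 powr (- ((1 - 2 * \<alpha>) / 4) * real (m + q))"
      unfolding nrm_def cube_def using u le D by (intro integral_fluct_sq_bounded) auto
    have "(nrm q)\<^sup>2 * (\<integral>x. (\<Phi> m x)\<^sup>2 \<partial>M) = (\<integral>x. (nrm (m + q) * (\<Sum>n\<in>cube m u. fluct n * h (T n x)))\<^sup>2 \<partial>M)"
      unfolding \<Phi>_def nrm_add[of m q] by (simp add: power_mult_distrib mult_ac)
    also note sq
    also have "2 powr (- ((1 - 2 * \<alpha>) / 4) * real (m + q)) = \<theta> ^ (m + q)"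
      unfolding \<theta>_def by (simp only: powr_power powr_realpow) (simp add: mult.commute)
    also have "\<theta> ^ (m + q) \<le> \<theta> ^ m" using \<theta> by (intro power_decreasing) auto
    finally have "(nrm q)\<^sup>2 * (\<integral>x. (\<Phi> m x)\<^sup>2 \<partial>M) \<le> K2 * 6 ^ CARD('d) * D\<^sup>2 * \<theta> ^ m"
      using K2_nonneg by (simp add: mult_left_mono)
    then show ?thesis unfolding A_def using nrm_pos[of q] by (simp add: field_simps)
  qed
  have bm: "bounded_measurable (\<Phi> m)" for m
  proof -
    have "\<bar>\<Phi> m x\<bar> \<le> nrm m * (\<Sum>n\<in>cube m u. \<bar>fluct n\<bar> * D)" for x
      unfolding \<Phi>_def abs_mult using nrm_pos[of m] D
      by (intro mult_mono order_trans[OF sum_abs] sum_mono) (auto simp: abs_mult intro!: mult_left_mono)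
    then show ?thesis by (auto simp: bounded_measurable_def)
  qed
  have "AE x in M. summable (\<lambda>m. (\<Phi> m x)\<^sup>2)"
  proof (rule AE_summable_of_summable_integral)
    show "integrable M (\<lambda>x. (\<Phi> m x)\<^sup>2)" for m
      by (intro bounded_measurable_imp_integrable bounded_measurable_square bm)
    show "summable (\<lambda>m. \<integral>x. (\<Phi> m x)\<^sup>2 \<partial>M)"
    proof (rule summable_comparison_test')
      show "summable (\<lambda>m. A * \<theta> ^ m)" using \<theta> by (intro summable_mult summable_geometric) auto
      show "norm (\<integral>x. (\<Phi> m x)\<^sup>2 \<partial>M) \<le> A * \<theta> ^ m" if "m \<ge> 0" for m using bound[of m] by simp
    qed
  qed auto
  then show ?thesis
  proof (rule AE_mp, intro AE_I2 impI)
    fix x assume "summable (\<lambda>m. (\<Phi> m x)\<^sup>2)"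
    then have "(\<lambda>m. (\<Phi> m x)\<^sup>2) \<longlonglongrightarrow> 0" by (rule summable_LIMSEQ_zero)
    then have "(\<lambda>m. sqrt ((\<Phi> m x)\<^sup>2)) \<longlonglongrightarrow> sqrt 0" by (rule tendsto_real_sqrt)
    then have "(\<lambda>m. \<bar>\<Phi> m x\<bar>) \<longlonglongrightarrow> 0" by simp
    then show "(\<lambda>m. nrm m * (\<Sum>n\<in>cube m u. fluct n * h (T n x))) \<longlonglongrightarrow> 0"
      unfolding \<Phi>_def by (rule tendsto_rabs_zero_cancel)
  qed
qed

lemma coboundary_null:
  assumes g: "bounded_measurable g"
  shows "(\<lambda>x. g (T (axis i0 1) x) - g x) \<in> null_functions"
proof -
  define h where "h = (\<lambda>x. g (T (axis i0 1) x) - g x)"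
  have h: "bounded_measurable h" unfolding h_def by (intro bounded_measurable_diff bounded_measurable_T g)
  from g obtain B where B: "\<And>x. \<bar>g x\<bar> \<le> B" by (auto simp: bounded_measurable_def)
  \<comment> \<open>There are countably many translates, so a single null set serves all of
    them.\<close>
  have "AE x in M. \<forall>u\<in>{u :: int ^ 'd. \<forall>i. 0 \<le> u $ i}.
      (\<lambda>m. nrm m * (\<Sum>n\<in>cube m u. fluct n * h (T n x))) \<longlonglongrightarrow> 0"
    using h by (subst AE_ball_countable) (auto intro!: fluct_cube_tendsto_0)
  then have "AE x in M. cubes_vanish h x"
  proof (rule AE_mp, intro AE_I2 impI)
    fix x assume x: "x \<in> space M" and *: "\<forall>u\<in>{u :: int ^ 'd. \<forall>i. 0 \<le> u $ i}.
      (\<lambda>m. nrm m * (\<Sum>n\<in>cube m u. fluct n * h (T n x))) \<longlonglongrightarrow> 0"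
    show "cubes_vanish h x"
      unfolding cubes_vanish_def
    proof (intro allI impI)
      fix u :: "int ^ 'd" assume u: "\<forall>i. 0 \<le> u $ i"
      define W where "W = (\<lambda>m. nrm m * (\<Sum>n\<in>cube m u. (\<Prod>i\<in>UNIV. wt \<alpha> (n $ i)) * h (T n x)))"
      have W_le: "\<bar>W m\<bar> \<le> B * 2 ^ CARD('d) * (2 powr (- (1 - \<alpha>))) ^ m" for m
      proof -
        have hT: "h (T n x) = g (T (n + axis i0 1) x) - g (T n x)" for n
          using x by (simp add: h_def T_T add.commute)
        have "(2::real) powr (- (1 - \<alpha>) * real m) = (2 powr (- (1 - \<alpha>))) ^ m"
          by (simp only: powr_power powr_realpow) (simp add: mult.commute)
        then show ?thesis
          using weighted_coboundary_sum_le[of "\<lambda>n. g (T n x)" B u m i0] B u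
          unfolding W_def hT by simp
      qed
      have "W \<longlonglongrightarrow> 0"
      proof (rule Lim_null_comparison)
        show "eventually (\<lambda>m. norm (W m) \<le> B * 2 ^ CARD('d) * (2 powr (- (1 - \<alpha>))) ^ m) sequentially"
          using W_le by simp
        have "(2::real) powr (- (1 - \<alpha>)) < 2 powr 0" using \<alpha> by (intro powr_less_mono) auto
        then have "(\<lambda>m. (2 powr (- (1 - \<alpha>))) ^ m) \<longlonglongrightarrow> (0::real)" by (intro LIMSEQ_power_zero) simp
        then show "(\<lambda>m. B * 2 ^ CARD('d) * (2 powr (- (1 - \<alpha>))) ^ m) \<longlonglongrightarrow> 0"
          by (rule tendsto_mult_right_zero)
      qed
      moreover have "(\<lambda>m. nrm m * (\<Sum>n\<in>cube m u. fluct n * h (T n x))) \<longlonglongrightarrow> 0" using * u by blast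
      ultimately have "(\<lambda>m. nrm m * (\<Sum>n\<in>cube m u. fluct n * h (T n x)) + W m) \<longlonglongrightarrow> 0 + 0"
        by (intro tendsto_add) auto
      moreover have "nrm m * (\<Sum>n\<in>cube m u. (\<Prod>i\<in>UNIV. X i (n $ i)) * h (T n x))
          = nrm m * (\<Sum>n\<in>cube m u. fluct n * h (T n x)) + W m" for m
        unfolding W_def fluct_def by (simp add: left_diff_distrib sum_subtractf right_diff_distrib)
      ultimately show "(\<lambda>m. nrm m * (\<Sum>n\<in>cube m u. (\<Prod>i\<in>UNIV. X i (n $ i)) * h (T n x))) \<longlonglongrightarrow> 0"
        by simp
    qed
  qed
  then show ?thesis using h by (simp add: null_functions_def h_def)
qed

lemma null_functions_add:
  assumes "h \<in> null_functions" "h' \<in> null_functions"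
  shows "(\<lambda>x. h x + h' x) \<in> null_functions"
proof -
  have "AE x in M. cubes_vanish h x" "AE x in M. cubes_vanish h' x"
    using assms by (auto simp: null_functions_def)
  then have "AE x in M. cubes_vanish (\<lambda>x. h x + h' x) x"
  proof eventually_elim
    case (elim x)
    show ?case unfolding cubes_vanish_def
    proof (intro allI impI)
      fix u :: "int ^ 'd" assume "\<forall>i. 0 \<le> u $ i"
      then have "(\<lambda>m. nrm m * (\<Sum>n\<in>cube m u. (\<Prod>i\<in>UNIV. X i (n $ i)) * h (T n x))
          + nrm m * (\<Sum>n\<in>cube m u. (\<Prod>i\<in>UNIV. X i (n $ i)) * h' (T n x))) \<longlonglongrightarrow> 0 + 0"
        using elim by (intro tendsto_add) (auto simp: cubes_vanish_def)
      then show "(\<lambda>m. nrm m * (\<Sum>n\<in>cube m u. (\<Prod>i\<in>UNIV. X i (n $ i)) * (h (T n x) + h' (T n x)))) \<longlonglongrightarrow> 0"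
        by (simp add: distrib_left sum.distrib)
    qed
  qed
  then show ?thesis using assms by (auto simp: null_functions_def intro: bounded_measurable_add)
qed

lemma null_functions_scale:
  assumes "h \<in> null_functions"
  shows "(\<lambda>x. c * h x) \<in> null_functions"
proof -
  have "AE x in M. cubes_vanish h x" using assms by (auto simp: null_functions_def)
  then have "AE x in M. cubes_vanish (\<lambda>x. c * h x) x"
  proof eventually_elim
    case (elim x)
    show ?case unfolding cubes_vanish_def
    proof (intro allI impI)
      fix u :: "int ^ 'd" assume "\<forall>i. 0 \<le> u $ i"
      then have "(\<lambda>m. c * (nrm m * (\<Sum>n\<in>cube m u. (\<Prod>i\<in>UNIV. X i (n $ i)) * h (T n x)))) \<longlonglongrightarrow> 0"
        using elim by (intro tendsto_mult_right_zero) (auto simp: cubes_vanish_def)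
      then show "(\<lambda>m. nrm m * (\<Sum>n\<in>cube m u. (\<Prod>i\<in>UNIV. X i (n $ i)) * (c * h (T n x)))) \<longlonglongrightarrow> 0"
        by (simp add: sum_distrib_left mult_ac)
    qed
  qed
  then show ?thesis using assms by (auto simp: null_functions_def intro: bounded_measurable_scale)
qed

lemma null_average_tendsto_0:
  assumes a: "norm_ordered_enumeration a support" and h: "h \<in> null_functions"
  shows "AE x in M. (\<lambda>N. (\<Sum>k=1..N. h (T (a k) x)) / real N) \<longlonglongrightarrow> 0"
proof -
  obtain B where B: "\<And>x. \<bar>h x\<bar> \<le> B" using h by (auto simp: null_functions_def bounded_measurable_def)
  have "AE x in M. cubes_vanish h x" using h by (simp add: null_functions_def)
  then show ?thesis
  proof eventually_elim
    case (elim x)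
    show ?case
      by (rule enum_average_tendsto_0[OF a, where \<phi> = "\<lambda>n. h (T n x)" and B = B])
        (use B elim in \<open>auto simp: cubes_vanish_def\<close>)
  qed
qed

end

section \<open>Convergence of the averages\<close>

context mp_action
begin

lemma invariant_add:
  assumes "AE x in M. F (T v x) = F x" "AE x in M. F (T w x) = F x"
  shows "AE x in M. F (T (v + w) x) = F x"
  using AE_T[OF assms(1), of w] assms(2) AE_space
proof eventually_elim
  case (elim x)
  then show ?case by (simp add: T_T)
qed

lemma invariant_nonneg:
  assumes inv: "\<And>i. AE x in M. F (T (axis i 1) x) = F x" and n: "\<And>i. 0 \<le> n $ i"
  shows "AE x in M. F (T n x) = F x"
proof -
  \<comment> \<open>\<open>T 0\<close> may differ from the identity. Almost everywhere
    \<open>F (T 0 x)\<close> and \<open>F x\<close> both equal the value of \<open>F\<close> at the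
    image of \<open>x\<close> under a unit vector.\<close>
  have zero: "AE x in M. F (T 0 x) = F x"
    using AE_T[OF inv[of undefined], of 0] inv[of undefined] AE_space
  proof eventually_elim
    case (elim x)
    then show ?case by (simp add: T_T)
  qed
  have ax: "AE x in M. F (T (axis i (int k)) x) = F x" for i k
  proof (induction k)
    case 0
    have axis_0: "axis i (int 0) = (0 :: int ^ 'd)" by (simp add: vec_eq_iff axis_def)
    show ?case unfolding axis_0 by (rule zero)
  next
    case (Suc k)
    have "axis i (int (Suc k)) = axis i (int k) + (axis i 1 :: int ^ 'd)" by (simp add: vec_eq_iff axis_def)
    then show ?case using invariant_add[OF Suc inv[of i]] by simp
  qed
  have "AE x in M. F (T (\<Sum>i\<in>A. axis i (n $ i)) x) = F x" if "finite A" for A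
    using that
  proof induction
    case empty
    then show ?case using zero by simp
  next
    case (insert i A)
    have "AE x in M. F (T (axis i (n $ i)) x) = F x" using ax[of i "nat (n $ i)"] n[of i] by simp
    from invariant_add[OF this insert.IH] show ?case using insert.hyps by simp
  qed
  from this[of UNIV] have "AE x in M. F (T (\<Sum>i\<in>UNIV. axis i (n $ i)) x) = F x" by simp
  moreover have "(\<Sum>i\<in>UNIV. axis i (n $ i)) = n"
    by (simp add: vec_eq_iff axis_def sum.delta)
  ultimately show ?thesis by simp
qed

end

context sparse_action
begin

text \<open>Truncation at a height \<open>K\<close> costs half of \<open>e\<close> and supplies the
  bounded function that the L^2 argument requires.\<close>

lemma null_invariant_approximation:
  assumes f: "integrable M f" and e: "e > 0"
  obtains h F where "h \<in> null_functions" "integrable M F"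
    "\<And>n. (\<And>i. 0 \<le> n $ i) \<Longrightarrow> AE x in M. F (T n x) = F x" "(\<integral>x. \<bar>f x - h x - F x\<bar> \<partial>M) < e"
proof -
  have [measurable]: "f \<in> borel_measurable M" using f by simp
  define g where "g = (\<lambda>K x. if \<bar>f x\<bar> \<le> real K then f x else 0)"
  have g_meas [measurable]: "g K \<in> borel_measurable M" for K unfolding g_def by measurable
  have g_bm: "bounded_measurable (g K)" for K
  proof -
    have "\<bar>g K x\<bar> \<le> real K" for x by (simp add: g_def)
    then show ?thesis using g_meas[of K] by (auto simp: bounded_measurable_def)
  qed
  have "(\<lambda>K. \<integral>x. \<bar>f x - g K x\<bar> \<partial>M) \<longlonglongrightarrow> (\<integral>x. 0 \<partial>M)"
  proof (rule integral_dominated_convergence[where w = "\<lambda>x. \<bar>f x\<bar>"])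
    show "AE x in M. (\<lambda>K. \<bar>f x - g K x\<bar>) \<longlonglongrightarrow> 0"
    proof (rule AE_I2)
      fix x
      obtain K0 where "\<bar>f x\<bar> \<le> real K0" using real_arch_simple by blast
      then have "eventually (\<lambda>K. \<bar>f x - g K x\<bar> = 0) sequentially"
        by (intro eventually_sequentiallyI[of K0]) (auto simp: g_def)
      then show "(\<lambda>K. \<bar>f x - g K x\<bar>) \<longlonglongrightarrow> 0" by (rule tendsto_eventually)
    qed
  qed (use f in \<open>auto simp: g_def\<close>)
  then have "(\<lambda>K. \<integral>x. \<bar>f x - g K x\<bar> \<partial>M) \<longlonglongrightarrow> 0" by simp
  then have "eventually (\<lambda>K. (\<integral>x. \<bar>f x - g K x\<bar> \<partial>M) < e / 2) sequentially"
    by (rule order_tendstoD(2)) (use e in simp)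
  then obtain K where K: "(\<integral>x. \<bar>f x - g K x\<bar> \<partial>M) < e / 2" by (auto simp: eventually_sequentially)
  obtain h F where hF: "h \<in> null_functions" "integrable M F"
    "\<And>n. n \<in> range (\<lambda>i. axis i 1) \<Longrightarrow> AE x in M. F (T n x) = F x"
    "(\<integral>x. \<bar>g K x - h x - F x\<bar> \<partial>M) < e / 2"
  proof (rule mean_ergodic_decomposition[where \<N> = null_functions and G = "range (\<lambda>i. axis i 1)"
        and f = "g K" and e = "e / 2"])
    show "null_functions \<noteq> {}" using coboundary_null[OF g_bm[of 0]] by blast
    show "\<And>g n. n \<in> range (\<lambda>i. axis i 1) \<Longrightarrow> bounded_measurable g \<Longrightarrow> (\<lambda>x. g (T n x) - g x) \<in> null_functions"
      using coboundary_null by blast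
  qed (use g_bm e null_functions_add null_functions_scale in \<open>auto simp: null_functions_def\<close>)
  have h_int: "integrable M h"
    using hF(1) by (auto simp: null_functions_def intro: bounded_measurable_imp_integrable)
  have g_int: "integrable M (g K)" by (intro bounded_measurable_imp_integrable g_bm)
  have "(\<integral>x. \<bar>f x - h x - F x\<bar> \<partial>M) \<le> (\<integral>x. \<bar>f x - g K x\<bar> + \<bar>g K x - h x - F x\<bar> \<partial>M)"
    using f h_int g_int hF(2) by (intro integral_mono) auto
  also have "\<dots> = (\<integral>x. \<bar>f x - g K x\<bar> \<partial>M) + (\<integral>x. \<bar>g K x - h x - F x\<bar> \<partial>M)"
    using f h_int g_int hF(2) by (intro Bochner_Integration.integral_add) auto
  also have "\<dots> < e" using K hF(4) by linarith
  finally have le: "(\<integral>x. \<bar>f x - h x - F x\<bar> \<partial>M) < e" .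
  have inv: "AE x in M. F (T n x) = F x" if "\<And>i. 0 \<le> n $ i" for n
    by (rule invariant_nonneg[OF hF(3)[OF rangeI] that])
  show ?thesis by (rule that[OF hF(1,2) inv le])
qed

text \<open>Banach's principle: the averages of the null part tend to 0, those of the invariant part
  are constant in \<open>N\<close>, and the maximal inequality controls the remainder
  \<open>r\<close> in probability by its L^1 norm, which is arbitrarily small.\<close>

theorem enum_averages_converge_real:
  assumes a: "norm_ordered_enumeration a support" and f: "integrable M f"
  shows "AE x in M. convergent (\<lambda>N. (\<Sum>k=1..N. f (T (a k) x)) / real N)"
proof -
  obtain c where c: "c > 0" "\<And>f t. integrable M f \<Longrightarrow> (\<And>x. f x \<ge> 0) \<Longrightarrow> t > 0 \<Longrightarrow>
       prob {x \<in> space M. \<exists>N\<ge>1. c * t < (\<Sum>k=1..N. f (T (a k) x)) / real N} \<le> c * (\<integral>x. f x \<partial>M) / t"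
    using enum_maximal[OF a] by blast
  define avg where "avg = (\<lambda>g N x. (\<Sum>k=1..N. g (T (a k) x)) / real N :: real)"
  have avg_meas [measurable]: "avg g N \<in> borel_measurable M" if "g \<in> borel_measurable M" for g N
    using that unfolding avg_def by measurable
  have f_meas [measurable]: "f \<in> borel_measurable M" using f by simp
  define Good where "Good = (\<lambda>t x. \<exists>N0. \<forall>N\<ge>N0. \<forall>N'\<ge>N0. \<bar>avg f N x - avg f N' x\<bar> \<le> t)"
  have Bad_sets: "{x \<in> space M. \<not> Good t x} \<in> sets M" for t unfolding Good_def by measurable
  have small: "prob {x \<in> space M. \<not> Good t x} \<le> 4 * c\<^sup>2 * e / t" if t: "t > 0" and e: "e > 0" for t e
  proof -
    obtain h F where hF: "h \<in> null_functions" "integrable M F"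
      "\<And>n. (\<And>i. 0 \<le> n $ i) \<Longrightarrow> AE x in M. F (T n x) = F x" "(\<integral>x. \<bar>f x - h x - F x\<bar> \<partial>M) < e"
      using null_invariant_approximation[OF f e] by blast
    define r where "r = (\<lambda>x. \<bar>f x - h x - F x\<bar>)"
    have h_int: "integrable M h"
      using hF(1) by (auto simp: null_functions_def intro: bounded_measurable_imp_integrable)
    have r: "integrable M r" "\<And>x. r x \<ge> 0" unfolding r_def using f h_int hF(2) by auto
    have r_meas [measurable]: "r \<in> borel_measurable M" using r by simp
    \<comment> \<open>Off \<open>?E\<close> the remainder then contributes at most
      \<open>t / 4\<close>. With another \<open>t / 4\<close> for the null part, late averages are
      within \<open>t / 2\<close> of \<open>F x\<close> and so within \<open>t\<close> of each
      other.\<close>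
    define s where "s = t / (4 * c)"
    have s: "s > 0" using t c by (simp add: s_def)
    let ?E = "{x \<in> space M. \<exists>N\<ge>1. c * s < avg r N x}"
    have E_sets: "?E \<in> sets M" by measurable
    have "AE x in M. F (T (a k) x) = F x" if k: "k \<ge> 1" for k
    proof (rule hF(3))
      fix i show "0 \<le> a k $ i" using support_pos[OF enum_mem[OF a k], of i] by simp
    qed
    then have "AE x in M. \<forall>k\<in>{1..}. F (T (a k) x) = F x"
      by (subst AE_ball_countable) auto
    moreover have "AE x in M. (\<lambda>N. avg h N x) \<longlonglongrightarrow> 0"
      unfolding avg_def by (rule null_average_tendsto_0[OF a hF(1)])
    ultimately have "AE x in M. x \<in> {x \<in> space M. \<not> Good t x} \<longrightarrow> x \<in> ?E"
    proof eventually_elim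
      case (elim x)
      show ?case
      proof (intro impI, rule ccontr)
        assume bad: "x \<in> {x \<in> space M. \<not> Good t x}" and "x \<notin> ?E"
        then have rs: "avg r N x \<le> t / 4" if "N \<ge> 1" for N
          using that c by (auto simp: s_def not_less)
        have F: "avg F N x = F x" if "N \<ge> 1" for N
          using elim(1) that by (simp add: avg_def)
        have dec: "\<bar>avg f N x - avg h N x - avg F N x\<bar> \<le> avg r N x" for N
        proof -
          have "avg f N x - avg h N x - avg F N x = (\<Sum>k=1..N. f (T (a k) x) - h (T (a k) x) - F (T (a k) x)) / real N"
            unfolding avg_def by (simp add: sum_subtractf diff_divide_distrib)
          then have "\<bar>avg f N x - avg h N x - avg F N x\<bar> = \<bar>\<Sum>k=1..N. f (T (a k) x) - h (T (a k) x) - F (T (a k) x)\<bar> / real N"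
            by simp
          also have "\<dots> \<le> avg r N x" unfolding avg_def r_def by (intro divide_right_mono sum_abs) auto
          finally show ?thesis .
        qed
        have "eventually (\<lambda>N. \<bar>avg h N x\<bar> < t / 4) sequentially"
          using order_tendstoD(2)[OF tendsto_rabs_zero[OF elim(2)], of "t / 4"] t by simp
        then obtain N0 where N0: "\<And>N. N \<ge> N0 \<Longrightarrow> \<bar>avg h N x\<bar> < t / 4"
          by (auto simp: eventually_sequentially)
        have near: "\<bar>avg f N x - F x\<bar> \<le> t / 2" if "N \<ge> max 1 N0" for N
          using dec[of N] rs[of N] F[of N] N0[of N] that by linarith
        have "Good t x" unfolding Good_def
        proof (intro exI[of _ "max 1 N0"] allI impI)
          fix N N' assume "max 1 N0 \<le> N" "max 1 N0 \<le> N'"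
          then show "\<bar>avg f N x - avg f N' x\<bar> \<le> t" using near[of N] near[of N'] by linarith
        qed
        then show False using bad by blast
      qed
    qed
    then have "prob {x \<in> space M. \<not> Good t x} \<le> prob ?E"
      using E_sets by (intro finite_measure_mono_AE) auto
    also have "\<dots> \<le> c * (\<integral>x. r x \<partial>M) / s" unfolding avg_def by (rule c(2)[OF r s])
    also have "\<dots> \<le> c * e / s" using hF(4) c s by (intro divide_right_mono mult_left_mono) (auto simp: r_def)
    also have "\<dots> = 4 * c\<^sup>2 * e / t" using c t by (simp add: s_def power2_eq_square field_simps)
    finally show ?thesis .
  qed
  have null: "AE x in M. Good t x" if t: "t > 0" for t
  proof -
    have "prob {x \<in> space M. \<not> Good t x} \<le> 0"
    proof (rule field_le_epsilon)
      fix e :: real assume e: "e > 0"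
      have "prob {x \<in> space M. \<not> Good t x} \<le> 4 * c\<^sup>2 * (e * t / (4 * c\<^sup>2)) / t"
        using e t c by (intro small) auto
      then show "prob {x \<in> space M. \<not> Good t x} \<le> 0 + e" using c t by simp
    qed
    then have "prob {x \<in> space M. \<not> Good t x} = 0" by (simp add: measure_le_0_iff)
    then have "{x \<in> space M. \<not> Good t x} \<in> null_sets M"
      using Bad_sets by (simp add: null_sets_def emeasure_eq_measure)
    then show ?thesis by (rule AE_I') simp
  qed
  have "AE x in M. \<forall>n. Good (1 / real (Suc n)) x"
    by (subst AE_all_countable) (auto intro!: null)
  then show ?thesis
  proof eventually_elim
    case (elim x)
    have "Cauchy (\<lambda>N. avg f N x)"
    proof (rule metric_CauchyI)
      fix e :: real assume "e > 0"
      then obtain n where n: "1 / real (Suc n) < e" using nat_approx_posE by blast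
      from elim obtain N0 where "\<forall>N\<ge>N0. \<forall>N'\<ge>N0. \<bar>avg f N x - avg f N' x\<bar> \<le> 1 / real (Suc n)"
        unfolding Good_def by blast
      then show "\<exists>N0. \<forall>N\<ge>N0. \<forall>N'\<ge>N0. dist (avg f N x) (avg f N' x) < e"
        using n unfolding dist_real_def by (meson le_less_trans)
    qed
    then show ?case unfolding avg_def by (rule Cauchy_convergent)
  qed
qed

end

context sparse_set
begin

theorem L1_averages_converge_support:
  fixes M :: "'x measure"
  assumes a: "norm_ordered_enumeration a support" and M: "prob_space M"
  shows "L1_averages_converge a M"
  unfolding L1_averages_converge_def
proof (intro allI impI)
  fix T :: "int ^ 'd \<Rightarrow> 'x \<Rightarrow> 'x" and f :: "'x \<Rightarrow> complex"
  assume T: "measure_preserving_action M T" and f: "integrable M f"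
  interpret sparse_action M T \<alpha> C X
    using M T sparse_set_axioms
    by (intro sparse_action.intro mp_action.intro mp_action_axioms.intro)
  have "AE x in M. convergent (\<lambda>N. (\<Sum>k=1..N. Re (f (T (a k) x))) / real N)"
    using f by (intro enum_averages_converge_real[OF a]) auto
  moreover have "AE x in M. convergent (\<lambda>N. (\<Sum>k=1..N. Im (f (T (a k) x))) / real N)"
    using f by (intro enum_averages_converge_real[OF a]) auto
  ultimately show "AE x in M. convergent (\<lambda>N. ergodic_average a T f N x)"
  proof eventually_elim
    case (elim x)
    then obtain u v where uv: "(\<lambda>N. (\<Sum>k=1..N. Re (f (T (a k) x))) / real N) \<longlonglongrightarrow> u"
      "(\<lambda>N. (\<Sum>k=1..N. Im (f (T (a k) x))) / real N) \<longlonglongrightarrow> v" by (auto simp: convergent_def)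
    have "ergodic_average a T f N x
        = Complex ((\<Sum>k=1..N. Re (f (T (a k) x))) / real N) ((\<Sum>k=1..N. Im (f (T (a k) x))) / real N)" for N
      unfolding ergodic_average_def
      by (intro complex_eqI) (simp_all add: Re_divide_of_nat Im_divide_of_nat)
    then show ?case using tendsto_Complex[OF uv] by (auto simp: convergent_def)
  qed
qed

end

section \<open>The probabilistic estimates\<close>

lemma exp_le_quadratic:
  assumes "\<bar>x\<bar> \<le> (1::real)"
  shows "exp x \<le> 1 + x + x\<^sup>2"
proof (cases "x \<ge> 0")
  case True
  then show ?thesis using assms by (intro exp_bound) auto
next
  case False
  define y where "y = - x"
  have y: "0 < y" "y \<le> 1" using False assms by (auto simp: y_def)
  \<comment> \<open>The product equals \<open>1 + y ^ 3\<close>.\<close>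
  have "1 \<le> (1 - y + y\<^sup>2) * (1 + y)" using y by (simp add: algebra_simps power2_eq_square)
  also have "\<dots> \<le> (1 - y + y\<^sup>2) * exp y"
  proof (intro mult_left_mono)
    show "1 + y \<le> exp y" by (rule exp_ge_add_one_self)
    show "0 \<le> 1 - y + y\<^sup>2" using y by simp
  qed
  finally have "exp (- y) \<le> 1 - y + y\<^sup>2" by (simp add: exp_minus field_simps)
  then show ?thesis by (simp add: y_def)
qed

section \<open>Exponential moments and tails of sums of independent variables\<close>

context prob_space
begin

lemma exp_moment_le:
  fixes Y :: "'i \<Rightarrow> 'a \<Rightarrow> real"
  assumes I: "finite I" and ind: "indep_vars (\<lambda>_. borel) Y I"
    and Y: "\<And>i \<omega>. i \<in> I \<Longrightarrow> \<omega> \<in> space M \<Longrightarrow> 0 \<le> Y i \<omega> \<and> Y i \<omega> \<le> 1"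
    and s: "\<bar>s\<bar> \<le> 1"
  shows "integrable M (\<lambda>\<omega>. exp (s * (\<Sum>i\<in>I. Y i \<omega> - expectation (Y i))))"
    and "expectation (\<lambda>\<omega>. exp (s * (\<Sum>i\<in>I. Y i \<omega> - expectation (Y i)))) \<le> exp (s\<^sup>2 * (\<Sum>i\<in>I. expectation (Y i)))"
proof -
  have meas [measurable]: "Y i \<in> borel_measurable M" if "i \<in> I" for i
    using ind that by (auto simp: indep_vars_def)
  have Y_int: "integrable M (Y i)" if "i \<in> I" for i
    using that Y by (intro integrable_const_bound[where B = 1]) (auto intro!: AE_I2)
  define Z where "Z = (\<lambda>i \<omega>. exp (s * (Y i \<omega> - expectation (Y i))))"
  have E01: "0 \<le> expectation (Y i)" if "i \<in> I" for i
    using that Y by (intro Bochner_Integration.integral_nonneg_AE) (auto intro!: AE_I2)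
  have Z_int: "integrable M (Z i)" if i: "i \<in> I" for i
  proof (rule integrable_const_bound)
    show "AE \<omega> in M. norm (Z i \<omega>) \<le> exp (1 + \<bar>s * expectation (Y i)\<bar>)"
    proof (rule AE_I2)
      fix \<omega> assume "\<omega> \<in> space M"
      then have "\<bar>s * Y i \<omega>\<bar> \<le> 1 * 1" unfolding abs_mult using Y[OF i] s by (intro mult_mono) auto
      then show "norm (Z i \<omega>) \<le> exp (1 + \<bar>s * expectation (Y i)\<bar>)"
        by (simp add: Z_def right_diff_distrib abs_le_iff) linarith
    qed
    show "Z i \<in> borel_measurable M" unfolding Z_def using i by measurable
  qed
  have prod: "exp (s * (\<Sum>i\<in>I. Y i \<omega> - expectation (Y i))) = (\<Prod>i\<in>I. Z i \<omega>)" for \<omega>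
    unfolding Z_def by (simp add: sum_distrib_left exp_sum[OF I])
  have indZ: "indep_vars (\<lambda>_. borel) Z I"
    unfolding Z_def
    by (rule indep_vars_compose2[OF ind, where Y = "\<lambda>i y. exp (s * (y - expectation (Y i)))"]) measurable
  show "integrable M (\<lambda>\<omega>. exp (s * (\<Sum>i\<in>I. Y i \<omega> - expectation (Y i))))"
    unfolding prod by (rule indep_vars_integrable[OF I indZ Z_int])
  have "expectation (\<lambda>\<omega>. exp (s * (\<Sum>i\<in>I. Y i \<omega> - expectation (Y i)))) = (\<Prod>i\<in>I. expectation (Z i))"
    unfolding prod by (rule indep_vars_lebesgue_integral[OF I indZ Z_int])
  also have "\<dots> \<le> (\<Prod>i\<in>I. exp (s\<^sup>2 * expectation (Y i)))"
  proof (intro prod_mono conjI)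
    fix i assume i: "i \<in> I"
    show "0 \<le> expectation (Z i)" by (intro Bochner_Integration.integral_nonneg) (simp add: Z_def)
    let ?m = "expectation (Y i)"
    have "expectation (Z i) \<le> expectation (\<lambda>\<omega>. exp (- s * ?m) * (1 + s * Y i \<omega> + s\<^sup>2 * Y i \<omega>))"
    proof (rule integral_mono[OF Z_int[OF i]])
      show "integrable M (\<lambda>\<omega>. exp (- s * ?m) * (1 + s * Y i \<omega> + s\<^sup>2 * Y i \<omega>))"
        using Y_int[OF i] by simp
      fix \<omega> assume \<omega>: "\<omega> \<in> space M"
      have y: "0 \<le> Y i \<omega>" "Y i \<omega> \<le> 1" using Y[OF i \<omega>] by auto
      have "\<bar>s * Y i \<omega>\<bar> \<le> 1 * 1" unfolding abs_mult using y s by (intro mult_mono) auto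
      then have "exp (s * Y i \<omega>) \<le> 1 + s * Y i \<omega> + (s * Y i \<omega>)\<^sup>2" by (intro exp_le_quadratic) simp
      also have "(s * Y i \<omega>)\<^sup>2 \<le> s\<^sup>2 * Y i \<omega>"
        unfolding power_mult_distrib using y by (intro mult_left_mono) (auto simp: power2_eq_square mult_left_le)
      finally have "exp (s * Y i \<omega>) \<le> 1 + s * Y i \<omega> + s\<^sup>2 * Y i \<omega>" by simp
      moreover have "Z i \<omega> = exp (- s * ?m) * exp (s * Y i \<omega>)"
        unfolding Z_def exp_add[symmetric] by (simp add: right_diff_distrib)
      ultimately show "Z i \<omega> \<le> exp (- s * ?m) * (1 + s * Y i \<omega> + s\<^sup>2 * Y i \<omega>)" by simp
    qed
    also have "\<dots> = exp (- s * ?m) * (1 + (s * ?m + s\<^sup>2 * ?m))"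
      using Y_int[OF i] by (simp add: prob_space algebra_simps)
    also have "\<dots> \<le> exp (- s * ?m) * exp (s * ?m + s\<^sup>2 * ?m)"
      by (intro mult_left_mono exp_ge_add_one_self) simp
    also have "\<dots> = exp (s\<^sup>2 * ?m)" unfolding exp_add[symmetric] by simp
    finally show "expectation (Z i) \<le> exp (s\<^sup>2 * ?m)" .
  qed
  also have "\<dots> = exp (s\<^sup>2 * (\<Sum>i\<in>I. expectation (Y i)))"
    by (simp add: sum_distrib_left exp_sum[OF I])
  finally show "expectation (\<lambda>\<omega>. exp (s * (\<Sum>i\<in>I. Y i \<omega> - expectation (Y i)))) \<le> exp (s\<^sup>2 * (\<Sum>i\<in>I. expectation (Y i)))" .
qed

text \<open>The parameter \<open>s\<close> is left free. It will be the inverse square root of the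
  order of the expected sum, which makes \<open>Q\<close> a constant.\<close>

lemma chernoff_two_sided:
  fixes Y :: "'i \<Rightarrow> 'a \<Rightarrow> real"
  assumes I: "finite I" and ind: "indep_vars (\<lambda>_. borel) Y I"
    and Y: "\<And>i \<omega>. i \<in> I \<Longrightarrow> \<omega> \<in> space M \<Longrightarrow> 0 \<le> Y i \<omega> \<and> Y i \<omega> \<le> 1"
    and s: "0 < s" "s \<le> 1" and Q: "s\<^sup>2 * (\<Sum>i\<in>I. expectation (Y i)) \<le> Q"
  shows "prob {\<omega> \<in> space M. t \<le> \<bar>\<Sum>i\<in>I. Y i \<omega> - expectation (Y i)\<bar>} \<le> 2 * exp (Q - s * t)"
proof -
  have meas [measurable]: "Y i \<in> borel_measurable M" if "i \<in> I" for i
    using ind that by (auto simp: indep_vars_def)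
  define S where "S = (\<lambda>\<omega>. \<Sum>i\<in>I. Y i \<omega> - expectation (Y i))"
  have S_meas [measurable]: "S \<in> borel_measurable M" unfolding S_def by measurable
  have one: "prob {\<omega> \<in> space M. exp (s * t) \<le> exp (r * S \<omega>)} \<le> exp (Q - s * t)" if r: "r = s \<or> r = - s" for r
  proof -
    have r': "\<bar>r\<bar> \<le> 1" "r\<^sup>2 = s\<^sup>2" using r s by auto
    have "prob {\<omega> \<in> space M. exp (s * t) \<le> exp (r * S \<omega>)} \<le> expectation (\<lambda>\<omega>. exp (r * S \<omega>)) / exp (s * t)"
      unfolding S_def using exp_moment_le(1)[OF I ind Y r'(1)]
      by (intro integral_Markov_inequality_measure[where A = "{}"]) auto
    also have "\<dots> \<le> exp Q / exp (s * t)"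
      using exp_moment_le(2)[OF I ind Y r'(1)] Q unfolding S_def r'(2)
      by (intro divide_right_mono) (auto elim: order_trans)
    finally show ?thesis by (simp add: exp_diff)
  qed
  have "prob {\<omega> \<in> space M. t \<le> \<bar>S \<omega>\<bar>}
      \<le> prob ({\<omega> \<in> space M. exp (s * t) \<le> exp (s * S \<omega>)} \<union> {\<omega> \<in> space M. exp (s * t) \<le> exp (- s * S \<omega>)})"
  proof (rule finite_measure_mono)
    show "{\<omega> \<in> space M. t \<le> \<bar>S \<omega>\<bar>}
      \<subseteq> {\<omega> \<in> space M. exp (s * t) \<le> exp (s * S \<omega>)} \<union> {\<omega> \<in> space M. exp (s * t) \<le> exp (- s * S \<omega>)}"
    proof
      fix \<omega> assume \<omega>: "\<omega> \<in> {\<omega> \<in> space M. t \<le> \<bar>S \<omega>\<bar>}"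
      then have "t \<le> S \<omega> \<or> t \<le> - S \<omega>" by auto
      moreover have "s * t \<le> s * z" if "t \<le> z" for z using that s(1) by (intro mult_left_mono) auto
      ultimately have "s * t \<le> s * S \<omega> \<or> s * t \<le> s * (- S \<omega>)" by blast
      then show "\<omega> \<in> {\<omega> \<in> space M. exp (s * t) \<le> exp (s * S \<omega>)} \<union> {\<omega> \<in> space M. exp (s * t) \<le> exp (- s * S \<omega>)}"
        using \<omega> by simp
    qed
  qed measurable
  also have "\<dots> \<le> prob {\<omega> \<in> space M. exp (s * t) \<le> exp (s * S \<omega>)} + prob {\<omega> \<in> space M. exp (s * t) \<le> exp (- s * S \<omega>)}"
    by (intro measure_Un_le) measurable
  also have "\<dots> \<le> exp (Q - s * t) + exp (Q - s * t)"
    using one[of s] one[of "- s"] by (intro add_mono) auto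
  finally show ?thesis by (simp add: S_def)
qed

end

text \<open>\<open>8 ^ j\<close> is the order of the number of windows and shifts at scale
  \<open>j\<close>. With \<open>m \<ge> 4 / g\<close>, the m-th power of y = 2^(g j) is at least
  16^j, and exp y exceeds it up to the constant \<open>real m ^ m\<close>.\<close>

lemma summable_exp_decay:
  fixes g :: real assumes g: "g > 0"
  shows "summable (\<lambda>j. 8 ^ j * exp (- (2 powr (g * real j))))"
proof -
  obtain m :: nat where m: "4 / g \<le> real m" using real_arch_simple by blast
  have m0: "m > 0" using m g by (cases m) (auto simp: divide_le_0_iff)
  show ?thesis
  proof (rule summable_comparison_test')
    show "summable (\<lambda>j. real m ^ m * (1 / 2) ^ j)" by (intro summable_mult summable_geometric) simp
    fix j :: nat
    define y where "y = 2 powr (g * real j)"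
    have y: "y > 0" by (simp add: y_def)
    have "(y / real m) ^ m \<le> (1 + y / real m) ^ m" using y by (intro power_mono) auto
    also have "\<dots> \<le> exp y" using m0 y by (intro exp_ge_one_plus_x_over_n_power_n) auto
    finally have e: "y ^ m / real m ^ m \<le> exp y" by (simp add: power_divide)
    have "4 * real j \<le> g * real j * real m"
    proof -
      have "4 \<le> g * real m" using m g by (simp add: field_simps)
      then have "4 * real j \<le> (g * real m) * real j" by (intro mult_right_mono) auto
      then show ?thesis by (simp add: mult_ac)
    qed
    then have "2 powr (4 * real j) \<le> y ^ m" unfolding y_def by (simp add: powr_power mult_ac)
    moreover have "2 powr (4 * real j) = (16::real) ^ j"
    proof -
      have "2 powr (4 * real j) = (2::real) powr real (4 * j)" by simp
      also have "\<dots> = 2 ^ (4 * j)" by (rule powr_realpow) simp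
      finally show ?thesis by (simp add: power_mult)
    qed
    ultimately have "16 ^ j / real m ^ m \<le> y ^ m / real m ^ m" by (intro divide_right_mono) auto
    then have "16 ^ j / real m ^ m \<le> exp y" using e by linarith
    then have "16 ^ j * exp (- y) \<le> real m ^ m" using m0 by (simp add: exp_minus field_simps)
    moreover have "(16::real) ^ j = 2 ^ j * 8 ^ j" by (simp add: power_mult_distrib[symmetric])
    ultimately have "8 ^ j * exp (- y) \<le> real m ^ m * (1 / 2) ^ j" by (simp add: power_one_over field_simps)
    then show "norm (8 ^ j * exp (- (2 powr (g * real j)))) \<le> real m ^ m * (1 / 2) ^ j"
      by (simp add: y_def)
  qed
qed

section \<open>Concentration and Borel-Cantelli for the random selection\<close>

locale random_selection = prob_space P for P :: "'w measure" +
  fixes \<xi> :: "'d::finite \<Rightarrow> nat \<Rightarrow> 'w \<Rightarrow> real" and \<alpha> :: real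
  assumes \<alpha>: "0 \<le> \<alpha>" "\<alpha> < 1/2"
    and indep: "indep_vars (\<lambda>_. borel) (\<lambda>(i, n). \<xi> i n) (UNIV \<times> {1..})"
    and \<xi>01: "\<And>i n \<omega>. n \<ge> 1 \<Longrightarrow> \<omega> \<in> space P \<Longrightarrow> \<xi> i n \<omega> \<in> {0, 1}"
    and \<xi>_prob: "\<And>i n. n \<ge> 1 \<Longrightarrow> prob {\<omega> \<in> space P. \<xi> i n \<omega> = 1} = real n powr (- \<alpha>)"
begin

lemma \<xi>_measurable [measurable]: "n \<ge> 1 \<Longrightarrow> \<xi> i n \<in> borel_measurable P"
  using indep by (auto simp: indep_vars_def)

lemma \<xi>_integrable:
  assumes n: "n \<ge> 1"
  shows "integrable P (\<xi> i n)"
proof (rule integrable_const_bound)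
  show "AE \<omega> in P. norm (\<xi> i n \<omega>) \<le> 1"
  proof (rule AE_I2)
    fix \<omega> assume "\<omega> \<in> space P"
    from \<xi>01[OF n this, of i] show "norm (\<xi> i n \<omega>) \<le> 1" by auto
  qed
qed (rule \<xi>_measurable[OF n])

lemma expectation_\<xi>:
  assumes n: "n \<ge> 1"
  shows "expectation (\<xi> i n) = wt \<alpha> (int n)"
proof -
  have "expectation (\<xi> i n) = expectation (indicat_real {\<omega> \<in> space P. \<xi> i n \<omega> = 1})"
  proof (rule Bochner_Integration.integral_cong[OF refl])
    fix \<omega> assume "\<omega> \<in> space P"
    then show "\<xi> i n \<omega> = indicat_real {\<omega> \<in> space P. \<xi> i n \<omega> = 1} \<omega>"
      using \<xi>01[OF n, of \<omega> i] by (auto simp: indicator_def)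
  qed
  also have "\<dots> = prob {\<omega> \<in> space P. \<xi> i n \<omega> = 1}"
    by (simp add: Collect_conj_eq Int_ac)
  finally show ?thesis using \<xi>_prob[OF n] by (simp add: wt_def)
qed

lemma expectation_\<xi>_mult:
  assumes nm: "n \<ge> 1" "m \<ge> 1" "n \<noteq> m"
  shows "expectation (\<lambda>\<omega>. \<xi> i n \<omega> * \<xi> i m \<omega>) = wt \<alpha> (int n) * wt \<alpha> (int m)"
proof -
  have ind: "indep_vars (\<lambda>_. borel) (\<lambda>(i, n). \<xi> i n) {(i, n), (i, m)}"
    by (rule indep_vars_subset[OF indep]) (use nm in auto)
  have "expectation (\<lambda>\<omega>. \<Prod>k\<in>{(i, n), (i, m)}. (case k of (i, n) \<Rightarrow> \<xi> i n) \<omega>)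
      = (\<Prod>k\<in>{(i, n), (i, m)}. expectation (case k of (i, n) \<Rightarrow> \<xi> i n))"
    using nm by (intro indep_vars_lebesgue_integral ind) (auto intro: \<xi>_integrable)
  then show ?thesis using nm by (simp add: expectation_\<xi>)
qed

text \<open>The flag chooses between the random variable and its mean, so that all kinds of
  correlation fall under one estimate.\<close>

definition factor :: "bool \<Rightarrow> 'd \<Rightarrow> int \<Rightarrow> 'w \<Rightarrow> real" where
  "factor p i n \<omega> = (if p then \<xi> i (nat n) \<omega> else wt \<alpha> n)"

lemma factor_measurable [measurable]: "n \<ge> 1 \<Longrightarrow> factor p i n \<in> borel_measurable P"
  unfolding factor_def[abs_def] by (cases p) simp_all

lemma factor_bounds:
  assumes n: "n \<ge> 1" and \<omega>: "\<omega> \<in> space P"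
  shows "0 \<le> factor p i n \<omega> \<and> factor p i n \<omega> \<le> 1"
proof -
  have "nat n \<ge> 1" using n by arith
  from \<xi>01[OF this \<omega>, of i] show ?thesis using wt_le_1[OF \<alpha>(1) n] by (auto simp: factor_def)
qed

lemma expectation_factor_mult:
  assumes "n \<ge> 1" "h \<ge> 1"
  shows "expectation (\<lambda>\<omega>. factor p i n \<omega> * factor q i (n + h) \<omega>) = wt \<alpha> n * wt \<alpha> (n + h)"
  using assms expectation_\<xi>_mult[of "nat n" "nat (n + h)" i] expectation_\<xi>[of "nat n" i]
    expectation_\<xi>[of "nat (n + h)" i]
  by (cases p; cases q) (simp_all add: factor_def nat_eq_iff prob_space)

text \<open>
  For \<open>n\<close> ranging over the indices with \<open>n div h\<close> of a fixed parity the pairs \<open>{n, n + h}\<close> are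
  pairwise disjoint.
\<close>

definition parity_class :: "int \<Rightarrow> int \<Rightarrow> int \<Rightarrow> bool \<Rightarrow> int set" where
  "parity_class a b h c = {n\<in>{a<..b}. even (n div h) = c}"

text \<open>Functions of disjoint groups of independent variables are independent. Two pairs
  \<open>{n, n + h}\<close> with different first indices meet only if these differ by exactly
  \<open>h\<close>; then their quotients by \<open>h\<close> differ by 1, which the common parity
  excludes.\<close>

lemma indep_factor_mult:
  assumes a: "a \<ge> 0" and h: "h \<ge> 1"
  shows "indep_vars (\<lambda>_. borel) (\<lambda>n \<omega>. factor p i n \<omega> * factor q i (n + h) \<omega>) (parity_class a b h c)"
proof -
  let ?L = "parity_class a b h c"
  define K where "K = (\<lambda>n. {(i, nat n), (i, nat (n + h))})"
  have pos: "n \<ge> 1" if "n \<in> ?L" for n using that a by (auto simp: parity_class_def)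
  have neq: "n \<noteq> n' + h" if "n \<in> ?L" "n' \<in> ?L" for n n'
  proof
    assume "n = n' + h"
    then have "n div h = n' div h + 1" using h by simp
    then show False using that by (auto simp: parity_class_def)
  qed
  have "disjoint_family_on K ?L"
    unfolding disjoint_family_on_def
  proof (intro ballI impI)
    fix n n' assume n: "n \<in> ?L" "n' \<in> ?L" "n \<noteq> n'"
    then show "K n \<inter> K n' = {}"
      using pos[OF n(1)] pos[OF n(2)] neq[OF n(1,2)] neq[OF n(2,1)] h
      by (auto simp: K_def nat_eq_iff eq_nat_nat_iff)
  qed
  then have R: "indep_vars (\<lambda>n. PiM (K n) (\<lambda>_. borel))
      (\<lambda>n \<omega>. restrict (\<lambda>k. (case k of (i, n) \<Rightarrow> \<xi> i n) \<omega>) (K n)) ?L"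
    using pos h by (intro indep_vars_restrict[OF indep]) (force simp: K_def)+
  define G where "G = (\<lambda>n y. (if p then y (i, nat n) else wt \<alpha> n) * (if q then y (i, nat (n + h)) else wt \<alpha> (n + h)))"
  have "indep_vars (\<lambda>_. borel) (\<lambda>n \<omega>. G n (restrict (\<lambda>k. (case k of (i, n) \<Rightarrow> \<xi> i n) \<omega>) (K n))) ?L"
  proof (rule indep_vars_compose2[OF R])
    fix n
    have "(\<lambda>y. if p then y (i, nat n) else wt \<alpha> n) \<in> borel_measurable (PiM (K n) (\<lambda>_. borel))"
      by (cases p) (auto intro!: measurable_component_singleton simp: K_def)
    moreover have "(\<lambda>y. if q then y (i, nat (n + h)) else wt \<alpha> (n + h)) \<in> borel_measurable (PiM (K n) (\<lambda>_. borel))"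
      by (cases q) (auto intro!: measurable_component_singleton simp: K_def)
    ultimately show "G n \<in> borel_measurable (PiM (K n) (\<lambda>_. borel))"
      unfolding G_def by (rule borel_measurable_times)
  qed
  moreover have "G n (restrict (\<lambda>k. (case k of (i, n) \<Rightarrow> \<xi> i n) \<omega>) (K n))
      = factor p i n \<omega> * factor q i (n + h) \<omega>" for n \<omega>
    by (simp add: G_def factor_def K_def)
  ultimately show ?thesis by simp
qed

definition K0 :: real where "K0 = 1 / (1 - 2 * \<alpha>)"

text \<open>The Chernoff bound with deviation 2^(3/4 (1 - 2 alpha) j) and parameter 2^(-1/2 (1 - 2
  alpha) j); a quarter of the exponent survives in the product.\<close>

definition tail :: "nat \<Rightarrow> real" where
  "tail j = 2 * exp (K0 - 2 powr ((1 - 2 * \<alpha>) / 4 * real j))"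

definition corr_bad :: "nat \<Rightarrow> bool \<Rightarrow> bool \<Rightarrow> bool \<Rightarrow> 'd \<Rightarrow> int \<Rightarrow> int \<Rightarrow> int \<Rightarrow> 'w set" where
  "corr_bad j p q c i a b h = {\<omega> \<in> space P. 2 powr (3/4 * (1 - 2 * \<alpha>) * real j) \<le>
     \<bar>\<Sum>n\<in>parity_class a b h c. factor p i n \<omega> * factor q i (n + h) \<omega> - wt \<alpha> n * wt \<alpha> (n + h)\<bar>}"

definition count_bad :: "nat \<Rightarrow> 'd \<Rightarrow> int \<Rightarrow> int \<Rightarrow> 'w set" where
  "count_bad j i a b = {\<omega> \<in> space P. 2 powr (3/4 * (1 - \<alpha>) * real j) \<le>
     \<bar>\<Sum>n\<in>{a<..b}. \<xi> i (nat n) \<omega> - wt \<alpha> n\<bar>}"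

lemma finite_parity_class [simp, intro]: "finite (parity_class a b h c)"
  unfolding parity_class_def by (rule finite_subset[of _ "{a<..b}"]) auto

lemma prob_corr_bad_le:
  assumes ab: "0 \<le> a" "1 \<le> h" "b \<le> 2 ^ j"
  shows "corr_bad j p q c i a b h \<in> events" "prob (corr_bad j p q c i a b h) \<le> tail j"
proof -
  let ?L = "parity_class a b h c"
  define Y where "Y = (\<lambda>n \<omega>. factor p i n \<omega> * factor q i (n + h) \<omega>)"
  have pos: "n \<ge> 1" if "n \<in> ?L" for n using that ab by (auto simp: parity_class_def)
  have EY: "expectation (Y n) = wt \<alpha> n * wt \<alpha> (n + h)" if "n \<in> ?L" for n
    unfolding Y_def using pos[OF that] ab by (intro expectation_factor_mult) auto
  have Y_meas [measurable]: "Y n \<in> borel_measurable P" if "n \<in> ?L" for n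
    unfolding Y_def using pos[OF that] ab by (intro borel_measurable_times factor_measurable) auto
  have eq: "corr_bad j p q c i a b h = {\<omega> \<in> space P. 2 powr (3/4 * (1 - 2 * \<alpha>) * real j) \<le>
     \<bar>\<Sum>n\<in>?L. Y n \<omega> - expectation (Y n)\<bar>}"
  proof -
    have "(\<Sum>n\<in>?L. Y n \<omega> - expectation (Y n))
        = (\<Sum>n\<in>?L. factor p i n \<omega> * factor q i (n + h) \<omega> - wt \<alpha> n * wt \<alpha> (n + h))" for \<omega>
      by (rule sum.cong[OF refl]) (subst EY, assumption, simp only: Y_def)
    then show ?thesis unfolding corr_bad_def by (simp only:)
  qed
  show "corr_bad j p q c i a b h \<in> events" unfolding eq by measurable
  \<comment> \<open>The inverse square root of the order of the expected sum.\<close>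
  define s where "s = 2 powr (- ((1 - 2 * \<alpha>) / 2 * real j))"
  have "s \<le> 2 powr 0" unfolding s_def using \<alpha> by (intro powr_mono) auto
  then have s: "0 < s" "s \<le> 1" by (simp_all add: s_def)
  have s2: "s\<^sup>2 * 2 powr ((1 - 2 * \<alpha>) * real j) = 1"
    unfolding s_def power2_eq_square powr_add[symmetric] by (simp add: field_simps)
  have "prob {\<omega> \<in> space P. 2 powr (3/4 * (1 - 2 * \<alpha>) * real j) \<le> \<bar>\<Sum>n\<in>?L. Y n \<omega> - expectation (Y n)\<bar>}
      \<le> 2 * exp (K0 - s * 2 powr (3/4 * (1 - 2 * \<alpha>) * real j))"
  proof (rule chernoff_two_sided)
    show "indep_vars (\<lambda>_. borel) Y ?L" unfolding Y_def using ab by (intro indep_factor_mult)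
    show "0 \<le> Y n \<omega> \<and> Y n \<omega> \<le> 1" if "n \<in> ?L" "\<omega> \<in> space P" for n \<omega>
      unfolding Y_def using factor_bounds[of n \<omega> p i] factor_bounds[of "n + h" \<omega> q i] pos[OF that(1)] that(2) ab
      by (auto intro!: mult_le_one)
    have "(\<Sum>n\<in>?L. expectation (Y n)) \<le> (\<Sum>n\<in>?L. (wt \<alpha> n)\<^sup>2)"
    proof (rule sum_mono)
      fix n assume n: "n \<in> ?L"
      have "wt \<alpha> (n + h) \<le> wt \<alpha> n" using pos[OF n] ab \<alpha> by (intro wt_antimono) auto
      then show "expectation (Y n) \<le> (wt \<alpha> n)\<^sup>2"
        unfolding EY[OF n] power2_eq_square by (intro mult_left_mono) auto
    qed
    also have "\<dots> \<le> (\<Sum>n\<in>{a<..b}. (wt \<alpha> n)\<^sup>2)"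
      by (intro sum_mono2) (auto simp: parity_class_def)
    also have "\<dots> \<le> K0 * 2 powr ((1 - 2 * \<alpha>) * real j)"
      unfolding K0_def using \<alpha> ab by (intro sum_wt_sq_dyadic_le) auto
    finally have "s\<^sup>2 * (\<Sum>n\<in>?L. expectation (Y n)) \<le> s\<^sup>2 * (K0 * 2 powr ((1 - 2 * \<alpha>) * real j))"
      by (intro mult_left_mono) auto
    also have "\<dots> = K0 * (s\<^sup>2 * 2 powr ((1 - 2 * \<alpha>) * real j))" by (simp only: mult_ac)
    finally show "s\<^sup>2 * (\<Sum>n\<in>?L. expectation (Y n)) \<le> K0" unfolding s2 by simp
  qed (use s in auto)
  also have "s * 2 powr (3/4 * (1 - 2 * \<alpha>) * real j) = 2 powr ((1 - 2 * \<alpha>) / 4 * real j)"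
  proof -
    have "- ((1 - 2 * \<alpha>) / 2 * real j) + 3/4 * (1 - 2 * \<alpha>) * real j = (1 - 2 * \<alpha>) / 4 * real j"
      by (simp add: field_simps)
    then show ?thesis unfolding s_def powr_add[symmetric] by (simp only:)
  qed
  finally show "prob (corr_bad j p q c i a b h) \<le> tail j" unfolding eq tail_def .
qed

lemma prob_count_bad_le:
  assumes ab: "0 \<le> a" "b \<le> 2 ^ j"
  shows "count_bad j i a b \<in> events" "prob (count_bad j i a b) \<le> tail j"
proof -
  let ?L = "{a<..b}"
  define Y where "Y = (\<lambda>n. \<xi> i (nat n))"
  have pos: "nat n \<ge> 1" if "n \<in> ?L" for n using that ab by auto
  have EY: "expectation (Y n) = wt \<alpha> n" if "n \<in> ?L" for n
  proof -
    have "int (nat n) = n" using that ab by auto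
    then show ?thesis unfolding Y_def using expectation_\<xi>[OF pos[OF that]] by simp
  qed
  have Y_meas [measurable]: "Y n \<in> borel_measurable P" if "n \<in> ?L" for n
    unfolding Y_def using pos[OF that] by simp
  have eq: "count_bad j i a b = {\<omega> \<in> space P. 2 powr (3/4 * (1 - \<alpha>) * real j) \<le>
     \<bar>\<Sum>n\<in>?L. Y n \<omega> - expectation (Y n)\<bar>}"
  proof -
    have "(\<Sum>n\<in>?L. Y n \<omega> - expectation (Y n)) = (\<Sum>n\<in>?L. \<xi> i (nat n) \<omega> - wt \<alpha> n)" for \<omega>
      by (rule sum.cong[OF refl]) (subst EY, assumption, simp only: Y_def)
    then show ?thesis unfolding count_bad_def by (simp only:)
  qed
  show "count_bad j i a b \<in> events" unfolding eq by measurable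
  define s where "s = 2 powr (- ((1 - \<alpha>) / 2 * real j))"
  have "s \<le> 2 powr 0" unfolding s_def using \<alpha> by (intro powr_mono) auto
  then have s: "0 < s" "s \<le> 1" by (simp_all add: s_def)
  have s2: "s\<^sup>2 * 2 powr ((1 - \<alpha>) * real j) = 1"
    unfolding s_def power2_eq_square powr_add[symmetric] by (simp add: field_simps)
  have "prob {\<omega> \<in> space P. 2 powr (3/4 * (1 - \<alpha>) * real j) \<le> \<bar>\<Sum>n\<in>?L. Y n \<omega> - expectation (Y n)\<bar>}
      \<le> 2 * exp (K0 - s * 2 powr (3/4 * (1 - \<alpha>) * real j))"
  proof (rule chernoff_two_sided)
    define K where "K = (\<lambda>n. {(i, nat n)})"
    have "disjoint_family_on K ?L"
      using ab by (auto simp: disjoint_family_on_def K_def eq_nat_nat_iff)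
    then have R: "indep_vars (\<lambda>n. PiM (K n) (\<lambda>_. borel))
        (\<lambda>n \<omega>. restrict (\<lambda>k. (case k of (i, n) \<Rightarrow> \<xi> i n) \<omega>) (K n)) ?L"
      using pos by (intro indep_vars_restrict[OF indep]) (force simp: K_def)+
    have "indep_vars (\<lambda>_. borel) (\<lambda>n \<omega>. restrict (\<lambda>k. (case k of (i, n) \<Rightarrow> \<xi> i n) \<omega>) (K n) (i, nat n)) ?L"
      by (rule indep_vars_compose2[OF R, where Y = "\<lambda>n y. y (i, nat n)"])
        (auto intro!: measurable_component_singleton simp: K_def)
    then show "indep_vars (\<lambda>_. borel) Y ?L" by (simp add: Y_def K_def)
    show "0 \<le> Y n \<omega> \<and> Y n \<omega> \<le> 1" if "n \<in> ?L" "\<omega> \<in> space P" for n \<omega>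
      unfolding Y_def using \<xi>01[OF pos[OF that(1)] that(2), of i] by auto
    have "(\<Sum>n\<in>?L. expectation (Y n)) = (\<Sum>n\<in>?L. wt \<alpha> n)" by (intro sum.cong refl EY)
    also have "\<dots> \<le> 1 / (1 - \<alpha>) * 2 powr ((1 - \<alpha>) * real j)"
      using \<alpha> ab by (intro sum_wt_dyadic_le) auto
    also have "\<dots> \<le> K0 * 2 powr ((1 - \<alpha>) * real j)"
      unfolding K0_def using \<alpha> by (intro mult_right_mono divide_left_mono) auto
    finally have "s\<^sup>2 * (\<Sum>n\<in>?L. expectation (Y n)) \<le> s\<^sup>2 * (K0 * 2 powr ((1 - \<alpha>) * real j))"
      by (intro mult_left_mono) auto
    also have "\<dots> = K0 * (s\<^sup>2 * 2 powr ((1 - \<alpha>) * real j))" by (simp only: mult_ac)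
    finally show "s\<^sup>2 * (\<Sum>n\<in>?L. expectation (Y n)) \<le> K0" unfolding s2 by simp
  qed (use s in auto)
  \<comment> \<open>Counts concentrate even better, with \<open>(1 - \<alpha>) / 4\<close> in the
    exponent; they are weakened to the tail of the correlations.\<close>
  also have "\<dots> \<le> tail j"
  proof -
    have "- ((1 - \<alpha>) / 2 * real j) + 3/4 * (1 - \<alpha>) * real j = (1 - \<alpha>) / 4 * real j"
      by (simp add: field_simps)
    then have e: "s * 2 powr (3/4 * (1 - \<alpha>) * real j) = 2 powr ((1 - \<alpha>) / 4 * real j)"
      unfolding s_def powr_add[symmetric] by (simp only:)
    have "(1 - 2 * \<alpha>) / 4 * real j \<le> (1 - \<alpha>) / 4 * real j" using \<alpha> by (intro mult_right_mono) auto
    then have "(2::real) powr ((1 - 2 * \<alpha>) / 4 * real j) \<le> 2 powr ((1 - \<alpha>) / 4 * real j)" by simp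
    then show ?thesis unfolding tail_def e by simp
  qed
  finally show "prob (count_bad j i a b) \<le> tail j" unfolding eq .
qed

text \<open>All windows and shifts at scale \<open>j\<close> are taken together: their number is
  polynomial in \<open>2 ^ j\<close>, while \<open>tail j\<close> decays faster than any power of
  \<open>2 ^ j\<close>.\<close>

definition bad :: "nat \<Rightarrow> 'w set" where
  "bad j = (\<Union>(i, a, b)\<in>UNIV \<times> {0..2 ^ j} \<times> {0..2 ^ j}. count_bad j i a b) \<union>
     (\<Union>(p, q, c, i, a, b, h)\<in>UNIV \<times> UNIV \<times> UNIV \<times> UNIV \<times> {0..2 ^ j} \<times> {0..2 ^ j} \<times> {1..2 ^ j}.
        corr_bad j p q c i a b h)"

lemma bad_sets: "bad j \<in> events"
  unfolding bad_def
  by (intro sets.Un sets.finite_UN) (auto intro!: prob_corr_bad_le prob_count_bad_le)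

lemma prob_bad_le: "prob (bad j) \<le> (80 * real CARD('d) * exp K0 * 2) * (8 ^ j * exp (- (2 powr ((1 - 2 * \<alpha>) / 4 * real j))))"
proof -
  let ?I = "UNIV \<times> {0..2 ^ j} \<times> {0..2 ^ j} :: ('d \<times> int \<times> int) set"
  let ?J = "UNIV \<times> UNIV \<times> UNIV \<times> UNIV \<times> {0..2 ^ j} \<times> {0..2 ^ j} \<times> {1..2 ^ j} :: (bool \<times> bool \<times> bool \<times> 'd \<times> int \<times> int \<times> int) set"
  have tail0: "tail j \<ge> 0" by (simp add: tail_def)
  have "prob (\<Union>(i, a, b)\<in>?I. count_bad j i a b) \<le> (\<Sum>(i, a, b)\<in>?I. prob (count_bad j i a b))"
    unfolding case_prod_unfold
    by (intro finite_measure_subadditive_finite) (auto intro!: prob_count_bad_le)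
  also have "\<dots> \<le> (\<Sum>(i, a, b)\<in>?I. tail j)"
    by (intro sum_mono) (auto intro!: prob_count_bad_le)
  also have "\<dots> = real (card ?I) * tail j" by simp
  finally have 1: "prob (\<Union>(i, a, b)\<in>?I. count_bad j i a b) \<le> real (card ?I) * tail j" .
  have "prob (\<Union>(p, q, c, i, a, b, h)\<in>?J. corr_bad j p q c i a b h) \<le> (\<Sum>(p, q, c, i, a, b, h)\<in>?J. prob (corr_bad j p q c i a b h))"
    unfolding case_prod_unfold
    by (intro finite_measure_subadditive_finite) (auto intro!: prob_corr_bad_le)
  also have "\<dots> \<le> (\<Sum>(p, q, c, i, a, b, h)\<in>?J. tail j)"
    by (intro sum_mono) (auto intro!: prob_corr_bad_le)
  also have "\<dots> = real (card ?J) * tail j" by simp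
  finally have 2: "prob (\<Union>(p, q, c, i, a, b, h)\<in>?J. corr_bad j p q c i a b h) \<le> real (card ?J) * tail j" .
  have "prob (bad j) \<le> prob (\<Union>(i, a, b)\<in>?I. count_bad j i a b) + prob (\<Union>(p, q, c, i, a, b, h)\<in>?J. corr_bad j p q c i a b h)"
    unfolding bad_def
    by (intro measure_Un_le sets.finite_UN) (auto intro!: prob_corr_bad_le prob_count_bad_le)
  also have "\<dots> \<le> (real (card ?I) + real (card ?J)) * tail j" using 1 2 by (simp add: distrib_right)
  also have "\<dots> \<le> (80 * real CARD('d) * 8 ^ j) * tail j"
  proof (intro mult_right_mono tail0)
    define N where "N = (2::real) ^ j"
    have N: "N \<ge> 1" by (simp add: N_def)
    have nat: "real (nat (2 ^ j + 1)) = N + 1" "real (nat (2 ^ j)) = N"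
      by (simp_all add: N_def of_nat_nat)
    have cI: "real (card ?I) = real CARD('d) * ((N + 1) * (N + 1))"
      unfolding card_cartesian_product of_nat_mult by (simp add: nat[simplified add.commute] N_def)
    have cJ: "real (card ?J) = 8 * real CARD('d) * ((N + 1) * (N + 1) * N)"
      unfolding card_cartesian_product of_nat_mult by (simp add: N_def mult_ac)
    have n1: "(N + 1) * (N + 1) \<le> (2 * N) * (2 * N)" using N by (intro mult_mono) auto
    have "(N + 1) * (N + 1) * 1 \<le> ((2 * N) * (2 * N)) * N" using n1 N by (intro mult_mono) auto
    then have 3: "(N + 1) * (N + 1) \<le> 4 * (N * N * N)" by simp
    have "(N + 1) * (N + 1) * N \<le> ((2 * N) * (2 * N)) * N" using n1 N by (intro mult_right_mono) auto
    then have 4: "(N + 1) * (N + 1) * N \<le> 4 * (N * N * N)" by simp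
    have N3: "N * N * N = 8 ^ j" unfolding N_def power_mult_distrib[symmetric] by simp
    have "real (card ?I) + real (card ?J) \<le> real CARD('d) * (4 * 8 ^ j) + 8 * real CARD('d) * (4 * 8 ^ j)"
      unfolding cI cJ using 3 4 unfolding N3 by (intro add_mono mult_left_mono) auto
    also have "\<dots> \<le> 80 * real CARD('d) * 8 ^ j" by simp
    finally show "real (card ?I) + real (card ?J) \<le> 80 * real CARD('d) * 8 ^ j" .
  qed
  also have "\<dots> = (80 * real CARD('d) * exp K0 * 2) * (8 ^ j * exp (- (2 powr ((1 - 2 * \<alpha>) / 4 * real j))))"
    by (simp add: tail_def exp_diff exp_minus field_simps)
  finally show ?thesis .
qed

lemma abs_sum_le_dyadic:
  fixes f :: "int \<Rightarrow> real"
  assumes "0 \<le> a" "b \<le> 2 ^ j" "\<And>n. n \<in> {a<..b} \<Longrightarrow> \<bar>f n\<bar> \<le> 1"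
  shows "\<bar>\<Sum>n\<in>{a<..b}. f n\<bar> \<le> 2 ^ j"
proof -
  have "\<bar>\<Sum>n\<in>{a<..b}. f n\<bar> \<le> (\<Sum>n\<in>{a<..b}. \<bar>f n\<bar>)" by (rule sum_abs)
  also have "\<dots> \<le> (\<Sum>n\<in>{a<..b}. 1)" by (intro sum_mono assms(3))
  also have "\<dots> \<le> (\<Sum>n\<in>{0<..2 ^ j::int}. 1)" using assms by (intro sum_mono2) auto
  finally show ?thesis by simp
qed

lemma AE_sparse_set: "AE \<omega> in P. \<exists>C. sparse_set \<alpha> C (\<lambda>i n. \<xi> i (nat n) \<omega>)"
proof -
  have "AE \<omega> in P. eventually (\<lambda>j. \<omega> \<in> space P - bad j) sequentially"
  proof (rule borel_cantelli_AE1)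
    show "summable (\<lambda>j. prob (bad j))"
    proof (rule summable_comparison_test')
      show "summable (\<lambda>j. (80 * real CARD('d) * exp K0 * 2) * (8 ^ j * exp (- (2 powr ((1 - 2 * \<alpha>) / 4 * real j)))))"
        using \<alpha> by (intro summable_mult summable_exp_decay) auto
      show "norm (prob (bad j)) \<le> (80 * real CARD('d) * exp K0 * 2) * (8 ^ j * exp (- (2 powr ((1 - 2 * \<alpha>) / 4 * real j))))" for j
        using prob_bad_le[of j] by simp
    qed
  qed (auto simp: bad_sets less_top[symmetric])
  with AE_space show ?thesis
  proof eventually_elim
    case (elim \<omega>)
    then obtain j0 where j0: "\<And>j. j \<ge> j0 \<Longrightarrow> \<omega> \<notin> bad j" by (auto simp: eventually_sequentially)
    \<comment> \<open>The 2 is for the two parity classes; \<open>2 ^ j0\<close> covers the finitely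
      many scales before Borel-Cantelli takes effect, where the trivial bound \<open>2 ^ j\<close>
      is used.\<close>
    define C where "C = 2 + (2::real) ^ j0"
    have C2: "C \<ge> 2" by (simp add: C_def)
    have one_le: "(1::real) \<le> 2 powr x" if "x \<ge> 0" for x using powr_mono[of 0 x 2] that by simp
    have early: "S \<le> C * 2 powr x" if "S \<le> 2 ^ j" "j < j0" "x \<ge> 0" for S x j
    proof -
      have "(2::real) ^ j \<le> 2 ^ j0" using that(2) by (intro power_increasing) auto
      with that(1) have "S \<le> 2 ^ j0" by (rule order_trans)
      also have "\<dots> \<le> C * 1" by (simp add: C_def)
      also have "\<dots> \<le> C * 2 powr x" using C2 one_le[OF that(3)] by (intro mult_left_mono) auto
      finally show ?thesis .
    qed
    have "sparse_set \<alpha> C (\<lambda>i n. \<xi> i (nat n) \<omega>)"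
    proof
      show "0 \<le> \<alpha>" "\<alpha> < 1/2" "0 \<le> C" using \<alpha> C2 by auto
      show "\<xi> i (nat n) \<omega> \<in> {0, 1}" if "1 \<le> n" for n i using \<xi>01[of "nat n" \<omega> i] that elim(1) by simp
      show "\<bar>\<Sum>n\<in>{a<..b}. \<xi> i (nat n) \<omega> - wt \<alpha> n\<bar> \<le> C * 2 powr (3/4 * (1 - \<alpha>) * real j)"
        if ab: "0 \<le> a" "a \<le> b" "b \<le> 2 ^ j" for a b j i
      proof (cases "j < j0")
        case True
        have "\<bar>\<Sum>n\<in>{a<..b}. \<xi> i (nat n) \<omega> - wt \<alpha> n\<bar> \<le> 2 ^ j"
        proof (rule abs_sum_le_dyadic[OF ab(1,3)])
          fix n assume "n \<in> {a<..b}"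
          then have "n \<ge> 1" using ab by auto
          then have "0 \<le> \<xi> i (nat n) \<omega> \<and> \<xi> i (nat n) \<omega> \<le> 1" "wt \<alpha> n \<le> 1"
            using factor_bounds[OF _ elim(1), of n True i] wt_le_1[OF \<alpha>(1), of n]
            by (simp_all add: factor_def)
          then show "\<bar>\<xi> i (nat n) \<omega> - wt \<alpha> n\<bar> \<le> 1" using wt_nonneg[of \<alpha> n] by linarith
        qed
        then show ?thesis using True \<alpha> by (intro early) auto
      next
        case False
        then have "\<omega> \<notin> bad j" using j0 by simp
        then have "\<omega> \<notin> count_bad j i a b" using ab by (fastforce simp: bad_def)
        then have "\<bar>\<Sum>n\<in>{a<..b}. \<xi> i (nat n) \<omega> - wt \<alpha> n\<bar> \<le> 1 * 2 powr (3/4 * (1 - \<alpha>) * real j)"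
          using elim(1) by (simp add: count_bad_def)
        also have "\<dots> \<le> C * 2 powr (3/4 * (1 - \<alpha>) * real j)" using C2 by (intro mult_right_mono) auto
        finally show ?thesis .
      qed
      show "\<bar>\<Sum>n\<in>{a<..b}. u n * v (n + h) - wt \<alpha> n * wt \<alpha> (n + h)\<bar> \<le> C * 2 powr (3/4 * (1 - 2 * \<alpha>) * real j)"
        if ab: "0 \<le> a" "a \<le> b" "1 \<le> h" "b + h \<le> 2 ^ j"
          and uv: "u \<in> {\<lambda>n. \<xi> i (nat n) \<omega>, wt \<alpha>}" "v \<in> {\<lambda>n. \<xi> i (nat n) \<omega>, wt \<alpha>}" for a b h j i u v
      proof -
        obtain p where p: "u = (\<lambda>n. factor p i n \<omega>)"
          using uv(1) by (cases "u = wt \<alpha>") (auto simp: factor_def fun_eq_iff intro: that[of False] that[of True])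
        obtain q where q: "v = (\<lambda>n. factor q i n \<omega>)"
          using uv(2) by (cases "v = wt \<alpha>") (auto simp: factor_def fun_eq_iff intro: that[of False] that[of True])
        let ?f = "\<lambda>n. u n * v (n + h) - wt \<alpha> n * wt \<alpha> (n + h)"
        show ?thesis
        proof (cases "j < j0")
          case True
          have "\<bar>\<Sum>n\<in>{a<..b}. ?f n\<bar> \<le> 2 ^ j"
          proof (rule abs_sum_le_dyadic[OF ab(1)])
            fix n assume "n \<in> {a<..b}"
            then have n: "n \<ge> 1" "n + h \<ge> 1" using ab by auto
            have "0 \<le> u n * v (n + h)" "u n * v (n + h) \<le> 1"
              unfolding p q using factor_bounds[OF n(1) elim(1), of p i] factor_bounds[OF n(2) elim(1), of q i]
              by (auto intro: mult_le_one)
            moreover have "0 \<le> wt \<alpha> n * wt \<alpha> (n + h)" "wt \<alpha> n * wt \<alpha> (n + h) \<le> 1"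
              using n wt_le_1[OF \<alpha>(1)] by (auto intro: mult_le_one)
            ultimately show "\<bar>?f n\<bar> \<le> 1" by linarith
          qed (use ab in auto)
          then show ?thesis using True \<alpha> by (intro early) auto
        next
          case False
          then have nb: "\<omega> \<notin> bad j" using j0 by simp
          have "\<bar>\<Sum>n\<in>parity_class a b h c. ?f n\<bar> \<le> 2 powr (3/4 * (1 - 2 * \<alpha>) * real j)" for c
          proof -
            have "\<omega> \<notin> corr_bad j p q c i a b h"
            proof
              assume "\<omega> \<in> corr_bad j p q c i a b h"
              moreover have "(p, q, c, i, a, b, h) \<in> UNIV \<times> UNIV \<times> UNIV \<times> UNIV \<times> {0..2 ^ j} \<times> {0..2 ^ j} \<times> {1..2 ^ j}"
                using ab by auto
              ultimately have "\<omega> \<in> bad j" unfolding bad_def by (intro UnI2 UN_I[of "(p, q, c, i, a, b, h)"]) auto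
              then show False using nb by simp
            qed
            then show ?thesis using elim(1) by (simp add: corr_bad_def p q)
          qed
          from this[of True] this[of False]
          have "\<bar>(\<Sum>n\<in>parity_class a b h True. ?f n) + (\<Sum>n\<in>parity_class a b h False. ?f n)\<bar>
            \<le> 2 * 2 powr (3/4 * (1 - 2 * \<alpha>) * real j)" by linarith
          also have "(\<Sum>n\<in>parity_class a b h True. ?f n) + (\<Sum>n\<in>parity_class a b h False. ?f n)
            = (\<Sum>n\<in>{a<..b}. ?f n)"
          proof (subst sum.union_disjoint[symmetric])
            show "parity_class a b h True \<inter> parity_class a b h False = {}" by (auto simp: parity_class_def)
            have "parity_class a b h True \<union> parity_class a b h False = {a<..b}" by (auto simp: parity_class_def)
            then show "sum ?f (parity_class a b h True \<union> parity_class a b h False) = sum ?f {a<..b}" by simp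
          qed auto
          also have "2 * 2 powr (3/4 * (1 - 2 * \<alpha>) * real j) \<le> C * 2 powr (3/4 * (1 - 2 * \<alpha>) * real j)"
            using C2 by (intro mult_right_mono) auto
          finally show ?thesis .
        qed
      qed
    qed
    then show ?case by blast
  qed
qed

end

section \<open>Transfer between probability spaces\<close>

text \<open>
  The law of the process \<open>n \<mapsto> f \<circ> T n\<close> is a shift-invariant measure on \<open>int ^ 'd \<Rightarrow> complex\<close>, and
  the averages of its coordinate at \<open>0\<close> along the shift are those of \<open>f\<close> along \<open>T\<close>.
\<close>

lemma L1_averages_converge_transfer:
  fixes a :: "nat \<Rightarrow> int ^ 'd::finite" and M :: "'x measure"
  assumes M: "prob_space M"
    and conv: "\<And>M' :: (int ^ 'd \<Rightarrow> complex) measure. prob_space M' \<Longrightarrow> L1_averages_converge a M'"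
  shows "L1_averages_converge a M"
  unfolding L1_averages_converge_def
proof (intro allI impI)
  fix T :: "int ^ 'd \<Rightarrow> 'x \<Rightarrow> 'x" and f :: "'x \<Rightarrow> complex"
  assume T: "measure_preserving_action M T" and f: "integrable M f"
  have T_meas [measurable]: "T n \<in> M \<rightarrow>\<^sub>M M" for n
    using T by (simp add: measure_preserving_action_def)
  have T_distr: "distr M M (T n) = M" for n
    using T by (simp add: measure_preserving_action_def)
  have TT: "T n (T m x) = T (n + m) x" if "x \<in> space M" for n m x
    using T that by (simp add: measure_preserving_action_def)
  have f_meas [measurable]: "f \<in> borel_measurable M" using f by simp
  define S where "S = (PiM UNIV (\<lambda>_. borel) :: (int ^ 'd \<Rightarrow> complex) measure)"
  define \<Phi> where "\<Phi> = (\<lambda>x n. f (T n x))"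
  define shift where "shift = (\<lambda>(n :: int ^ 'd) (y :: int ^ 'd \<Rightarrow> complex) m. y (m + n))"
  have coord [measurable]: "(\<lambda>y. y n) \<in> borel_measurable S" for n
    unfolding S_def by (rule measurable_component_singleton) simp
  have \<Phi>_meas [measurable]: "\<Phi> \<in> M \<rightarrow>\<^sub>M S"
    unfolding S_def \<Phi>_def by (rule measurable_PiM_single') (auto simp: space_PiM)
  have shift_meas [measurable]: "shift n \<in> S \<rightarrow>\<^sub>M S" for n
  proof -
    have "(\<lambda>y. shift n y m) \<in> borel_measurable S" for m unfolding shift_def by (rule coord)
    then show ?thesis unfolding S_def by (intro measurable_PiM_single') (auto simp: space_PiM)
  qed
  define M' where "M' = distr M S \<Phi>"
  have M': "prob_space M'" unfolding M'_def by (rule prob_space.prob_space_distr[OF M \<Phi>_meas])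
  have equivariant: "shift n (\<Phi> x) = \<Phi> (T n x)" if "x \<in> space M" for n x
    using that by (simp add: shift_def \<Phi>_def TT)
  have "distr M' M' (shift n) = M'" for n
  proof -
    have "distr M' M' (shift n) = distr M' S (shift n)" by (rule distr_cong) (simp_all add: M'_def)
    also have "\<dots> = distr M S (shift n \<circ> \<Phi>)" unfolding M'_def by (rule distr_distr) measurable
    also have "\<dots> = distr M S (\<Phi> \<circ> T n)" by (rule distr_cong) (simp_all add: equivariant)
    also have "\<dots> = distr (distr M M (T n)) S \<Phi>" by (rule distr_distr[symmetric]) measurable
    finally show ?thesis by (simp add: T_distr M'_def)
  qed
  then have shift_action: "measure_preserving_action M' shift"
    unfolding measure_preserving_action_def using shift_meas
    by (auto simp: M'_def shift_def add.assoc add.commute add.left_commute)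
  \<comment> \<open>The coordinate at 0 corresponds to \<open>f\<close> composed with
    \<open>T 0\<close>, not to \<open>f\<close>; its integrability comes from the invariance of the
    measure.\<close>
  have "integrable (distr M M (T 0)) f" using f by (simp add: T_distr)
  then have "integrable M (\<lambda>x. f (T 0 x))" by (rule integrable_distr[OF T_meas])
  then have int0: "integrable M' (\<lambda>y. y 0)"
    unfolding M'_def integrable_distr_eq[OF \<Phi>_meas coord] by (simp add: \<Phi>_def)
  have "AE y in M'. convergent (\<lambda>N. ergodic_average a shift (\<lambda>y. y 0) N y)"
    using conv[OF M'] shift_action int0 unfolding L1_averages_converge_def by blast
  then have "AE x in M. convergent (\<lambda>N. ergodic_average a shift (\<lambda>y. y 0) N (\<Phi> x))"
    unfolding M'_def by (rule AE_distrD[OF \<Phi>_meas])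
  then show "AE x in M. convergent (\<lambda>N. ergodic_average a T f N x)"
    by (simp add: ergodic_average_def shift_def \<Phi>_def)
qed

lemma (in random_selection) AE_good_outcomes: "AE \<omega> in P. \<omega> \<in> good_outcomes P \<xi>"
  using AE_sparse_set AE_space
proof eventually_elim
  case (elim \<omega>)
  then obtain C where "sparse_set \<alpha> C (\<lambda>i n. \<xi> i (nat n) \<omega>)" by blast
  then interpret sparse_set \<alpha> C "\<lambda>i n. \<xi> i (nat n) \<omega>" .
  have "support = random_set \<xi> \<omega>" by (simp add: support_def random_set_def)
  then show ?case using elim L1_averages_converge_support by (auto simp: good_outcomes_def)
qed

theorem corollary3p5:
  fixes P :: "'w measure" and \<xi> :: "'d::finite \<Rightarrow> nat \<Rightarrow> 'w \<Rightarrow> real" and \<alpha> :: real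
  assumes "prob_space P"
    and "0 \<le> \<alpha>" and "\<alpha> < 1/2"
    and "prob_space.indep_vars P (\<lambda>_. borel) (\<lambda>(i, n). \<xi> i n) (UNIV \<times> {1..})"
    and "\<And>i n \<omega>. n \<ge> 1 \<Longrightarrow> \<omega> \<in> space P \<Longrightarrow> \<xi> i n \<omega> \<in> {0, 1}"
    and "\<And>i n. n \<ge> 1 \<Longrightarrow> measure P {\<omega> \<in> space P. \<xi> i n \<omega> = 1} = real n powr (- \<alpha>)"
  shows "(\<exists>\<Omega>\<^sub>0\<in>sets P. measure P \<Omega>\<^sub>0 = 1 \<and> \<Omega>\<^sub>0 \<subseteq> good_outcomes P \<xi>) \<and>
         (\<forall>\<omega>\<in>good_outcomes P \<xi>. \<forall>a. norm_ordered_enumeration a (random_set \<xi> \<omega>) \<longrightarrow>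
            (\<forall>M :: 'x measure. prob_space M \<longrightarrow> L1_averages_converge a M))"
proof
  interpret prob_space P by (rule assms(1))
  interpret random_selection P \<xi> \<alpha>
    by unfold_locales (use assms in auto)
  \<comment> \<open>\<open>good_outcomes\<close> need not be measurable, so the set of probability 1
    is the complement of a null set that contains all other outcomes.\<close>
  obtain N where N: "{\<omega> \<in> space P. \<omega> \<notin> good_outcomes P \<xi>} \<subseteq> N" "N \<in> null_sets P"
    using AE_good_outcomes by (auto elim!: AE_E3 simp: eventually_ae_filter)
  show "\<exists>\<Omega>\<^sub>0\<in>sets P. measure P \<Omega>\<^sub>0 = 1 \<and> \<Omega>\<^sub>0 \<subseteq> good_outcomes P \<xi>"
  proof (intro bexI conjI)
    have "prob N = 0" using N(2) by (simp add: null_sets_def emeasure_eq_measure)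
    then show "prob (space P - N) = 1" using N(2) by (subst prob_compl) auto
  qed (use N in auto)
  show "\<forall>\<omega>\<in>good_outcomes P \<xi>. \<forall>a. norm_ordered_enumeration a (random_set \<xi> \<omega>) \<longrightarrow>
      (\<forall>M :: 'x measure. prob_space M \<longrightarrow> L1_averages_converge a M)"
    using L1_averages_converge_transfer by (auto simp: good_outcomes_def)
qed

end
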